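(* Let $\mathcal{P}$ be a finite-volume non-obtuse hyperbolic polyhedron with exactly $N_4$ vertices of degree $4$ and exactly $N_3$ vertices of degree $3$. Then $$\mathrm{Vol}(\mathcal{P}) < \frac{2N_4 + 3 N_3 -2}{4} \cdot V_8 + \frac{15N_3 + 20 N_4}{16} \cdot V_3.$$
   Context: A hyperbolic polyhedron is the closure in $\mathbb{H}^3$ of a non-empty intersection of finitely many open hyperbolic half-spaces; it is non-obtuse if all its dihedral angles lie in $(0,\pi/2]$. Vertices may be finite or ideal (ideal vertices count as vertices of the $1$-skeleton), and in the finite-volume non-obtuse case all vertices have degree $3$ or $4$. $V_8\approx 3.66386$ is the volume of the right-angled ideal hyperbolic octahedron and $V_3\approx 1.01494$ that of the regular ideal hyperbolic tetrahedron. *)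

theory Defs
  imports "HOL-Analysis.Analysis"
begin

text \<open>
  Hyperbolic 3-space is represented by the Klein (projective) model: the open unit ball of
  Euclidean 3-space with the Riemannian metric \<open>klein_metric\<close>; its sphere at infinity is the
  unit sphere. Geodesics are Euclidean chords and hyperbolic planes are the non-empty
  intersections of Euclidean planes with the ball. Hence hyperbolic convexity is Euclidean
  convexity, and the faces, facets and edges of a hyperbolic polyhedron are those given by
  \<^const>\<open>face_of\<close>, \<^const>\<open>facet_of\<close> and \<^const>\<open>edge_of\<close>.
\<close>

definition hyp3 :: "(real^3) set" where
  "hyp3 = ball 0 1"

definition klein_metric :: "real^3 \<Rightarrow> real^3 \<Rightarrow> real^3 \<Rightarrow> real" where
  "klein_metric x u v =
     (u \<bullet> v) / (1 - (norm x)\<^sup>2) + (x \<bullet> u) * (x \<bullet> v) / (1 - (norm x)\<^sup>2)\<^sup>2"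

definition hyp_angle :: "real^3 \<Rightarrow> real^3 \<Rightarrow> real^3 \<Rightarrow> real" where
  "hyp_angle x u v =
     arccos (klein_metric x u v / sqrt (klein_metric x u u * klein_metric x v v))"

definition hyp_volume_density :: "real^3 \<Rightarrow> real" where
  "hyp_volume_density x =
     sqrt (det ((\<chi> i j. klein_metric x (axis i 1) (axis j 1)) :: real^3^3))"

lemma hyp_volume_density_eq:
  assumes "x \<in> hyp3"
  shows "hyp_volume_density x = 1 / (1 - (norm x)\<^sup>2)\<^sup>2"
proof -
  define s where "s = 1 - (norm x)\<^sup>2"
  have s: "s > 0"
    using assms by (simp add: s_def hyp3_def abs_square_less_1)
  have n: "(norm x)\<^sup>2 = x$1 * x$1 + x$2 * x$2 + x$3 * x$3"
    by (simp add: power2_norm_eq_inner inner_vec_def sum_3)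
  have e: "x$3 * x$3 = 1 - s - x$1 * x$1 - x$2 * x$2"
    using n by (simp add: s_def)
  have m: "klein_metric x (axis i 1) (axis j 1) =
      ((if i = j then s else 0) + x$i * x$j) / s\<^sup>2" for i j
  proof -
    have "axis i (1::real) \<bullet> axis j 1 = (if i = j then 1 else 0)"
      by (simp add: inner_axis_axis)
    then show ?thesis
      using s unfolding klein_metric_def s_def[symmetric]
      by (simp add: inner_axis add_divide_distrib power2_eq_square)
  qed
  let ?M = "(\<chi> i j. klein_metric x (axis i 1) (axis j 1)) :: real^3^3"
  let ?a = "x$1" and ?b = "x$2" and ?c = "x$3"
  have "det ?M = ((s + ?a*?a) * (s + ?b*?b) * (s + ?c*?c) + 2 * (?a*?b) * (?b*?c) * (?a*?c)
      - (s + ?a*?a) * (?b*?c)\<^sup>2 - (s + ?b*?b) * (?a*?c)\<^sup>2 - (s + ?c*?c) * (?a*?b)\<^sup>2) / s^6"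
    using s by (simp add: det_3 m field_simps power2_eq_square eval_nat_numeral)
  also have "\<dots> = s\<^sup>2 * (s + (?a*?a + ?b*?b + ?c*?c)) / s^6"
    by (simp add: algebra_simps power2_eq_square)
  also have "\<dots> = (1 / s\<^sup>2)\<^sup>2"
    using s by (simp add: e field_simps eval_nat_numeral)
  finally have "det ?M = (1 / s\<^sup>2)\<^sup>2" .
  hence "hyp_volume_density x = 1 / s\<^sup>2"
    unfolding hyp_volume_density_def by simp
  thus ?thesis by (simp add: s_def)
qed

definition hyp_measure :: "(real^3) measure" where
  "hyp_measure = density lborel (\<lambda>x. ennreal (hyp_volume_density x) * indicator hyp3 x)"

definition hyp_volume :: "(real^3) set \<Rightarrow> real" where
  "hyp_volume S = measure hyp_measure S"

text \<open>The condition \<open>\<bar>b\<bar> < norm a\<close> says that the bounding plane meets the open ball.\<close>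

definition open_hyp_halfspace :: "(real^3) set \<Rightarrow> bool" where
  "open_hyp_halfspace H \<longleftrightarrow> (\<exists>a b. \<bar>b\<bar> < norm a \<and> H = {x \<in> hyp3. a \<bullet> x < b})"

definition hyp_polyhedron :: "(real^3) set \<Rightarrow> bool" where
  "hyp_polyhedron P \<longleftrightarrow>
     (\<exists>\<H>. finite \<H> \<and> (\<forall>H\<in>\<H>. open_hyp_halfspace H) \<and> hyp3 \<inter> \<Inter>\<H> \<noteq> {} \<and>
          P = (top_of_set hyp3) closure_of (hyp3 \<inter> \<Inter>\<H>))"

definition finite_hyp_volume :: "(real^3) set \<Rightarrow> bool" where
  "finite_hyp_volume P \<longleftrightarrow> emeasure hyp_measure P < \<infinity>"

text \<open>
  The interior dihedral angle at an edge \<open>e\<close> is measured, at a point \<open>x\<close> of \<open>e\<close>, between the two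
  tangent vectors \<open>u\<close> and \<open>v\<close> perpendicular to \<open>e\<close> that point into the adjacent facets \<open>F\<close> and
  \<open>G\<close>. It does not depend on \<open>x\<close>, \<open>u\<close>, \<open>v\<close>.
\<close>

definition dihedral_angles :: "(real^3) set \<Rightarrow> real set" where
  "dihedral_angles P =
     {hyp_angle x u v | x u v. \<exists>F G e.
        F facet_of P \<and> G facet_of P \<and> F \<noteq> G \<and> e edge_of P \<and> e \<subseteq> F \<inter> G \<and>
        x \<in> rel_interior e \<and> u \<noteq> 0 \<and> v \<noteq> 0 \<and> x + u \<in> F \<and> x + v \<in> G \<and>
        (\<forall>y\<in>e. klein_metric x u (y - x) = 0 \<and> klein_metric x v (y - x) = 0)}"

definition non_obtuse :: "(real^3) set \<Rightarrow> bool" where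
  "non_obtuse P \<longleftrightarrow> dihedral_angles P \<subseteq> {0<..pi/2}"

definition finite_vertices :: "(real^3) set \<Rightarrow> (real^3) set" where
  "finite_vertices P = {v. v extreme_point_of P}"

text \<open>
  A polyhedron of finite volume meets the sphere at infinity only in its ideal vertices.
  For infinite volume this set may contain further points.
\<close>

definition ideal_vertices :: "(real^3) set \<Rightarrow> (real^3) set" where
  "ideal_vertices P = closure P \<inter> sphere 0 1"

definition vertices :: "(real^3) set \<Rightarrow> (real^3) set" where
  "vertices P = finite_vertices P \<union> ideal_vertices P"

text \<open>The closure adds to an edge its ideal endpoints.\<close>

definition vertex_degree :: "(real^3) set \<Rightarrow> real^3 \<Rightarrow> nat" where
  "vertex_degree P v = card {e. e edge_of P \<and> v \<in> closure e}"

text \<open>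
  Regular Euclidean solids inscribed in the unit sphere are regular ideal polyhedra of the
  Klein model; the regular ideal octahedron is the right-angled one.
\<close>

definition V8 :: real where
  "V8 = hyp_volume (convex hull (Basis \<union> uminus ` Basis) \<inter> hyp3)"

definition V3 :: real where
  "V3 = hyp_volume (convex hull ((\<lambda>p. p /\<^sub>R sqrt 3) `
          {vector [1, 1, 1], vector [1, -1, -1], vector [-1, 1, -1], vector [-1, -1, 1]}) \<inter> hyp3)"

end

(* In the Klein model a non-obtuse polyhedron P of finite volume is the open ball intersected with a
   Euclidean polytope Q contained in the closed ball; otherwise P would contain a neighbourhood of a
   point at infinity, which has infinite volume.

   Coning Q over its facets from the origin, and each facet over its edges from the foot of the
   perpendicular from the origin, covers Q by one simplex per flag (facet, edge). Each of these has
   hyperbolic volume at most 0.56 (the optimal constant is the maximum 0.507... of the Lobachevsky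
   function). The number of flags is twice the number of edges, that is 3 N3 + 4 N4.

   All vertices have degree 3 or 4, because projecting to the plane of a facet F maps Q into F, so the
   normals of any two facets have non-positive Lorentzian product, and only four such normals fit
   at a vertex. Slicing the regular ideal octahedron and tetrahedron gives V8 >= 3 and V3 >= 0.836,
   and then 0.56 (3 N3 + 4 N4) is below the claimed bound. For this N3 >= 1 and N3 + N4 >= 4, or
   N4 >= 5, is needed; it holds because a vertex of degree d has d neighbours. *)

theory Submission imports Defs begin

section \<open>Faces of polytopes\<close>

text \<open>Only an upper bound is wanted, so the flag simplices have to cover \<open>Q\<close>, not
  tile it: overlaps cost nothing, and no base point need be found inside \<open>Q\<close> or inside
  a facet. A bound that is uniform over all flags turns the volume into a sum of vertex degrees,
  without a volume formula for any polyhedron.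

  The numerical constants are governed by the term - 2 of the claim. With 0.56 per flag, 3 for
  \<open>V8\<close> and 0.836 for \<open>V3\<close>, a vertex of degree 4 gains 1.5 + 1.045 - 2.24 =
  0.305 and a vertex of degree 3 gains 2.25 + 0.78375 - 1.68 = 1.35375, while - 2/4 * 3 costs 1.5.
  The tight case is five vertices, all of degree 4, which leaves a margin of 0.025. Hence 0.56 may
  stay well above the optimal constant and both lower bounds well below the true values, but the
  three constants together have almost no further room.\<close>

lemma facets_containing_ridge:
  fixes S :: "'a::euclidean_space set"
  assumes "polyhedron S" "R face_of S" "R \<noteq> {}" "aff_dim R = aff_dim S - 2"
  shows "card {F. F facet_of S \<and> R \<subseteq> F} = 2"
proof -
  let ?X = "{F. F facet_of S \<and> R \<subseteq> F}"
  have "convex S" using assms(1) polyhedron_imp_convex by blast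
  have fin: "finite ?X"
    using finite_polyhedron_facets[OF assms(1)] by (rule rev_finite_subset) auto
  have R: "R \<noteq> S" using assms(4) by auto
  have eq: "R = \<Inter>?X" by (rule face_of_polyhedron[OF assms(1-3) R])
  have ne: "?X \<noteq> {}"
    using face_of_polyhedron_subset_facet[OF assms(1-3) R] by blast
  have "card ?X \<noteq> 1"
  proof
    assume "card ?X = 1"
    then obtain F where F: "?X = {F}" by (auto simp: card_1_singleton_iff)
    with eq have "R = F" by simp
    moreover have "F facet_of S" using F by blast
    ultimately show False using assms(4) by (simp add: facet_of_def)
  qed
  moreover have "card ?X \<noteq> 0" using fin ne by simp
  \<comment> \<open>Modulo \<open>R\<close> the polytope is planar with \<open>R\<close> as a
    corner, and a planar corner has only two sides. A third facet would give a third supporting line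
    through the corner with a further point of the polytope on it.\<close>
  moreover have "\<not> card ?X \<ge> 3"
  proof
    assume "card ?X \<ge> 3"
    then obtain T where T: "T \<subseteq> ?X" "card T = 3"
      by (meson obtain_subset_with_card_n)
    then obtain F1 F2 F3 where T3: "T = {F1,F2,F3}" "F1 \<noteq> F2" "F2 \<noteq> F3" "F1 \<noteq> F3"
      by (auto simp: card_3_iff)
    have F: "F1 facet_of S" "F2 facet_of S" "F3 facet_of S" "R \<subseteq> F1" "R \<subseteq> F2" "R \<subseteq> F3"
      using T T3 by auto
    \<comment> \<open>Two distinct facets through \<open>R\<close> meet in \<open>R\<close> only,
      because their intersection already has the dimension of \<open>R\<close>. Hence
      \<open>f1\<close>, \<open>f2\<close>, \<open>f3\<close> below each lie on just one of the
      three facets, and the other two functionals are strictly negative there.\<close>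
    have meet: "x \<in> R" if "A facet_of S" "B facet_of S" "A \<noteq> B" "R \<subseteq> A" "R \<subseteq> B" "x \<in> A" "x \<in> B" for A B x
    proof -
      have AB: "A \<inter> B face_of S" using that(1,2)[THEN facet_of_imp_face_of] by (rule face_of_Int)
      have nA: "A \<inter> B \<noteq> A"
      proof
        assume "A \<inter> B = A"
        then have "A face_of B"
          using facet_of_imp_face_of[OF that(1)] facet_of_imp_face_of[OF that(2)] face_of_face[of B S A] by blast
        moreover have "convex B" using facet_of_imp_face_of[OF that(2)] by (rule face_of_imp_convex)
        ultimately have "aff_dim A < aff_dim B" using face_of_aff_dim_lt that(3) by blast
        then show False using that by (simp add: facet_of_def)
      qed
      have "A \<inter> B face_of A"
        using AB facet_of_imp_face_of[OF that(1)] face_of_face[of A S "A \<inter> B"] by blast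
      moreover have "convex A" using facet_of_imp_face_of[OF that(1)] by (rule face_of_imp_convex)
      ultimately have "aff_dim (A \<inter> B) < aff_dim A" using face_of_aff_dim_lt nA by blast
      then have l: "aff_dim (A \<inter> B) \<le> aff_dim R" using that(1) assms(4) by (simp add: facet_of_def)
      have "R face_of A \<inter> B"
        using AB assms(2) that by (simp add: face_of_face)
      moreover have "convex (A \<inter> B)" using AB face_of_imp_convex by blast
      ultimately have "R = A \<inter> B" using face_of_aff_dim_lt l by fastforce
      then show ?thesis using that by blast
    qed
    have ex: "\<exists>f. f \<in> A \<and> f \<notin> affine hull R" if "A facet_of S" "R \<subseteq> A" for A
    proof (rule ccontr)
      assume "\<not> ?thesis"
      then have "A \<subseteq> affine hull R" by blast
      then have "aff_dim A \<le> aff_dim R" by (metis aff_dim_affine_hull aff_dim_subset)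
      then show False using that assms(4) by (simp add: facet_of_def)
    qed
    obtain f1 f2 f3 where f: "f1 \<in> F1" "f2 \<in> F2" "f3 \<in> F3"
       "f1 \<notin> affine hull R" "f2 \<notin> affine hull R" "f3 \<notin> affine hull R"
      using ex F by metis
    then have fR: "f1 \<notin> R" "f2 \<notin> R" "f3 \<notin> R" by (auto simp: hull_inc)
    have fS: "f1 \<in> S" "f2 \<in> S" "f3 \<in> S" using F f facet_of_imp_subset by blast+
    obtain a1 b1 where 1: "S \<subseteq> {x. a1 \<bullet> x \<le> b1}" "F1 = S \<inter> {x. a1 \<bullet> x = b1}"
      using facet_of_polyhedron[OF assms(1) F(1)] by metis
    obtain a2 b2 where 2: "S \<subseteq> {x. a2 \<bullet> x \<le> b2}" "F2 = S \<inter> {x. a2 \<bullet> x = b2}"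
      using facet_of_polyhedron[OF assms(1) F(2)] by metis
    obtain a3 b3 where 3: "S \<subseteq> {x. a3 \<bullet> x \<le> b3}" "F3 = S \<inter> {x. a3 \<bullet> x = b3}"
      using facet_of_polyhedron[OF assms(1) F(3)] by metis
    have n: "f1 \<notin> F2" "f1 \<notin> F3" "f2 \<notin> F1" "f2 \<notin> F3" "f3 \<notin> F1" "f3 \<notin> F2"
      using meet F T3 f fR by metis+
    define p1 where "p1 x = a1 \<bullet> x - b1" for x
    define p2 where "p2 x = a2 \<bullet> x - b2" for x
    define p3 where "p3 x = a3 \<bullet> x - b3" for x
    have z: "p1 f1 = 0" "p2 f2 = 0" "p3 f3 = 0" using f 1 2 3 by (auto simp: p1_def p2_def p3_def)
    have s: "p1 f2 < 0" "p1 f3 < 0" "p2 f1 < 0" "p2 f3 < 0" "p3 f1 < 0" "p3 f2 < 0"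
      using n fS 1 2 3 unfolding p1_def p2_def p3_def by fastforce+
    have zR: "p1 x = 0" "p2 x = 0" "p3 x = 0" if "x \<in> R" for x
      using that F 1 2 3 by (auto simp: p1_def p2_def p3_def)
    have "affine {x. p1 x = 0}" 
      using affine_hyperplane[of a1 b1] by (simp add: p1_def)
    then have "affine hull (insert f1 R) \<subseteq> {x. p1 x = 0}"
      by (intro hull_minimal) (auto simp: zR z)
    then have "f2 \<notin> affine hull (insert f1 R)" using s by auto
    then have d: "aff_dim (insert f2 (insert f1 R)) = aff_dim S"
      using f(4) assms(4) by (simp add: aff_dim_insert)
    have "insert f2 (insert f1 R) \<subseteq> S" using fS assms(2) face_of_imp_subset by blast
    then have "affine hull (insert f2 (insert f1 R)) \<subseteq> affine hull S" by (rule hull_mono)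
    then have "affine hull (insert f2 (insert f1 R)) = affine hull S"
      using d by (intro affine_dim_equal) auto
    then have f3: "f3 \<in> affine hull (insert f2 (insert f1 R))"
      using fS by (simp add: hull_inc)
    \<comment> \<open>\<open>c1\<close> and \<open>c2\<close> make
      \<open>c1 * p1 + c2 * p2 + p3\<close> vanish at \<open>f2\<close> and \<open>f1\<close>. It
      vanishes on \<open>R\<close> as well, hence on all of \<open>S\<close>, whose affine hull is
      spanned by \<open>R\<close>, \<open>f1\<close>, \<open>f2\<close>; but at \<open>f3\<close> it
      is a sum of two positive terms.\<close>
    define c2 where "c2 = - p3 f1 / p2 f1"
    define c1 where "c1 = - p3 f2 / p1 f2"
    have c: "c1 < 0" "c2 < 0" using s unfolding c1_def c2_def by (simp_all add: divide_neg_neg)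
    let ?H = "{x. c1 * p1 x + c2 * p2 x + p3 x = 0}"
    have "?H = {x. (c1 *\<^sub>R a1 + c2 *\<^sub>R a2 + a3) \<bullet> x = c1*b1+c2*b2+b3}"
      by (auto simp: p1_def p2_def p3_def inner_add_left algebra_simps)
    then have "affine ?H" by (simp add: affine_hyperplane)
    moreover have "insert f2 (insert f1 R) \<subseteq> ?H"
      using z zR s by (auto simp: c1_def c2_def)
    ultimately have "affine hull (insert f2 (insert f1 R)) \<subseteq> ?H" by (intro hull_minimal)
    then have "c1 * p1 f3 + c2 * p2 f3 = 0" using f3 z by auto
    moreover have "c1 * p1 f3 > 0" "c2 * p2 f3 > 0" using c s by (simp_all add: mult_neg_neg)
    ultimately show False by simp
  qed
  ultimately show ?thesis by linarith
qed

text \<open>The last point \<open>z\<close> of \<open>S\<close> on the ray from \<open>o'\<close>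
  through \<open>y\<close> lies in the relative frontier, hence on a facet, and \<open>y\<close>
  lies between \<open>o'\<close> and \<open>z\<close>. Taking the last point makes the argument
  indifferent to whether \<open>o'\<close> belongs to \<open>S\<close>.\<close>

lemma polytope_subset_cone_over_facets:
  fixes S :: "'a::euclidean_space set"
  assumes "polytope S" "aff_dim S \<ge> 1" "o' \<in> affine hull S"
  shows "S \<subseteq> (\<Union>F\<in>{F. F facet_of S}. convex hull (insert o' F))"
proof
  fix y assume y: "y \<in> S"
  have "compact S" "convex S" "closed S" "polyhedron S" using assms(1)
    by (auto intro: polytope_imp_compact polytope_imp_convex polytope_imp_closed polytope_imp_polyhedron)
  show "y \<in> (\<Union>F\<in>{F. F facet_of S}. convex hull (insert o' F))"
  proof (cases "y = o'")
    case True
    obtain F where "F facet_of S" using polytope_facet_exists[OF assms(1)] assms(2) by auto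
    then show ?thesis using True by (auto intro!: exI[of _ F] hull_inc)
  next
    case False
    define A where "A = S \<inter> range (\<lambda>t. o' + t *\<^sub>R (y - o'))"
    define T where "T = (\<lambda>t. o' + t *\<^sub>R (y - o')) -` S"
    have "closed T" unfolding T_def
      by (intro closed_vimage \<open>closed S\<close> continuous_intros)
    moreover have "bounded T"
    proof -
      obtain B where B: "\<And>x. x \<in> S \<Longrightarrow> norm x \<le> B"
        using \<open>compact S\<close> compact_imp_bounded bounded_iff by metis
      have "\<bar>t\<bar> \<le> (B + norm o') / norm (y - o')" if "t \<in> T" for t
      proof -
        have "norm (o' + t *\<^sub>R (y - o')) \<le> B" using that B by (simp add: T_def)
        then have "norm (t *\<^sub>R (y - o')) \<le> B + norm o'"
          by (smt (verit) add_diff_cancel_left' norm_triangle_ineq4)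
        then have "\<bar>t\<bar> * norm (y - o') \<le> B + norm o'" by simp
        then show ?thesis using False by (simp add: pos_le_divide_eq)
      qed
      then show ?thesis unfolding bounded_iff real_norm_def by blast
    qed
    ultimately have "compact T" by (simp add: compact_eq_bounded_closed)
    moreover have T1: "1 \<in> T" using y by (simp add: T_def)
    ultimately obtain t where t: "t \<in> T" "\<And>u. u \<in> T \<Longrightarrow> u \<le> t"
      using compact_attains_sup[of T] by blast
    have t1: "t \<ge> 1" using t T1 by blast
    define z where "z = o' + t *\<^sub>R (y - o')"
    have zS: "z \<in> S" using t by (simp add: z_def T_def)
    have "z \<notin> rel_interior S"
    proof
      assume "z \<in> rel_interior S"
      then obtain e where e: "e > 0" "ball z e \<inter> affine hull S \<subseteq> S"
        by (auto simp: mem_rel_interior_ball)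
      define u where "u = t + e / (2 * norm (y - o'))"
      have d: "norm (y - o') > 0" using False by simp
      have "o' + u *\<^sub>R (y - o') = (1 - u) *\<^sub>R o' + u *\<^sub>R y" by (simp add: algebra_simps)
      also have "\<dots> \<in> affine hull S" using assms(3) y
        by (intro mem_affine[OF affine_affine_hull]) (auto simp: hull_inc)
      finally have 1: "o' + u *\<^sub>R (y - o') \<in> affine hull S" .
      have "o' + u *\<^sub>R (y - o') - z = (e / (2 * norm (y - o'))) *\<^sub>R (y - o')"
        by (simp add: u_def z_def algebra_simps)
      then have "norm (o' + u *\<^sub>R (y - o') - z) = e / 2" using d e by simp
      then have "o' + u *\<^sub>R (y - o') \<in> ball z e" using e by (simp add: dist_norm norm_minus_commute)
      then have "u \<in> T" using 1 e by (auto simp: T_def)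
      then have "u \<le> t" using t by blast
      moreover have "u > t" using d e by (simp add: u_def)
      ultimately show False by simp
    qed
    then have "z \<in> rel_frontier S" using zS \<open>closed S\<close> by (simp add: rel_frontier_def)
    then obtain F where F: "F facet_of S" "z \<in> F"
      using rel_frontier_of_polyhedron[OF \<open>polyhedron S\<close>] by auto
    have "y = (1 - 1/t) *\<^sub>R o' + (1/t) *\<^sub>R z"
      using t1 by (simp add: z_def algebra_simps)
    also have "\<dots> \<in> convex hull (insert o' F)"
      using F t1 by (intro convexD[OF convex_convex_hull]) (auto simp: hull_inc)
    finally show ?thesis using F by blast
  qed
qed

lemma edge_of_polytope_segment:
  fixes S :: "'a::euclidean_space set"
  assumes "polytope S" "e edge_of S"
  obtains a b where "a \<noteq> b" "e = closed_segment a b" "a extreme_point_of S" "b extreme_point_of S"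
proof -
  have e: "e face_of S" "aff_dim e = 1" using assms(2) by (auto simp: edge_of_def)
  then have "compact e" "convex e" using assms(1)
    by (auto intro: face_of_imp_compact face_of_imp_convex polytope_imp_compact polytope_imp_convex)
  moreover have "collinear e" using e by (simp add: collinear_aff_dim)
  moreover have "e \<noteq> {}" using e by auto
  ultimately obtain a b where ab: "e = closed_segment a b"
    using compact_convex_collinear_segment by blast
  have "a \<noteq> b" using ab e by auto
  moreover have "x extreme_point_of S" if "x extreme_point_of e" for x
    using that e by (simp add: extreme_point_of_face)
  ultimately show ?thesis using that ab extreme_point_of_segment by metis
qed

text \<open>On the way from a relative interior point to \<open>y\<close>, the polytope is left
  through a facet whose inequality is strict at the start and an equality at the exit, so it fails
  at any point further on. The functional for each facet is left open, so that for a facet of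
  \<open>Q\<close> in the role of \<open>S\<close> the normals of the neighbouring facets can be
  used.\<close>

lemma mem_polytope_if_facet_inequalities:
  fixes S :: "'a::euclidean_space set"
  assumes "polytope S" "S \<noteq> {}" and y: "y \<in> affine hull S"
    and ineq: "\<And>F. F facet_of S \<Longrightarrow> \<exists>a b. (\<forall>x\<in>S. a \<bullet> x \<le> b) \<and> (\<forall>x\<in>F. a \<bullet> x = b)
        \<and> (\<exists>x\<in>S. a \<bullet> x \<noteq> b) \<and> a \<bullet> y \<le> b"
  shows "y \<in> S"
proof (rule ccontr)
  assume n: "y \<notin> S"
  have S: "convex S" "closed S" "bounded S" "polyhedron S" using assms(1)
    by (auto intro: polytope_imp_convex polytope_imp_closed polytope_imp_bounded polytope_imp_polyhedron)
  obtain q where q: "q \<in> rel_interior S" using S(1) assms(2) rel_interior_eq_empty by blast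
  then have qS: "q \<in> S" using rel_interior_subset by blast
  have "q + (y - q) \<in> affine hull S" "y - q \<noteq> 0" using y n qS by auto
  then obtain d where d: "0 < d" "q + d *\<^sub>R (y - q) \<in> rel_frontier S"
      "\<And>e. \<lbrakk>0 \<le> e; e < d\<rbrakk> \<Longrightarrow> (q + e *\<^sub>R (y - q)) \<in> rel_interior S"
    using ray_to_rel_frontier[OF S(3) q] by metis
  have d1: "d \<le> 1" using d(3)[of 1] n rel_interior_subset by fastforce
  define z where "z = q + d *\<^sub>R (y - q)"
  obtain F where F: "F facet_of S" "z \<in> F" using d(2) rel_frontier_of_polyhedron[OF S(4)] by (auto simp: z_def)
  obtain a b where ab: "\<forall>x\<in>S. a \<bullet> x \<le> b" "\<forall>x\<in>F. a \<bullet> x = b" "\<exists>x\<in>S. a \<bullet> x \<noteq> b" "a \<bullet> y \<le> b"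
    using ineq[OF F(1)] by blast
  have "S \<inter> {x. a \<bullet> x = b} face_of S" using ab S(1) by (intro face_of_Int_supporting_hyperplane_le) auto
  then have "a \<bullet> q \<noteq> b"
    using subset_of_face_of[of "S \<inter> {x. a \<bullet> x = b}" S S] ab(3) q qS by blast
  then have aq: "a \<bullet> q < b" using ab(1) qS by force
  have "a \<bullet> z = b" using ab F by simp
  then have "(1 - d) * (b - a \<bullet> q) + d * (b - a \<bullet> y) = 0"
    by (simp add: z_def inner_simps algebra_simps)
  moreover have "0 \<le> d * (b - a \<bullet> y)" "0 \<le> (1 - d) * (b - a \<bullet> q)" using d d1 ab aq by simp_all
  ultimately have "(1 - d) * (b - a \<bullet> q) = 0" by linarith
  then have "d = 1" using aq by simp
  then have "y = z" by (simp add: z_def)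
  then show False using F n facet_of_imp_subset by blast
qed

section \<open>Pairwise non-acute vectors\<close>

text \<open>Take one vector \<open>e\<close> as axis of the plane, with \<open>f\<close> orthogonal
  to it. All other vectors have a non-positive \<open>e\<close>-coordinate, so two of them whose
  \<open>f\<close>-coordinates have the same sign, or are both zero, would have a positive product.
  That leaves at most one vector for each of the three signs.\<close>

lemma card_le_4_pairwise_nonacute_in_plane:
  fixes p :: "'i \<Rightarrow> real^3"
  assumes "finite I" and v: "v \<noteq> 0" and orth: "\<And>i. i \<in> I \<Longrightarrow> p i \<bullet> v = 0"
    and nz: "\<And>i. i \<in> I \<Longrightarrow> p i \<noteq> 0"
    and na: "\<And>i j. i \<in> I \<Longrightarrow> j \<in> I \<Longrightarrow> i \<noteq> j \<Longrightarrow> p i \<bullet> p j \<le> 0"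
  shows "card I \<le> 4"
proof (cases "I = {}")
  case False
  then obtain k where k: "k \<in> I" by blast
  define e where "e = p k"
  have e: "e \<noteq> 0" "e \<bullet> v = 0" using nz orth k by (auto simp: e_def)
  have "dim {e, v} \<le> card {e, v}" by (rule dim_le_card) (simp_all add: span_superset)
  also have "\<dots> \<le> 2" by (simp add: card_insert_if)
  finally have "dim {e, v} < DIM(real^3)" by simp
  then obtain f where f: "f \<noteq> 0" "\<And>y. y \<in> span {e, v} \<Longrightarrow> orthogonal f y"
    using orthogonal_to_subspace_exists by metis
  have fe: "f \<bullet> e = 0" "f \<bullet> v = 0" using f(2) by (auto simp: span_base orthogonal_def)
  define x where "x i = p i \<bullet> e / (e \<bullet> e)" for i
  define y where "y i = p i \<bullet> f / (f \<bullet> f)" for i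
  have rep: "p i = x i *\<^sub>R e + y i *\<^sub>R f" if "i \<in> I" for i
  proof -
    define w where "w = p i - x i *\<^sub>R e - y i *\<^sub>R f"
    have w: "w \<bullet> e = 0" "w \<bullet> f = 0" "w \<bullet> v = 0"
      using e f fe orth[OF that] by (simp_all add: w_def x_def y_def inner_simps inner_commute)
    have "w = 0"
    proof (rule ccontr)
      assume "w \<noteq> 0"
      have "pairwise orthogonal {e, f, v, w}"
        using w fe e by (auto simp: pairwise_def orthogonal_def inner_commute)
      moreover have "0 \<notin> {e, f, v, w}" using e f v \<open>w \<noteq> 0\<close> by auto
      ultimately have "independent {e, f, v, w}" by (rule pairwise_orthogonal_independent)
      then have "card {e, f, v, w} \<le> DIM(real^3)" using independent_bound by blast
      moreover have "e \<noteq> f" "e \<noteq> v" "e \<noteq> w" "f \<noteq> v" "f \<noteq> w" "v \<noteq> w"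
        using w fe e f(1) v by (auto simp: inner_commute)
      ultimately show False by simp
    qed
    then show ?thesis by (simp add: w_def algebra_simps)
  qed
  have ip: "p i \<bullet> p j = x i * x j * (e \<bullet> e) + y i * y j * (f \<bullet> f)" if "i \<in> I" "j \<in> I" for i j
    unfolding rep[OF that(1)] rep[OF that(2)] using fe by (simp add: inner_simps inner_commute)
  have ee: "e \<bullet> e > 0" and ff: "f \<bullet> f > 0" using e f by auto
  have xle: "x i \<le> 0" if "i \<in> I - {k}" for i
    using na[of i k] that k ee by (simp add: x_def e_def divide_le_0_iff)
  have le1: "card J \<le> 1" if "J \<subseteq> I - {k}" "\<And>i j. i \<in> J \<Longrightarrow> j \<in> J \<Longrightarrow> x i * x j * (e \<bullet> e) + y i * y j * (f \<bullet> f) > 0" for J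
  proof (rule ccontr)
    assume "\<not> card J \<le> 1"
    then obtain i j where "i \<in> J" "j \<in> J" "i \<noteq> j"
      by (metis card_le_Suc0_iff_eq One_nat_def card.infinite le0)
    then show False using na[of i j] ip[of i j] that by force
  qed
  have pos: "x i * x j * (e \<bullet> e) + y i * y j * (f \<bullet> f) > 0"
    if "i \<in> I - {k}" "j \<in> I - {k}" "y i * y j > 0" for i j
  proof -
    have "0 \<le> x i * x j" using xle that by (intro mult_nonpos_nonpos) auto
    from mult_nonneg_nonneg[OF this less_imp_le[OF ee]] have "0 \<le> x i * x j * (e \<bullet> e)" .
    moreover have "y i * y j * (f \<bullet> f) > 0" by (rule mult_pos_pos[OF that(3) ff])
    ultimately show ?thesis by linarith
  qed
  have 1: "card {i \<in> I - {k}. y i > 0} \<le> 1"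
    by (intro le1 pos) (auto simp: mult_pos_pos)
  have 2: "card {i \<in> I - {k}. y i < 0} \<le> 1"
    by (intro le1 pos) (auto simp: mult_neg_neg)
  have 3: "card {i \<in> I - {k}. y i = 0} \<le> 1"
  proof (rule le1)
    fix i j assume "i \<in> {i \<in> I - {k}. y i = 0}" "j \<in> {i \<in> I - {k}. y i = 0}"
    then have i: "i \<in> I - {k}" "y i = 0" and j: "j \<in> I - {k}" "y j = 0" by auto
    have "x i \<noteq> 0" "x j \<noteq> 0" using nz rep i j by force+
    then have "x i < 0" "x j < 0" using xle i j by force+
    then show "x i * x j * (e \<bullet> e) + y i * y j * (f \<bullet> f) > 0" using ee i by (simp add: mult_neg_neg)
  qed auto
  define J where "J = {i \<in> I - {k}. y i > 0}"
  define K where "K = {i \<in> I - {k}. y i < 0}"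
  define L where "L = {i \<in> I - {k}. y i = 0}"
  have "I = {k} \<union> (J \<union> (K \<union> L))" using k by (auto simp: J_def K_def L_def)
  then have "card I = card ({k} \<union> (J \<union> (K \<union> L)))" by (rule arg_cong)
  also have "\<dots> \<le> 4"
    using card_Un_le[of "{k}" "J \<union> (K \<union> L)"] card_Un_le[of J "K \<union> L"] card_Un_le[of K L]
      1[folded J_def] 2[folded K_def] 3[folded L_def] by simp
  finally show ?thesis .
qed simp

text \<open>In a positive definite form, pairwise non-acute vectors in an open half-space are independent:
  the two sides of a linear relation with non-negative coefficients would have non-positive product.\<close>

lemma independent_pairwise_nonacute:
  fixes A :: "'a::euclidean_space set" and B :: "'a \<Rightarrow> 'a \<Rightarrow> real"
  assumes "finite A" and lin: "\<And>y. linear (\<lambda>x. B x y)" "\<And>x. linear (\<lambda>y. B x y)"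
    and posdef: "\<And>x. x \<noteq> 0 \<Longrightarrow> B x x > 0"
    and na: "\<And>x y. x \<in> A \<Longrightarrow> y \<in> A \<Longrightarrow> x \<noteq> y \<Longrightarrow> B x y \<le> 0"
    and half: "\<And>x. x \<in> A \<Longrightarrow> x \<bullet> d < 0"
  shows "independent A"
proof
  assume "dependent A"
  then obtain u where u: "\<exists>v\<in>A. u v \<noteq> 0" "(\<Sum>v\<in>A. u v *\<^sub>R v) = 0"
    using dependent_finite[OF \<open>finite A\<close>] by blast
  define P where "P = {v \<in> A. u v > 0}"
  define N where "N = {v \<in> A. u v < 0}"
  have fin: "finite P" "finite N" using assms(1) by (auto simp: P_def N_def)
  define w where "w = (\<Sum>v\<in>P. u v *\<^sub>R v)"
  have "(\<Sum>v\<in>A. u v *\<^sub>R v) = (\<Sum>v\<in>P \<union> N. u v *\<^sub>R v)"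
    using assms(1) by (intro sum.mono_neutral_right) (auto simp: P_def N_def)
  also have "\<dots> = w + (\<Sum>v\<in>N. u v *\<^sub>R v)"
    unfolding w_def using fin by (intro sum.union_disjoint) (auto simp: P_def N_def)
  finally have w': "w = (\<Sum>v\<in>N. (- u v) *\<^sub>R v)" using u(2) by (simp add: sum_negf eq_neg_iff_add_eq_0)
  have "B w w = (\<Sum>x\<in>P. u x * B x w)"
    unfolding w_def[THEN arg_cong[where f = "\<lambda>x. B x w"]]
    by (simp add: linear_sum[OF lin(1)] linear_cmul[OF lin(1)])
  also have "\<dots> = (\<Sum>x\<in>P. u x * (\<Sum>y\<in>N. (- u y) * B x y))"
    unfolding w' by (simp add: linear_sum[OF lin(2)] linear_cmul[OF lin(2)] linear_neg[OF lin(2)])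
  also have "\<dots> \<le> 0"
  proof (intro sum_nonpos mult_nonneg_nonpos)
    fix x y assume xy: "x \<in> P" "y \<in> N"
    then have "x \<noteq> y" by (auto simp: P_def N_def)
    then show "B x y \<le> 0" using xy by (intro na) (auto simp: P_def N_def)
  qed (auto simp: P_def N_def)
  finally have "w = 0" using posdef[of w] by force
  have e: "(\<Sum>v\<in>P. u v * (v \<bullet> d)) = 0" "(\<Sum>v\<in>N. u v * (v \<bullet> d)) = 0"
    using arg_cong[OF w_def, of "\<lambda>x. x \<bullet> d"] arg_cong[OF w', of "\<lambda>x. x \<bullet> d"] \<open>w = 0\<close>
    by (simp_all add: inner_sum_left sum_negf)
  have "P = {}"
  proof (rule ccontr)
    assume "P \<noteq> {}"
    then have "(\<Sum>v\<in>P. - (u v * (v \<bullet> d))) > 0"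
      using fin half by (intro sum_pos) (auto simp: P_def mult_pos_neg)
    then show False using e by (simp add: sum_negf)
  qed
  moreover have "N = {}"
  proof (rule ccontr)
    assume "N \<noteq> {}"
    then have "(\<Sum>v\<in>N. u v * (v \<bullet> d)) > 0"
      using fin half by (intro sum_pos) (auto simp: N_def mult_neg_neg)
    then show False using e by simp
  qed
  ultimately show False using u(1) by (auto simp: P_def N_def) (metis linorder_neqE_linordered_idom)
qed

section \<open>Volume of a flag simplex\<close>

lemma distr_orthogonal_lborel:
  fixes g :: "real^3 \<Rightarrow> real^3"
  assumes "orthogonal_transformation g"
  shows "distr lborel borel g = lborel"
proof (rule lborel_eqI[symmetric])
  have lin: "linear g" using assms by (rule orthogonal_transformation_linear)
  then have [measurable]: "g \<in> borel \<rightarrow>\<^sub>M borel"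
    by (intro borel_measurable_continuous_onI linear_continuous_on) (simp add: linear_conv_bounded_linear)
  have bij: "bij g" using assms by (rule orthogonal_transformation_bij)
  fix l u :: "real^3" assume le: "\<And>b. b \<in> Basis \<Longrightarrow> l \<bullet> b \<le> u \<bullet> b"
  have inv: "orthogonal_transformation (inv g)" using assms by (rule orthogonal_transformation_inv)
  have v: "g -` box l u = inv g ` box l u" using bij by (simp add: bij_vimage_eq_inv_image)
  have "open (g -` box l u)"
    using lin by (intro open_vimage open_box linear_continuous_on) (simp add: linear_conv_bounded_linear)
  then have "g -` box l u \<in> sets borel" by (rule borel_open)
  then have "emeasure (distr lborel borel g) (box l u) = emeasure lebesgue (inv g ` box l u)"
    by (simp add: emeasure_distr v)
  also have "\<dots> = measure lebesgue (inv g ` box l u)"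
    using measurable_orthogonal_image[OF inv, of "box l u"] by (simp add: emeasure_eq_measure2)
  also have "\<dots> = measure lebesgue (box l u)"
    using measure_orthogonal_image[OF inv, of "box l u"] by simp
  also have "\<dots> = emeasure lebesgue (box l u)"
    by (simp add: emeasure_eq_measure2)
  also have "\<dots> = (\<Prod>b\<in>Basis. (u - l) \<bullet> b)" using le by simp
  finally show "emeasure (distr lborel borel g) (box l u) = (\<Prod>b\<in>Basis. (u - l) \<bullet> b)" .
qed simp

lemma distr_vector3_lborel:
  "distr lborel borel (\<lambda>(x, y, z). vector [x, y, z] :: real^3) = lborel"
proof (rule lborel_eqI[symmetric])
  have eq: "(\<lambda>(x, y, z). vector [x, y, z] :: real^3)
      = (\<lambda>v. fst v *\<^sub>R axis 1 1 + fst (snd v) *\<^sub>R axis 2 1 + snd (snd v) *\<^sub>R axis 3 1)"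
    by (auto simp: fun_eq_iff vec_eq_iff forall_3 axis_def)
  have [measurable]: "(\<lambda>(x, y, z). vector [x, y, z] :: real^3) \<in> borel \<rightarrow>\<^sub>M borel"
    unfolding eq by (intro borel_measurable_continuous_onI continuous_intros)
  fix l u :: "real^3" assume le: "\<And>b. b \<in> Basis \<Longrightarrow> l \<bullet> b \<le> u \<bullet> b"
  have le': "l$i \<le> u$i" for i
    using le[of "axis i 1"] by (simp add: inner_axis axis_in_Basis_iff)
  have v: "(\<lambda>(x, y, z). vector [x, y, z] :: real^3) -` box l u
      = {l$1<..<u$1} \<times> {l$2<..<u$2} \<times> {l$3<..<u$3}"
    by (auto simp: mem_box_cart forall_3)
  let ?A = "{l$1<..<u$1}" and ?B = "{l$2<..<u$2}" and ?C = "{l$3<..<u$3}"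
  have BC: "?B \<times> ?C \<in> sets lborel"
    unfolding sets_lborel by (intro borel_open open_Times) auto
  have Bas: "Basis = range (\<lambda>i::3. axis i (1::real))"
    by (auto simp: Basis_vec_def)
  have "emeasure (distr lborel borel (\<lambda>(x, y, z). vector [x, y, z] :: real^3)) (box l u)
     = emeasure lborel (?A \<times> ?B \<times> ?C)"
    by (subst emeasure_distr) (simp_all add: v)
  also have "\<dots> = emeasure (lborel \<Otimes>\<^sub>M lborel) (?A \<times> (?B \<times> ?C))"
    by (simp only: lborel_prod)
  also have "\<dots> = emeasure lborel ?A * emeasure lborel (?B \<times> ?C)"
    by (rule lborel.emeasure_pair_measure_Times) (use BC in simp_all)
  also have "emeasure lborel (?B \<times> ?C) = emeasure (lborel \<Otimes>\<^sub>M lborel) (?B \<times> ?C)"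
    by (simp only: lborel_prod)
  also have "\<dots> = emeasure lborel ?B * emeasure lborel ?C"
    by (rule lborel.emeasure_pair_measure_Times) simp_all
  also have "emeasure lborel ?A * (emeasure lborel ?B * emeasure lborel ?C)
      = ennreal ((u$1 - l$1) * ((u$2 - l$2) * (u$3 - l$3)))"
    using le'[of 1] le'[of 2] le'[of 3] by (simp add: ennreal_mult)
  also have "(u$1 - l$1) * ((u$2 - l$2) * (u$3 - l$3)) = (\<Prod>i\<in>UNIV. (u - l) $ i)"
    unfolding UNIV_3 by (subst prod.insert; simp)+
  also have "\<dots> = (\<Prod>b\<in>Basis. (u - l) \<bullet> b)"
  proof -
    have "inj (\<lambda>i::3. axis i (1::real))" by (simp add: inj_on_def axis_eq_axis)
    then show ?thesis unfolding Bas by (simp add: prod.reindex inner_axis)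
  qed
  finally show "emeasure (distr lborel borel (\<lambda>(x, y, z). vector [x, y, z] :: real^3)) (box l u)
      = (\<Prod>b\<in>Basis. (u - l) \<bullet> b)" .
qed simp

lemma norm_orthonormal_combination:
  fixes e1 e2 e3 :: "'a::real_inner"
  assumes "norm e1 = 1" "norm e2 = 1" "norm e3 = 1" "e1 \<bullet> e2 = 0" "e1 \<bullet> e3 = 0" "e2 \<bullet> e3 = 0"
  shows "(norm (x *\<^sub>R e1 + y *\<^sub>R e2 + z *\<^sub>R e3))\<^sup>2 = x\<^sup>2 + y\<^sup>2 + z\<^sup>2"
proof -
  have "e1 \<bullet> e1 = 1" "e2 \<bullet> e2 = 1" "e3 \<bullet> e3 = 1"
    using assms by (simp_all add: dot_square_norm)
  then show ?thesis using assms(4-6)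
    unfolding power2_norm_eq_inner
    by (simp add: inner_add_left inner_add_right inner_commute power2_eq_square)
qed

lemma distr_orthonormal_frame_lborel:
  fixes e1 e2 e3 :: "real^3"
  assumes "norm e1 = 1" "norm e2 = 1" "norm e3 = 1" "e1 \<bullet> e2 = 0" "e1 \<bullet> e3 = 0" "e2 \<bullet> e3 = 0"
  shows "distr lborel borel (\<lambda>(x, y, z). x *\<^sub>R e1 + y *\<^sub>R e2 + z *\<^sub>R e3) = lborel"
proof -
  let ?g = "\<lambda>v::real^3. v$1 *\<^sub>R e1 + v$2 *\<^sub>R e2 + v$3 *\<^sub>R e3"
  let ?f = "\<lambda>(x, y, z). vector [x, y, z] :: real^3"
  have lin: "linear ?g" by (rule linearI) (simp_all add: algebra_simps)
  have "orthogonal_transformation ?g"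
    unfolding orthogonal_transformation
  proof (intro conjI allI lin)
    fix v :: "real^3"
    have "(norm v)\<^sup>2 = (v$1)\<^sup>2 + (v$2)\<^sup>2 + (v$3)\<^sup>2"
      unfolding power2_norm_eq_inner by (simp add: inner_vec_def sum_3 power2_eq_square)
    then have "(norm (?g v))\<^sup>2 = (norm v)\<^sup>2"
      using norm_orthonormal_combination[OF assms, of "v$1" "v$2" "v$3"] by simp
    then show "norm (?g v) = norm v" by simp
  qed
  then have g: "distr lborel borel ?g = lborel" by (rule distr_orthogonal_lborel)
  have [measurable]: "?g \<in> borel \<rightarrow>\<^sub>M borel"
    by (intro borel_measurable_continuous_onI continuous_intros)
  have eq: "?f = (\<lambda>v. fst v *\<^sub>R axis 1 1 + fst (snd v) *\<^sub>R axis 2 1 + snd (snd v) *\<^sub>R axis 3 1)"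
    by (auto simp: fun_eq_iff vec_eq_iff forall_3 axis_def)
  have [measurable]: "?f \<in> borel \<rightarrow>\<^sub>M borel"
    unfolding eq by (intro borel_measurable_continuous_onI continuous_intros)
  have "lborel = distr (distr lborel borel ?f) borel ?g"
    using g by (simp only: distr_vector3_lborel)
  also have "\<dots> = distr lborel borel (?g \<circ> ?f)" by (intro distr_distr) auto
  also have "?g \<circ> ?f = (\<lambda>(x, y, z). x *\<^sub>R e1 + y *\<^sub>R e2 + z *\<^sub>R e3)"
    by (auto simp: fun_eq_iff)
  finally show ?thesis by simp
qed

lemma emeasure_hyp_measure:
  assumes "S \<in> sets borel"
  shows "emeasure hyp_measure S =
    (\<integral>\<^sup>+v. ennreal (1 / (1 - (norm v)\<^sup>2)\<^sup>2) * indicator (hyp3 \<inter> S) v \<partial>lborel)"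
proof -
  have eq: "(\<lambda>x. ennreal (hyp_volume_density x) * indicator hyp3 x)
      = (\<lambda>x. ennreal (1 / (1 - (norm x)\<^sup>2)\<^sup>2) * indicator hyp3 x)"
    by (auto simp: fun_eq_iff hyp_volume_density_eq split: split_indicator)
  have [measurable]: "hyp3 \<in> sets borel" by (simp add: hyp3_def)
  let ?f = "\<lambda>x::real^3. ennreal (1 / (1 - (norm x)\<^sup>2)\<^sup>2) * indicator hyp3 x"
  have M: "hyp_measure = density lborel ?f"
    using eq by (simp only: hyp_measure_def)
  have f: "?f \<in> borel_measurable lborel" by measurable
  have "emeasure (density lborel ?f) S = (\<integral>\<^sup>+v. ?f v * indicator S v \<partial>lborel)"
    by (rule emeasure_density[OF f]) (use assms in simp)
  then show ?thesis by (simp only: M indicator_inter_arith mult.assoc)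
qed

lemma sets_hyp_measure [simp]: "sets hyp_measure = sets borel"
  by (simp add: hyp_measure_def)

lemma emeasure_hyp_measure_coords:
  fixes e1 e2 e3 :: "real^3"
  assumes "norm e1 = 1" "norm e2 = 1" "norm e3 = 1" "e1 \<bullet> e2 = 0" "e1 \<bullet> e3 = 0" "e2 \<bullet> e3 = 0"
    and S: "S \<in> sets borel"
  shows "emeasure hyp_measure S =
    (\<integral>\<^sup>+x. \<integral>\<^sup>+y. \<integral>\<^sup>+z. ennreal (1 / (1 - (x\<^sup>2 + y\<^sup>2 + z\<^sup>2))\<^sup>2) *
       indicator (hyp3 \<inter> S) (x *\<^sub>R e1 + y *\<^sub>R e2 + z *\<^sub>R e3) \<partial>lborel \<partial>lborel \<partial>lborel)"
proof -
  let ?f = "\<lambda>(x, y, z). x *\<^sub>R e1 + y *\<^sub>R e2 + z *\<^sub>R e3"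
  have f: "?f = (\<lambda>v. fst v *\<^sub>R e1 + fst (snd v) *\<^sub>R e2 + snd (snd v) *\<^sub>R e3)" by auto
  have mf: "?f \<in> borel \<rightarrow>\<^sub>M borel"
    unfolding f by (intro borel_measurable_continuous_onI continuous_intros)
  have [measurable]: "hyp3 \<in> sets borel" by (simp add: hyp3_def)
  note [measurable] = S
  let ?h = "\<lambda>v::real^3. ennreal (1 / (1 - (norm v)\<^sup>2)\<^sup>2) * indicator (hyp3 \<inter> S) v"
  have mh: "?h \<in> borel_measurable borel" by measurable
  have m: "(\<lambda>v. ?h (?f v)) \<in> borel_measurable borel"
    using measurable_compose[OF mf mh] .
  have "emeasure hyp_measure S = (\<integral>\<^sup>+v. ?h v \<partial>distr lborel borel ?f)"
    unfolding distr_orthonormal_frame_lborel[OF assms(1-6)] by (rule emeasure_hyp_measure[OF S])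
  also have "\<dots> = (\<integral>\<^sup>+v. ?h (?f v) \<partial>lborel)"
    by (rule nn_integral_distr) (use mf mh in simp_all)
  also have "\<dots> = (\<integral>\<^sup>+v. ?h (?f v) \<partial>(lborel \<Otimes>\<^sub>M (lborel \<Otimes>\<^sub>M lborel)))"
    by (simp add: lborel_prod)
  also have "\<dots> = (\<integral>\<^sup>+x. \<integral>\<^sup>+w. ?h (?f (x, w)) \<partial>(lborel \<Otimes>\<^sub>M lborel) \<partial>lborel)"
    by (rule lborel_pair.nn_integral_fst[symmetric]) (use m in \<open>simp add: lborel_prod\<close>)
  also have "\<dots> = (\<integral>\<^sup>+x. \<integral>\<^sup>+y. \<integral>\<^sup>+z. ?h (?f (x, y, z)) \<partial>lborel \<partial>lborel \<partial>lborel)"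
  proof (intro nn_integral_cong)
    fix x :: real
    have "(\<lambda>w::real\<times>real. (x, w)) \<in> borel \<rightarrow>\<^sub>M borel"
      by (intro borel_measurable_continuous_onI continuous_intros)
    from measurable_compose[OF this m]
    show "(\<integral>\<^sup>+w. ?h (?f (x, w)) \<partial>(lborel \<Otimes>\<^sub>M lborel)) = (\<integral>\<^sup>+y. \<integral>\<^sup>+z. ?h (?f (x, y, z)) \<partial>lborel \<partial>lborel)"
      by (intro lborel.nn_integral_fst[symmetric]) (simp add: lborel_prod)
  qed
  finally show ?thesis
    by (simp add: norm_orthonormal_combination[OF assms(1-6)])
qed

section \<open>One-variable integration and the estimates for the wedge\<close>

lemma isCont_x_ln_x: "isCont (\<lambda>x::real. x * ln x) x"
proof (cases "x = 0")
  case False then show ?thesis by (intro continuous_intros) auto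
next
  case True
  have "((\<lambda>x::real. inverse x * ln (inverse x)) \<longlongrightarrow> 0) at_top"
  proof (rule Lim_transform_eventually)
    show "((\<lambda>x::real. - (ln x / x)) \<longlongrightarrow> 0) at_top"
      using tendsto_minus[OF ln_x_over_x_tendsto_0] by simp
    show "\<forall>\<^sub>F x::real in at_top. - (ln x / x) = inverse x * ln (inverse x)"
      using eventually_gt_at_top[of 0] by eventually_elim (simp add: ln_inverse divide_inverse del: inverse_eq_divide)
  qed
  then have r: "((\<lambda>x::real. x * ln x) \<longlongrightarrow> 0) (at_right 0)"
    by (simp add: filterlim_at_right_to_top)
  have "((\<lambda>x::real. - x * ln (- x)) \<longlongrightarrow> 0) (at_left 0)"
    using r by (simp add: filterlim_at_left_to_right)
  then have "((\<lambda>x::real. x * ln x) \<longlongrightarrow> 0) (at_left 0)"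
    using tendsto_minus by (fastforce simp: ln_minus)
  with r have "((\<lambda>x::real. x * ln x) \<longlongrightarrow> 0) (at 0)"
    by (simp add: filterlim_split_at)
  then show ?thesis using True by (simp add: isCont_def)
qed

text \<open>The derivative is asked for only inside the interval because the integrands below may
  blow up at its ends, as the logarithm in the angular integral does; continuity of \<open>F\<close>
  takes care of the end points, which are null sets.\<close>

lemma nn_integral_le_FTC:
  fixes f F' F :: "real \<Rightarrow> real"
  assumes "a \<le> b" "continuous_on {a..b} F"
    and "\<And>x. a < x \<Longrightarrow> x < b \<Longrightarrow> (F has_real_derivative F' x) (at x)"
    and "\<And>x. a < x \<Longrightarrow> x < b \<Longrightarrow> 0 \<le> F' x"
    and "\<And>x. a < x \<Longrightarrow> x < b \<Longrightarrow> g x \<le> ennreal (F' x)"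
  shows "(\<integral>\<^sup>+x. g x * indicator {a..b} x \<partial>lborel) \<le> ennreal (F b - F a)"
proof -
  let ?F = "\<lambda>x. if a < x \<and> x < b then F' x else 0"
  have "(?F has_integral (F b - F a)) {a..b}"
  proof (rule fundamental_theorem_of_calculus_interior[OF assms(1,2)])
    fix x assume "x \<in> {a<..<b}"
    then show "(F has_vector_derivative (if a < x \<and> x < b then F' x else 0)) (at x)"
      using assms(3)[of x] by (simp add: has_real_derivative_iff_has_vector_derivative)
  qed
  then have I: "(\<integral>\<^sup>+x. ennreal (?F x) * indicator {a..b} x \<partial>lborel) = ennreal (F b - F a)"
    using assms(4) by (intro nn_integral_has_integral_lebesgue') auto
  have "(\<integral>\<^sup>+x. g x * indicator {a..b} x \<partial>lborel) \<le> (\<integral>\<^sup>+x. ennreal (?F x) * indicator {a..b} x \<partial>lborel)"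
  proof (rule nn_integral_mono_AE)
    show "AE x in lborel. g x * indicator {a..b} x \<le> ennreal (?F x) * indicator {a..b} x"
      using AE_lborel_singleton[of a] AE_lborel_singleton[of b]
      by eventually_elim (auto split: split_indicator intro!: assms(5))
  qed
  then show ?thesis using I by simp
qed

text \<open>The exceptional set \<open>S\<close> accommodates antiderivatives written with an
  absolute value, as in the octahedron bound.\<close>

lemma nn_integral_ge_FTC:
  fixes F' F :: "real \<Rightarrow> real"
  assumes "finite S" "a \<le> b" "continuous_on {a..b} F"
    and "\<And>x. a < x \<Longrightarrow> x < b \<Longrightarrow> x \<notin> S \<Longrightarrow> (F has_real_derivative F' x) (at x)"
    and "\<And>x. a < x \<Longrightarrow> x < b \<Longrightarrow> 0 \<le> F' x"
    and "\<And>x. a < x \<Longrightarrow> x < b \<Longrightarrow> ennreal (F' x) \<le> g x"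
  shows "ennreal (F b - F a) \<le> (\<integral>\<^sup>+x. g x \<partial>lborel)"
proof -
  let ?F = "\<lambda>x. if a < x \<and> x < b then F' x else 0"
  have "(?F has_integral (F b - F a)) {a..b}"
  proof (rule fundamental_theorem_of_calculus_interior_strong[OF assms(1,2) _ assms(3)])
    fix x assume "x \<in> {a<..<b} - S"
    then show "(F has_vector_derivative (if a < x \<and> x < b then F' x else 0)) (at x)"
      using assms(4)[of x] by (simp add: has_real_derivative_iff_has_vector_derivative)
  qed
  then have I: "(\<integral>\<^sup>+x. ennreal (?F x) * indicator {a..b} x \<partial>lborel) = ennreal (F b - F a)"
    using assms(5) by (intro nn_integral_has_integral_lebesgue') auto
  have "(\<integral>\<^sup>+x. ennreal (?F x) * indicator {a..b} x \<partial>lborel) \<le> (\<integral>\<^sup>+x. g x \<partial>lborel)"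
    by (intro nn_integral_mono) (auto split: split_indicator intro!: assms(6))
  then show ?thesis using I by simp
qed

text \<open>With \<open>\<alpha> = arctan T\<close> the left side is
  \<open>\<alpha> * (1 - ln (2 * sin \<alpha>))\<close>. The same expression bounds the Lobachevsky
  function at \<open>\<alpha>\<close> if \<open>sin\<close> is replaced by its chord from 0 to
  \<open>\<alpha>\<close> inside the defining integral. Its maximum is about 0.53, so piecewise
  linear bounds for \<open>sin\<close> are good enough.\<close>

lemma arctan_log_bound:
  assumes "T > 0"
  shows "arctan T * (ln ((1 + T\<^sup>2) / T\<^sup>2) + 2 - 2 * ln 2) / 2 \<le> 14 / 25"
proof -
  define \<alpha> where "\<alpha> = arctan T"
  define s where "s = sin \<alpha>"
  have \<alpha>: "0 < \<alpha>" "\<alpha> < pi / 2" using assms arctan_ubound by (auto simp: \<alpha>_def)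
  have s0: "s > 0" using \<alpha> by (simp add: s_def sin_gt_zero)
  have T: "T = tan \<alpha>" by (simp add: \<alpha>_def tan_arctan)
  have c0: "cos \<alpha> > 0" using \<alpha> by (simp add: cos_gt_zero)
  have cs: "(cos \<alpha>)\<^sup>2 = 1 - s\<^sup>2" by (simp add: s_def cos_squared_eq)
  have "T\<^sup>2 = s\<^sup>2 / (cos \<alpha>)\<^sup>2" by (simp add: T s_def tan_def power_divide)
  then have "T\<^sup>2 * (cos \<alpha>)\<^sup>2 = s\<^sup>2" using c0 by simp
  then have "(1 + T\<^sup>2) * s\<^sup>2 = T\<^sup>2" unfolding cs by (simp add: algebra_simps)
  then have "(1 + T\<^sup>2) / T\<^sup>2 = 1 / s\<^sup>2" using assms s0 by (simp add: frac_eq_eq)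
  then have L: "ln ((1 + T\<^sup>2) / T\<^sup>2) = - 2 * ln s" using s0 by (simp add: ln_div ln_realpow)
  have eq: "arctan T * (ln ((1 + T\<^sup>2) / T\<^sup>2) + 2 - 2 * ln 2) / 2 = \<alpha> * (1 - ln (2 * s))"
    using s0 by (simp add: L \<alpha>_def[symmetric] ln_mult field_simps)
  have conc: "concave_on {0..pi} sin"
    by (rule f''_le0_imp_concave[where f' = cos and f'' = "\<lambda>x. - sin x"])
       (auto intro!: derivative_eq_intros sin_ge_zero)
  have q: "sqrt 2 \<ge> 1.414" by (rule real_le_rsqrt) (simp add: power2_eq_square)
  have q2: "sqrt 2 / 2 \<ge> 0.707" using q by simp
  have sin45: "sin (pi / 4) = sqrt 2 / 2" by (rule sin_45)
  note pi = pi_approx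
  \<comment> \<open>An upper bound for \<open>- ln y\<close> that is exact at \<open>y = c\<close>.
    Small angles use \<open>c = 1\<close>; the others use \<open>c = exp (1/2)\<close>, which lies
    in the middle part of the range of \<open>2 * s\<close> between sqrt 2 and 2.\<close>
  have lnle: "- ln y \<le> c / y - 1 - ln c" if "y > 0" "c > 0" for y c :: real
    using ln_le_minus_one[of "c / y"] that by (simp add: ln_div)
  show ?thesis
  proof (cases "\<alpha> \<le> pi / 4")
    case True
    define t where "t = \<alpha> / (pi / 4)"
    have t: "0 < t" "t \<le> 1" using True \<alpha> by (auto simp: t_def field_simps)
    have "(1 - t) * sin 0 + t * sin (pi / 4) \<le> sin ((1 - t) *\<^sub>R 0 + t *\<^sub>R (pi / 4))"
      by (rule concave_onD[OF conc]) (use t in auto)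
    then have "t * 0.707 \<le> s" using q2 t mult_left_mono[OF q2, of t] by (simp add: sin45 t_def s_def)
    then have ts: "1.414 * t \<le> 2 * s" by simp
    have "1 - ln (2 * s) \<le> 1 / (2 * s)" using lnle[of "2 * s" 1] s0 by simp
    also have "\<dots> \<le> 1 / (1.414 * t)" using ts t s0 by (intro divide_left_mono) auto
    finally have "\<alpha> * (1 - ln (2 * s)) \<le> \<alpha> * (1 / (1.414 * t))"
      using \<alpha> by (intro mult_left_mono) auto
    also have "\<dots> = pi / 4 / 1.414" using \<alpha> by (simp add: t_def)
    also have "\<dots> \<le> 14 / 25" using pi by simp
    finally show ?thesis using eq by simp
  next
    case False
    define t where "t = \<alpha> / (pi / 4)"
    have t: "1 < t" "t \<le> 2" using False \<alpha> by (auto simp: t_def field_simps)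
    have at: "\<alpha> = t * (pi / 4)" by (simp add: t_def)
    have "(1 - (t - 1)) * sin (pi/4) + (t - 1) * sin (pi / 2)
        \<le> sin ((1 - (t - 1)) *\<^sub>R (pi/4) + (t - 1) *\<^sub>R (pi / 2))"
      by (rule concave_onD[OF conc]) (use t in auto)
    also have "(1 - (t - 1)) *\<^sub>R (pi/4) + (t - 1) *\<^sub>R (pi / 2) = \<alpha>"
      by (simp add: at algebra_simps) (simp add: field_simps)
    finally have "(2 - t) * (sqrt 2 / 2) + (t - 1) \<le> s" by (simp add: sin45 s_def)
    moreover have "(2 - t) * 0.707 \<le> (2 - t) * (sqrt 2 / 2)" using q2 t by (intro mult_left_mono) auto
    \<comment> \<open>The chord of \<open>sin\<close> between pi/4 and pi/2, with sqrt 2 / 2 rounded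
      down to 0.707.\<close>
    ultimately have D: "0.414 + 0.293 * t \<le> s" by (simp add: field_simps)
    let ?D = "0.414 + 0.293 * t"
    have D0: "?D > 0" using t by simp
    have "exp (1/2::real) ^ 2 < (1.6494::real) ^ 2"
      using e_less_272 exp_double[of "1/2::real"] by (simp add: power2_eq_square)
    then have e: "exp (1/2::real) \<le> 1.6494" using power2_less_imp_less less_imp_le by fastforce
    have "1 - ln (2 * s) \<le> exp (1/2) / (2 * s) - 1 / 2" using lnle[of "2 * s" "exp (1/2)"] s0 by simp
    also have "\<dots> \<le> 1.6494 / (2 * s) - 1/2" using e s0 by (intro diff_right_mono divide_right_mono) auto
    also have "\<dots> \<le> 1.6494 / (2 * ?D) - 1/2" using D D0 s0
      by (intro diff_mono divide_left_mono) auto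
    also have "\<dots> = (0.6177 - 0.1465 * t) / ?D" using D0 by (simp add: field_simps)
    finally have "\<alpha> * (1 - ln (2 * s)) \<le> \<alpha> * ((0.6177 - 0.1465 * t) / ?D)"
      using \<alpha> by (intro mult_left_mono) auto
    also have "\<dots> \<le> (t * 0.7854) * ((0.6177 - 0.1465 * t) / ?D)"
      using t D0 pi by (intro mult_right_mono divide_nonneg_pos) (auto simp: at)
    also have "\<dots> = (t * 0.7854 * (0.6177 - 0.1465 * t)) / ?D" by simp
    also have "\<dots> \<le> 14 / 25"
    proof -
      \<comment> \<open>The difference of the two sides is a quadratic in \<open>t\<close> with
        negative discriminant, and 1.395 is close to its minimiser.\<close>
      have "0 \<le> (t - 1.395)\<^sup>2" by simp
      with t have "t * 0.7854 * (0.6177 - 0.1465 * t) \<le> 14/25 * ?D"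
        by (simp add: power2_eq_square algebra_simps)
      then show ?thesis using D0 by (simp add: pos_divide_le_eq)
    qed
    finally show ?thesis using eq by simp
  qed
qed

text \<open>\<open>1 / (1 + \<tau>\<^sup>2)\<close> decreases and \<open>w = ln (T\<^sup>2 / (T\<^sup>2 - \<tau>\<^sup>2))\<close> increases with \<open>\<bar>\<tau>\<bar>\<close>, so
  Chebyshev's inequality replaces \<open>w\<close> by its mean \<open>m = 2 - 2 ln 2\<close> over \<open>[-T, T]\<close>. Comparison with
  the point \<open>\<tau>\<^sub>0\<close> where \<open>w = m\<close> gives an upper bound with an elementary antiderivative.\<close>

lemma wedge_angle_integral_bound:
  fixes T :: real
  assumes T: "T > 0"
    and g: "\<And>\<tau>. - T < \<tau> \<Longrightarrow> \<tau> < T \<Longrightarrow>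
      g \<tau> \<le> ennreal (ln ((1 + T\<^sup>2) / (T\<^sup>2 - \<tau>\<^sup>2)) / (4 * (1 + \<tau>\<^sup>2)))"
  shows "(\<integral>\<^sup>+\<tau>. g \<tau> * indicator {-T..T} \<tau> \<partial>lborel) \<le> ennreal (14 / 25)"
proof -
  define m where "m = 2 - 2 * ln (2::real)"
  define L where "L = ln ((1 + T\<^sup>2) / T\<^sup>2)"
  \<comment> \<open>In terms of \<open>q = 1 - (\<tau> / T)^2\<close> the logarithm is
    \<open>w = - ln q\<close>, so \<open>q0\<close> is the value of \<open>q\<close> at the point
    where \<open>w = m\<close>, and \<open>f0\<close> is the value of 1 / (1 + \<tau>^2)
    there.\<close>
  define q0 where "q0 = exp (- m)"
  have "ln (2::real) \<le> 1" using ln_2_less_1 by simp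
  then have q0: "0 < q0" "q0 \<le> 1" by (auto simp: q0_def m_def)
  define f0 where "f0 = 1 / (1 + T\<^sup>2 * (1 - q0))"
  \<comment> \<open>\<open>W\<close> is an antiderivative of \<open>w\<close>. It stays continuous
    at \<tau> = T and \<tau> = - T, where \<open>w\<close> has logarithmic poles, because the poles
    enter only through x * ln x.\<close>
  define W where "W \<tau> = (T - \<tau>) * ln (T - \<tau>) - (T + \<tau>) * ln (T + \<tau>) + 2 * \<tau> + 2 * \<tau> * ln T" for \<tau>
  define F where "F \<tau> = ((L + m) * arctan \<tau> + f0 * W \<tau> - f0 * m * \<tau>) / 4" for \<tau>
  define w where "w \<tau> = 2 * ln T - ln (T - \<tau>) - ln (T + \<tau>)" for \<tau>
  define F' where "F' \<tau> = ((L + m) * (1 / (1 + \<tau>\<^sup>2)) + f0 * w \<tau> - f0 * m) / 4" for \<tau>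
  have split: "ln ((1 + T\<^sup>2) / (T\<^sup>2 - \<tau>\<^sup>2)) = L + w \<tau>" if "-T < \<tau>" "\<tau> < T" for \<tau>
  proof -
    have "T\<^sup>2 - \<tau>\<^sup>2 = (T - \<tau>) * (T + \<tau>)" by (simp add: power2_eq_square algebra_simps)
    moreover have "1 + T\<^sup>2 > 0" by (smt (verit) zero_le_power2)
    ultimately show ?thesis using that T by (simp add: L_def w_def ln_div ln_mult ln_realpow)
  qed
  have le: "ln ((1 + T\<^sup>2) / (T\<^sup>2 - \<tau>\<^sup>2)) / (4 * (1 + \<tau>\<^sup>2)) \<le> F' \<tau>" if "-T < \<tau>" "\<tau> < T" for \<tau>
  proof -
    define q where "q = (T\<^sup>2 - \<tau>\<^sup>2) / T\<^sup>2"
    define f where "f = 1 / (1 + \<tau>\<^sup>2)"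
    have "T\<^sup>2 - \<tau>\<^sup>2 = (T - \<tau>) * (T + \<tau>)" by (simp add: power2_eq_square algebra_simps)
    moreover from this have q: "q > 0" using that T by (simp add: q_def)
    ultimately have wq: "w \<tau> = - ln q" using that T by (simp add: w_def q_def ln_div ln_mult ln_realpow)
    have mq: "m = - ln q0" by (simp add: q0_def)
    have tq: "\<tau>\<^sup>2 = T\<^sup>2 * (1 - q)" using T by (simp add: q_def field_simps)
    have "(f - f0) * (w \<tau> - m) \<le> 0"
    proof (cases "q \<le> q0")
      case True
      then have "w \<tau> \<ge> m" using q q0 by (simp add: wq mq)
      moreover have "f \<le> f0" unfolding f_def f0_def tq
        using True q0 T by (intro divide_left_mono add_left_mono mult_left_mono mult_pos_pos add_pos_nonneg mult_nonneg_nonneg) auto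
      ultimately show ?thesis by (intro mult_nonpos_nonneg) auto
    next
      case False
      then have "w \<tau> \<le> m" using q q0 by (simp add: wq mq)
      moreover have "q \<le> 1" by (simp add: q_def divide_le_eq_1)
      then have "f0 \<le> f" unfolding f_def f0_def tq
        using False q0 T by (intro divide_left_mono add_left_mono mult_left_mono mult_pos_pos add_pos_nonneg mult_nonneg_nonneg) auto
      ultimately show ?thesis by (intro mult_nonneg_nonpos) auto
    qed
    then have "f * (L + w \<tau>) \<le> (L + m) * f + f0 * w \<tau> - f0 * m" by (simp add: algebra_simps)
    then have "f * (L + w \<tau>) / 4 \<le> ((L + m) * f + f0 * w \<tau> - f0 * m) / 4"
      by (rule divide_right_mono) simp
    moreover have "1 + \<tau>\<^sup>2 \<noteq> 0" by (smt (verit) zero_le_power2)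
    then have "(L + w \<tau>) / (4 * (1 + \<tau>\<^sup>2)) = f * (L + w \<tau>) / 4" by (simp add: f_def field_simps)
    ultimately show ?thesis unfolding split[OF that] F'_def f_def[symmetric] by simp
  qed
  have pos: "0 \<le> F' \<tau>" if "-T < \<tau>" "\<tau> < T" for \<tau>
  proof -
    have "T\<^sup>2 - \<tau>\<^sup>2 > 0" using that T by (simp add: abs_square_less_1 power2_eq_square) (smt (verit) mult_strict_mono' mult_minus_left mult_minus_right)
    then have "1 \<le> (1 + T\<^sup>2) / (T\<^sup>2 - \<tau>\<^sup>2)" by (simp add: pos_le_divide_eq) (smt (verit) zero_le_power2)
    then have "0 \<le> ln ((1 + T\<^sup>2) / (T\<^sup>2 - \<tau>\<^sup>2))" by simp
    then have "0 \<le> ln ((1 + T\<^sup>2) / (T\<^sup>2 - \<tau>\<^sup>2)) / (4 * (1 + \<tau>\<^sup>2))"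
      by (intro divide_nonneg_nonneg) auto
    then show ?thesis using le[OF that] by linarith
  qed
  have contW: "isCont W \<tau>" for \<tau>
  proof -
    have 1: "isCont (\<lambda>\<tau>. (T - \<tau>) * ln (T - \<tau>)) \<tau>"
      by (rule isCont_o2[where g = "\<lambda>x. x * ln x", OF _ isCont_x_ln_x]) (intro continuous_intros)
    have 2: "isCont (\<lambda>\<tau>. (T + \<tau>) * ln (T + \<tau>)) \<tau>"
      by (rule isCont_o2[where g = "\<lambda>x. x * ln x", OF _ isCont_x_ln_x]) (intro continuous_intros)
    have "isCont (\<lambda>\<tau>. 2 * \<tau> + 2 * \<tau> * ln T) \<tau>" by (intro continuous_intros)
    from isCont_add[OF isCont_diff[OF 1 2] this]
    show ?thesis unfolding W_def by (simp add: add.assoc)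
  qed
  have contF: "continuous_on {-T..T} F"
    unfolding F_def by (intro continuous_at_imp_continuous_on ballI continuous_intros contW) auto
  have der: "(F has_real_derivative F' \<tau>) (at \<tau>)" if "-T < \<tau>" "\<tau> < T" for \<tau>
  proof -
    have 1: "((\<lambda>\<tau>. (T - \<tau>) * ln (T - \<tau>)) has_real_derivative - ln (T - \<tau>) - 1) (at \<tau>)"
      using that by (auto intro!: derivative_eq_intros)
    have 2: "((\<lambda>\<tau>. (T + \<tau>) * ln (T + \<tau>)) has_real_derivative ln (T + \<tau>) + 1) (at \<tau>)"
      using that by (auto intro!: derivative_eq_intros)
    have 3: "((\<lambda>\<tau>. 2 * \<tau> + 2 * \<tau> * ln T) has_real_derivative 2 + 2 * ln T) (at \<tau>)"
      by (auto intro!: derivative_eq_intros)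
    have W: "(W has_real_derivative w \<tau>) (at \<tau>)"
      using DERIV_add[OF DERIV_diff[OF 1 2] 3] unfolding W_def w_def
      by (rule DERIV_cong[THEN has_field_derivative_transform_within_open[where S = UNIV]]) auto
    show ?thesis unfolding F_def F'_def
      by (rule derivative_eq_intros W refl | simp)+ (simp add: inverse_eq_divide)
  qed
  have "(\<integral>\<^sup>+\<tau>. g \<tau> * indicator {-T..T} \<tau> \<partial>lborel) \<le> ennreal (F T - F (- T))"
  proof (rule nn_integral_le_FTC[OF _ contF der pos])
    fix \<tau> assume \<tau>: "-T < \<tau>" "\<tau> < T"
    show "g \<tau> \<le> ennreal (F' \<tau>)"
      using g[OF \<tau>] ennreal_leI[OF le[OF \<tau>]] by (rule order_trans)
  qed (use T in auto)
  \<comment> \<open>Since \<open>m\<close> is the mean of \<open>w\<close> over [-T, T], the terms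
    with \<open>f0\<close> cancel at the end points and only the arctangent remains.\<close>
  also have "F T - F (- T) = arctan T * (L + m) / 2"
  proof -
    have "W T = m * T" "W (- T) = - m * T"
      using T by (simp_all add: W_def m_def ln_mult algebra_simps)
    then show ?thesis by (simp add: F_def arctan_minus field_simps)
  qed
  also have "\<dots> \<le> 14 / 25"
    using arctan_log_bound[OF T] by (simp add: L_def m_def algebra_simps)
  finally show ?thesis by (simp add: ennreal_leI)
qed

text \<open>In coordinates \<open>x\<close>, \<open>y\<close>, z = \<tau> y, a slice with fixed
  \<tau> is a triangle, and the factor \<open>y\<close> is the Jacobian. The assumption
  \<open>eq\<close> places the two outer corners (h, c h, T c h) and (h, c h, - T c h) of the wedge
  on the unit sphere; hence the integrand is bounded on every slice with |\<tau>| < T.\<close>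

lemma wedge_slice_integral_bound:
  fixes h c T \<tau> :: real
  assumes h: "0 < h" "h < 1" and c: "c > 0" and T: "T > 0"
    and eq: "h\<^sup>2 * (1 + c\<^sup>2 * (1 + T\<^sup>2)) = 1" and \<tau>: "- T < \<tau>" "\<tau> < T"
  shows "(\<integral>\<^sup>+x. (\<integral>\<^sup>+y. ennreal (y / (1 - (x\<^sup>2 + y\<^sup>2 * (1 + \<tau>\<^sup>2)))\<^sup>2) * indicator {0..c * x} y \<partial>lborel)
            * indicator {0..h} x \<partial>lborel)
      \<le> ennreal (ln ((1 + T\<^sup>2) / (T\<^sup>2 - \<tau>\<^sup>2)) / (4 * (1 + \<tau>\<^sup>2)))"
proof -
  define a where "a = 1 + \<tau>\<^sup>2"
  define A where "A = 1 + c\<^sup>2 * a"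
  have a: "a > 0" unfolding a_def by (smt (verit) zero_le_power2)
  have A: "A > 1" using a c by (simp add: A_def)
  have \<tau>T: "T\<^sup>2 - \<tau>\<^sup>2 > 0"
  proof -
    have "(T - \<tau>) * (T + \<tau>) > 0" using \<tau> by simp
    then show ?thesis by (simp add: power2_eq_square algebra_simps)
  qed
  have Ah: "1 - A * h\<^sup>2 = h\<^sup>2 * c\<^sup>2 * (T\<^sup>2 - \<tau>\<^sup>2)"
    using eq by (simp add: A_def a_def algebra_simps)
  have hh: "1 - h\<^sup>2 = h\<^sup>2 * c\<^sup>2 * (1 + T\<^sup>2)"
    using eq by (simp add: algebra_simps)
  have Ah0: "A * h\<^sup>2 < 1"
  proof -
    have "h\<^sup>2 * c\<^sup>2 * (T\<^sup>2 - \<tau>\<^sup>2) > 0" using \<tau>T h c by simp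
    then show ?thesis using Ah by linarith
  qed
  have Ax: "A * x\<^sup>2 < 1" "x\<^sup>2 < 1" if "0 \<le> x" "x \<le> h" for x
  proof -
    have "x\<^sup>2 \<le> h\<^sup>2" using that by (simp add: power_mono)
    moreover have "A * x\<^sup>2 \<le> A * h\<^sup>2" using calculation A by (intro mult_left_mono) auto
    moreover have "1 * x\<^sup>2 \<le> A * x\<^sup>2" using A by (intro mult_right_mono) auto
    ultimately show "A * x\<^sup>2 < 1" "x\<^sup>2 < 1" using Ah0 by linarith+
  qed
  have inner: "(\<integral>\<^sup>+y. ennreal (y / (1 - (x\<^sup>2 + y\<^sup>2 * a))\<^sup>2) * indicator {0..c * x} y \<partial>lborel)
      \<le> ennreal (1 / (2 * a * (1 - A * x\<^sup>2)) - 1 / (2 * a * (1 - x\<^sup>2)))" (is "?I \<le> _")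
    if x: "0 \<le> x" "x \<le> h" for x
  proof -
    let ?F = "\<lambda>y. 1 / (2 * a * (1 - (x\<^sup>2 + y\<^sup>2 * a)))"
    have pos: "1 - (x\<^sup>2 + y\<^sup>2 * a) > 0" if "0 \<le> y" "y \<le> c * x" for y
    proof -
      have "y\<^sup>2 * a \<le> (c * x)\<^sup>2 * a" using that a by (intro mult_right_mono power_mono) auto
      then have "x\<^sup>2 + y\<^sup>2 * a \<le> A * x\<^sup>2" by (simp add: A_def algebra_simps power_mult_distrib)
      then show ?thesis using Ax[OF x] by linarith
    qed
    have der: "(?F has_real_derivative y / (1 - (x\<^sup>2 + y\<^sup>2 * a))\<^sup>2) (at y)"
      if "0 \<le> y" "y \<le> c * x" for y
    proof -
      define q where "q = 1 - (x\<^sup>2 + y\<^sup>2 * a)"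
      have q: "q > 0" using pos[OF that] by (simp add: q_def)
      have F: "?F = (\<lambda>y. 1 / (2 * a) * inverse (1 - (x\<^sup>2 + y\<^sup>2 * a)))"
        by (simp add: fun_eq_iff inverse_eq_divide)
      have "((\<lambda>y. 1 - (x\<^sup>2 + y\<^sup>2 * a)) has_real_derivative - 2 * y * a) (at y)"
        by (auto intro!: derivative_eq_intros)
      from DERIV_cmult[OF DERIV_inverse'[OF this], of "1 / (2 * a)"] pos[OF that]
      have "((\<lambda>y. 1 / (2 * a) * inverse (1 - (x\<^sup>2 + y\<^sup>2 * a))) has_real_derivative
          1 / (2 * a) * - (inverse q * (- 2 * y * a) * inverse q)) (at y)" by (simp add: q_def)
      moreover have "1 / (2 * a) * - (inverse q * (- 2 * y * a) * inverse q) = y / q\<^sup>2"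
        using q a by (simp add: divide_simps power2_eq_square)
      ultimately show ?thesis unfolding F q_def by simp
    qed
    have "?I \<le> ennreal (?F (c * x) - ?F 0)"
    proof (rule nn_integral_le_FTC)
      show "0 \<le> c * x" using c x by simp
      show "continuous_on {0..c * x} ?F"
        using der by (intro DERIV_atLeastAtMost_imp_continuous_on) auto
      show "(?F has_real_derivative y / (1 - (x\<^sup>2 + y\<^sup>2 * a))\<^sup>2) (at y)" if "0 < y" "y < c * x" for y
        using der that by simp
    qed auto
    then show ?thesis by (simp add: A_def algebra_simps power_mult_distrib)
  qed
  \<comment> \<open>The integrand in \<open>x\<close> is x * x times a rational function. Replacing
    one factor \<open>x\<close> by its upper bound \<open>h\<close> gives it a logarithmic
    antiderivative, and the error becomes negligible as \<open>h\<close> tends to 1, the extremal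
    regime.\<close>
  let ?G = "\<lambda>x. h / (4 * a) * (ln (1 - x\<^sup>2) - ln (1 - A * x\<^sup>2))"
  let ?G' = "\<lambda>x. h / (4 * a) * (- 2 * x / (1 - x\<^sup>2) + 2 * A * x / (1 - A * x\<^sup>2))"
  have G': "?G' x = h * x * ((A - 1) / (2 * a * (1 - A * x\<^sup>2) * (1 - x\<^sup>2)))" if x: "0 \<le> x" "x \<le> h" for x
    using Ax[OF x] a by (simp add: divide_simps) (simp add: algebra_simps)
  have E: "1 / (2 * a * (1 - A * x\<^sup>2)) - 1 / (2 * a * (1 - x\<^sup>2))
      = x * x * ((A - 1) / (2 * a * (1 - A * x\<^sup>2) * (1 - x\<^sup>2)))" if x: "0 \<le> x" "x \<le> h" for x
    using Ax[OF x] a by (simp add: divide_simps) (simp add: algebra_simps power2_eq_square)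
  have P: "0 \<le> (A - 1) / (2 * a * (1 - A * x\<^sup>2) * (1 - x\<^sup>2))" if x: "0 \<le> x" "x \<le> h" for x
    using Ax[OF x] a A by (intro divide_nonneg_nonneg mult_nonneg_nonneg) auto
  have der: "(?G has_real_derivative ?G' x) (at x)" if x: "0 \<le> x" "x \<le> h" for x
    using Ax[OF x] a by (auto intro!: derivative_eq_intros)
  have "(\<integral>\<^sup>+x. (\<integral>\<^sup>+y. ennreal (y / (1 - (x\<^sup>2 + y\<^sup>2 * a))\<^sup>2) * indicator {0..c * x} y \<partial>lborel)
            * indicator {0..h} x \<partial>lborel) \<le> ennreal (?G h - ?G 0)"
  proof (rule nn_integral_le_FTC)
    show "continuous_on {0..h} ?G"
      using der by (intro DERIV_atLeastAtMost_imp_continuous_on) auto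
    fix x assume x: "0 < x" "x < h"
    then show "(?G has_real_derivative ?G' x) (at x)" using der by simp
    show "0 \<le> ?G' x"
      unfolding G'[OF less_imp_le[OF x(1)] less_imp_le[OF x(2)]]
      using P[of x] x h by (intro mult_nonneg_nonneg) auto
    have "1 / (2 * a * (1 - A * x\<^sup>2)) - 1 / (2 * a * (1 - x\<^sup>2)) \<le> ?G' x"
      unfolding G'[OF less_imp_le[OF x(1)] less_imp_le[OF x(2)]] E[OF less_imp_le[OF x(1)] less_imp_le[OF x(2)]]
      using P[of x] x by (intro mult_right_mono) auto
    from order_trans[OF inner[OF less_imp_le[OF x(1)] less_imp_le[OF x(2)]] ennreal_leI[OF this]]
    show "(\<integral>\<^sup>+y. ennreal (y / (1 - (x\<^sup>2 + y\<^sup>2 * a))\<^sup>2) * indicator {0..c * x} y \<partial>lborel) \<le> ennreal (?G' x)" .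
  qed (use h in auto)
  also have "?G h - ?G 0 = h * (ln ((1 + T\<^sup>2) / (T\<^sup>2 - \<tau>\<^sup>2)) / (4 * a))"
  proof -
    have "1 + T\<^sup>2 > 0" by (smt (verit) zero_le_power2)
    then have "ln (1 - h\<^sup>2) - ln (1 - A * h\<^sup>2) = ln ((1 + T\<^sup>2) / (T\<^sup>2 - \<tau>\<^sup>2))"
      unfolding Ah hh using \<tau>T h c by (simp add: ln_mult ln_div)
    then show ?thesis by simp
  qed
  also have "\<dots> \<le> 1 * (ln ((1 + T\<^sup>2) / (T\<^sup>2 - \<tau>\<^sup>2)) / (4 * a))"
  proof (rule mult_right_mono)
    have "1 \<le> (1 + T\<^sup>2) / (T\<^sup>2 - \<tau>\<^sup>2)" using \<tau>T by (simp add: pos_le_divide_eq) (smt (verit) zero_le_power2)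
    then show "0 \<le> ln ((1 + T\<^sup>2) / (T\<^sup>2 - \<tau>\<^sup>2)) / (4 * a)" using a by simp
  qed (use h in simp)
  finally show ?thesis by (simp add: a_def ennreal_leI)
qed

text \<open>The substitution z = y \<tau> and an exchange of integrals put \<tau> outermost, so that
  the slice bound can be integrated over the angle. At y = 0 the substitution degenerates, but this
  is a null set.\<close>

lemma wedge_integral_bound:
  fixes h c T :: real
  assumes h: "0 < h" "h < 1" and c: "c > 0" and T: "T > 0"
    and eq: "h\<^sup>2 * (1 + c\<^sup>2 * (1 + T\<^sup>2)) = 1"
  shows "(\<integral>\<^sup>+x. \<integral>\<^sup>+y. \<integral>\<^sup>+z. ennreal (1 / (1 - (x\<^sup>2 + y\<^sup>2 + z\<^sup>2))\<^sup>2) *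
      (indicator {0..h} x * indicator {0..c * x} y * indicator {- (T * y)..T * y} z)
        \<partial>lborel \<partial>lborel \<partial>lborel) \<le> ennreal (14 / 25)"
proof -
  define G :: "real \<Rightarrow> real \<Rightarrow> real \<Rightarrow> ennreal" where
    "G x y \<tau> = (if 0 \<le> x \<and> x \<le> h \<and> 0 \<le> y \<and> y \<le> c * x \<and> - T \<le> \<tau> \<and> \<tau> \<le> T
       then ennreal (y / (1 - (x\<^sup>2 + y\<^sup>2 * (1 + \<tau>\<^sup>2)))\<^sup>2) else 0)" for x y \<tau>
  have [measurable (raw)]: "(\<lambda>v. G (f v) (g v) (k v)) \<in> borel_measurable M"
    if [measurable]: "f \<in> borel_measurable M" "g \<in> borel_measurable M" "k \<in> borel_measurable M"
    for M :: "'z measure" and f g k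
    unfolding G_def by measurable
  have scale: "(\<integral>\<^sup>+z. ennreal (1 / (1 - (x\<^sup>2 + y\<^sup>2 + z\<^sup>2))\<^sup>2) *
      (indicator {0..h} x * indicator {0..c * x} y * indicator {- (T * y)..T * y} z) \<partial>lborel)
      = (\<integral>\<^sup>+\<tau>. G x y \<tau> \<partial>lborel)" (is "?L = _") if "y \<noteq> 0" for x y
  proof (cases "y > 0")
    case True
    have "?L = \<bar>y\<bar> * (\<integral>\<^sup>+\<tau>. ennreal (1 / (1 - (x\<^sup>2 + y\<^sup>2 + (0 + y * \<tau>)\<^sup>2))\<^sup>2) *
      (indicator {0..h} x * indicator {0..c * x} y * indicator {- (T * y)..T * y} (0 + y * \<tau>)) \<partial>lborel)"
      by (rule nn_integral_real_affine) (use True in \<open>measurable, simp\<close>)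
    also have "\<dots> = (\<integral>\<^sup>+\<tau>. \<bar>y\<bar> * (ennreal (1 / (1 - (x\<^sup>2 + y\<^sup>2 + (0 + y * \<tau>)\<^sup>2))\<^sup>2) *
      (indicator {0..h} x * indicator {0..c * x} y * indicator {- (T * y)..T * y} (0 + y * \<tau>))) \<partial>lborel)"
      by (rule nn_integral_cmult[symmetric]) measurable
    also have "\<dots> = (\<integral>\<^sup>+\<tau>. G x y \<tau> \<partial>lborel)"
    proof (intro nn_integral_cong)
      fix \<tau>
      have "0 + y * \<tau> \<in> {- (T * y)..T * y} \<longleftrightarrow> - T \<le> \<tau> \<and> \<tau> \<le> T"
        using True mult_le_cancel_left_pos[of y "- T" \<tau>] mult_le_cancel_left_pos[of y \<tau> T]
        by (simp add: mult.commute)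
      moreover have "x\<^sup>2 + y\<^sup>2 + (0 + y * \<tau>)\<^sup>2 = x\<^sup>2 + y\<^sup>2 * (1 + \<tau>\<^sup>2)" by (simp add: algebra_simps power_mult_distrib)
      ultimately show "\<bar>y\<bar> * (ennreal (1 / (1 - (x\<^sup>2 + y\<^sup>2 + (0 + y * \<tau>)\<^sup>2))\<^sup>2) *
        (indicator {0..h} x * indicator {0..c * x} y * indicator {- (T * y)..T * y} (0 + y * \<tau>))) = G x y \<tau>"
        using True by (auto simp: G_def indicator_def ennreal_mult[symmetric] add.assoc)
    qed
    finally show ?thesis .
  next
    case False
    then show ?thesis using that by (auto simp: G_def indicator_def)
  qed
  have "(\<integral>\<^sup>+x. \<integral>\<^sup>+y. \<integral>\<^sup>+z. ennreal (1 / (1 - (x\<^sup>2 + y\<^sup>2 + z\<^sup>2))\<^sup>2) *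
      (indicator {0..h} x * indicator {0..c * x} y * indicator {- (T * y)..T * y} z)
        \<partial>lborel \<partial>lborel \<partial>lborel) = (\<integral>\<^sup>+x. \<integral>\<^sup>+y. \<integral>\<^sup>+\<tau>. G x y \<tau> \<partial>lborel \<partial>lborel \<partial>lborel)"
  proof (rule nn_integral_cong, rule nn_integral_cong_AE)
    fix x
    show "AE y in lborel. (\<integral>\<^sup>+z. ennreal (1 / (1 - (x\<^sup>2 + y\<^sup>2 + z\<^sup>2))\<^sup>2) *
      (indicator {0..h} x * indicator {0..c * x} y * indicator {- (T * y)..T * y} z) \<partial>lborel)
      = (\<integral>\<^sup>+\<tau>. G x y \<tau> \<partial>lborel)"
      using AE_lborel_singleton[of 0] by eventually_elim (rule scale)
  qed
  also have "\<dots> = (\<integral>\<^sup>+x. \<integral>\<^sup>+\<tau>. \<integral>\<^sup>+y. G x y \<tau> \<partial>lborel \<partial>lborel \<partial>lborel)"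
    by (intro nn_integral_cong lborel_pair.Fubini') measurable
  also have "\<dots> = (\<integral>\<^sup>+\<tau>. \<integral>\<^sup>+x. \<integral>\<^sup>+y. G x y \<tau> \<partial>lborel \<partial>lborel \<partial>lborel)"
    by (intro lborel_pair.Fubini') measurable
  also have "\<dots> = (\<integral>\<^sup>+\<tau>. (\<integral>\<^sup>+x. \<integral>\<^sup>+y. G x y \<tau> \<partial>lborel \<partial>lborel) * indicator {-T..T} \<tau> \<partial>lborel)"
    by (intro nn_integral_cong) (auto simp: G_def indicator_def)
  also have "\<dots> \<le> ennreal (14 / 25)"
  proof (rule wedge_angle_integral_bound[OF T])
    fix \<tau> assume \<tau>: "- T < \<tau>" "\<tau> < T"
    have "(\<integral>\<^sup>+x. \<integral>\<^sup>+y. G x y \<tau> \<partial>lborel \<partial>lborel) =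
      (\<integral>\<^sup>+x. (\<integral>\<^sup>+y. ennreal (y / (1 - (x\<^sup>2 + y\<^sup>2 * (1 + \<tau>\<^sup>2)))\<^sup>2) * indicator {0..c * x} y \<partial>lborel)
            * indicator {0..h} x \<partial>lborel)"
      using \<tau> by (intro nn_integral_cong) (auto simp: G_def indicator_def intro!: nn_integral_cong)
    also have "\<dots> \<le> ennreal (ln ((1 + T\<^sup>2) / (T\<^sup>2 - \<tau>\<^sup>2)) / (4 * (1 + \<tau>\<^sup>2)))"
      by (rule wedge_slice_integral_bound[OF h c T eq \<tau>])
    finally show "(\<integral>\<^sup>+x. \<integral>\<^sup>+y. G x y \<tau> \<partial>lborel \<partial>lborel)
      \<le> ennreal (ln ((1 + T\<^sup>2) / (T\<^sup>2 - \<tau>\<^sup>2)) / (4 * (1 + \<tau>\<^sup>2)))" .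
  qed
  finally show ?thesis .
qed

section \<open>From the wedge to the flag simplex\<close>

lemma hyp_measure_null_of_negligible:
  assumes "negligible S" "S \<in> sets borel"
  shows "emeasure hyp_measure S = 0"
proof -
  have "S \<in> null_sets lborel"
    using assms by (simp add: negligible_iff_null_sets null_sets_completion_iff)
  then have "AE x in lborel. x \<notin> S" by (rule AE_not_in)
  then have "AE x in lborel. ennreal (1 / (1 - (norm x)\<^sup>2)\<^sup>2) * indicator (hyp3 \<inter> S) x = 0"
    by eventually_elim simp
  then have "(\<integral>\<^sup>+v. ennreal (1 / (1 - (norm v)\<^sup>2)\<^sup>2) * indicator (hyp3 \<inter> S) v \<partial>lborel) = integral\<^sup>N lborel (\<lambda>v::real^3. 0)"
    by (rule nn_integral_cong_AE)
  then show ?thesis using emeasure_hyp_measure[OF assms(2)] by simp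
qed

text \<open>\<open>s\<close> is the joint weight of \<open>p\<close>, \<open>a\<close>,
  \<open>b\<close>, and \<open>u\<close>, \<open>v\<close> are the weights of \<open>a\<close>,
  \<open>b\<close>. This separates the height along \<open>p\<close> from the displacement within
  the plane of the face.\<close>

lemma convex_hull_zero_insert_3_subset:
  fixes p a b :: "'a::real_vector"
  assumes "y \<in> convex hull {0, p, a, b}"
  obtains s u v where "0 \<le> u" "0 \<le> v" "u + v \<le> s" "s \<le> 1" "y = s *\<^sub>R p + u *\<^sub>R (a - p) + v *\<^sub>R (b - p)"
proof -
  let ?C = "{s *\<^sub>R p + u *\<^sub>R (a - p) + v *\<^sub>R (b - p) |s u v. 0 \<le> u \<and> 0 \<le> v \<and> u + v \<le> s \<and> s \<le> (1::real)}"
  have "convex hull {0, p, a, b} \<subseteq> ?C"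
  proof (rule hull_minimal)
    have "0 \<in> ?C" by (rule CollectI, rule exI[of _ 0], rule exI[of _ 0], rule exI[of _ 0]) simp
    moreover have "p \<in> ?C" by (rule CollectI, rule exI[of _ 1], rule exI[of _ 0], rule exI[of _ 0]) simp
    moreover have "a \<in> ?C" by (rule CollectI, rule exI[of _ 1], rule exI[of _ 1], rule exI[of _ 0]) simp
    moreover have "b \<in> ?C" by (rule CollectI, rule exI[of _ 1], rule exI[of _ 0], rule exI[of _ 1]) simp
    ultimately show "{0, p, a, b} \<subseteq> ?C" by simp
    show "convex ?C"
    proof (rule convexI)
      fix x y and \<mu> \<nu> :: real
      assume "x \<in> ?C" "y \<in> ?C" and m: "0 \<le> \<mu>" "0 \<le> \<nu>" "\<mu> + \<nu> = 1"
      then obtain s u v s' u' v' where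
        x: "0 \<le> u" "0 \<le> v" "u + v \<le> s" "s \<le> 1" "x = s *\<^sub>R p + u *\<^sub>R (a - p) + v *\<^sub>R (b - p)" and
        y: "0 \<le> u'" "0 \<le> v'" "u' + v' \<le> s'" "s' \<le> 1" "y = s' *\<^sub>R p + u' *\<^sub>R (a - p) + v' *\<^sub>R (b - p)"
        by blast
      have "\<mu> *\<^sub>R x + \<nu> *\<^sub>R y = (\<mu> * s+\<nu> * s') *\<^sub>R p + (\<mu> * u+\<nu> * u') *\<^sub>R (a - p) + (\<mu> * v+\<nu> * v') *\<^sub>R (b - p)"
        by (simp add: x y algebra_simps)
      moreover have "0 \<le> \<mu> * u+\<nu> * u'" "0 \<le> \<mu> * v+\<nu> * v'" using x y m by auto
      moreover have "(\<mu> * u+\<nu> * u') + (\<mu> * v+\<nu> * v') \<le> \<mu> * s+\<nu> * s'"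
        using mult_left_mono[OF x(3) m(1)] mult_left_mono[OF y(3) m(2)] by (simp add: algebra_simps)
      moreover have "\<mu> * s+\<nu> * s' \<le> 1"
        using mult_left_mono[OF x(4) m(1)] mult_left_mono[OF y(4) m(2)] m by simp
      ultimately show "\<mu> *\<^sub>R x + \<nu> *\<^sub>R y \<in> ?C" by blast
    qed
  qed
  then show ?thesis using assms that by blast
qed

text \<open>The assumptions make \<open>p\<close> orthogonal to \<open>a - p\<close> and
  \<open>b - p\<close>. Lengthening both differences until they reach the unit sphere enlarges the
  simplex to one with two ideal vertices at equal distance from \<open>p\<close>; it is symmetric
  about the bisector at \<open>p\<close>, and in the frame of \<open>p\<close>, bisector and normal
  it is exactly the wedge integrated above.\<close>

lemma emeasure_hyp_flag_simplex:
  fixes p a b :: "real^3"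
  assumes pa: "p \<bullet> a = p \<bullet> p" and pb: "p \<bullet> b = p \<bullet> p" and a: "norm a \<le> 1" and b: "norm b \<le> 1"
  shows "emeasure hyp_measure (convex hull {0, p, a, b}) \<le> ennreal (14 / 25)"
proof -
  let ?K = "convex hull {0, p, a, b}"
  have cl: "compact ?K" by (simp add: finite_imp_compact_convex_hull)
  then have meas: "?K \<in> sets borel" by (intro borel_closed compact_imp_closed)
  show ?thesis
  proof (cases "dim {p, a, b} < 3")
    case True
    have "negligible (span {p, a, b})"
      using True by (intro negligible_lowdim) simp
    moreover have "?K \<subseteq> span {p, a, b}"
      by (rule hull_minimal) (auto simp: span_zero span_base subspace_span subspace_imp_convex)
    ultimately have "negligible ?K" by (rule negligible_subset)
    then show ?thesis using hyp_measure_null_of_negligible[OF _ meas] by simp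
  next
    case False
    have small: False if "{p, a, b} \<subseteq> span {x, y}" for x y :: "real^3"
    proof -
      have "dim {p, a, b} \<le> card {x, y}" using that by (rule dim_le_card) simp
      also have "card {x, y} \<le> 2" by (simp add: card_insert_if)
      finally show False using False by simp
    qed
    define u where "u = a - p"
    define v where "v = b - p"
    have au: "a = p + u" and bv: "b = p + v" by (simp_all add: u_def v_def)
    have pu: "p \<bullet> u = 0" and pv: "p \<bullet> v = 0" using pa pb by (simp_all add: u_def v_def inner_diff_right)
    have p0: "p \<noteq> 0" using small[of a b] by (auto simp: span_base span_zero)
    have u0: "u \<noteq> 0" using small[of p b] by (auto simp: u_def span_base)
    have v0: "v \<noteq> 0" using small[of p a] by (auto simp: v_def span_base)
    define u' where "u' = u /\<^sub>R norm u"
    define v' where "v' = v /\<^sub>R norm v"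
    have n: "norm u' = 1" "norm v' = 1" using u0 v0 by (simp_all add: u'_def v'_def)
    have uu: "u = norm u *\<^sub>R u'" "v = norm v *\<^sub>R v'" using u0 v0 by (simp_all add: u'_def v'_def)
    have par: "v' \<noteq> k *\<^sub>R u'" for k
    proof
      assume "v' = k *\<^sub>R u'"
      then have "v = (norm v * k * inverse (norm u)) *\<^sub>R u" using uu(2) by (simp add: u'_def mult.assoc)
      then have "b = p + (norm v * k * inverse (norm u)) *\<^sub>R (a - p)" by (metis bv u_def)
      also have "\<dots> \<in> span {p, a}" by (intro span_add span_scale span_diff span_base) auto
      finally show False using small[of p a] by (auto simp: span_base)
    qed
    \<comment> \<open>Sum and difference of two unit vectors are orthogonal; \<open>f2\<close>
      points along the bisector of the angle at \<open>p\<close>.\<close>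
    define f2 where "f2 = u' + v'"
    define f3 where "f3 = u' - v'"
    have f2: "f2 \<noteq> 0" using par[of "-1"] by (auto simp: f2_def eq_neg_iff_add_eq_0 add.commute)
    have f3: "f3 \<noteq> 0" using par[of 1] by (auto simp: f3_def)
    have u1: "u' \<bullet> u' = 1" "v' \<bullet> v' = 1" using n by (simp_all add: dot_square_norm)
    have f23: "f2 \<bullet> f3 = 0" using u1 by (simp add: f2_def f3_def inner_simps inner_commute)
    have pf: "p \<bullet> f2 = 0" "p \<bullet> f3 = 0" using pu pv by (simp_all add: f2_def f3_def u'_def v'_def inner_simps)
    define e1 where "e1 = p /\<^sub>R norm p"
    define e2 where "e2 = f2 /\<^sub>R norm f2"
    define e3 where "e3 = f3 /\<^sub>R norm f3"
    have on: "norm e1 = 1" "norm e2 = 1" "norm e3 = 1" "e1 \<bullet> e2 = 0" "e1 \<bullet> e3 = 0" "e2 \<bullet> e3 = 0"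
      using p0 f2 f3 f23 pf by (simp_all add: e1_def e2_def e3_def)
    define h where "h = norm p"
    \<comment> \<open>\<open>C\<close> and \<open>S\<close> are cosine and sine of half the angle
      between \<open>u'\<close> and \<open>v'\<close>, so \<open>T\<close> below is the tangent of
      that half angle. \<open>R\<close> is the radius of the disc cut out of the ball by the plane
      of the face, and \<open>c\<close> is fixed by c h = R C.\<close>
    define C where "C = norm f2 / 2"
    define S where "S = norm f3 / 2"
    have CS0: "C > 0" "S > 0" using f2 f3 by (simp_all add: C_def S_def)
    have CS: "C\<^sup>2 + S\<^sup>2 = 1"
      using u1 unfolding C_def S_def power_divide power2_norm_eq_inner
      by (simp add: f2_def f3_def inner_simps inner_commute field_simps)
    have u'e: "u' = C *\<^sub>R e2 + S *\<^sub>R e3" and v'e: "v' = C *\<^sub>R e2 - S *\<^sub>R e3"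
    proof -
      have "C *\<^sub>R e2 = (1/2) *\<^sub>R f2" "S *\<^sub>R e3 = (1/2) *\<^sub>R f3"
        using f2 f3 by (simp_all add: C_def S_def e2_def e3_def)
      moreover have "f2 + f3 = u' + u'" "f2 - f3 = v' + v'" by (simp_all add: f2_def f3_def)
      then have "(1/2) *\<^sub>R (f2 + f3) = u'" "(1/2) *\<^sub>R (f2 - f3) = v'" by simp_all
      ultimately show "u' = C *\<^sub>R e2 + S *\<^sub>R e3" "v' = C *\<^sub>R e2 - S *\<^sub>R e3"
        by (simp_all only: scaleR_add_right scaleR_diff_right)
    qed
    have h0: "h > 0" using p0 by (simp add: h_def)
    have na: "(norm a)\<^sup>2 = h\<^sup>2 + (norm u)\<^sup>2" "(norm b)\<^sup>2 = h\<^sup>2 + (norm v)\<^sup>2"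
      using pu pv unfolding au bv h_def power2_norm_eq_inner by (simp_all add: inner_simps inner_commute)
    have a1: "(norm a)\<^sup>2 \<le> 1" "(norm b)\<^sup>2 \<le> 1" using a b by (simp_all add: power_le_one)
    define R where "R = sqrt (1 - h\<^sup>2)"
    have uR: "norm u \<le> R" "norm v \<le> R" using na a1 unfolding R_def by (auto intro!: real_le_rsqrt)
    have R0: "R > 0" using uR(1) u0 by (smt (verit) norm_le_zero_iff)
    then have h21: "h\<^sup>2 < 1" unfolding R_def by simp
    then have h1: "h < 1" using h0 power2_less_imp_less[of h 1] by simp
    have R2: "R\<^sup>2 = 1 - h\<^sup>2" using h21 by (simp add: R_def)
    define c where "c = R * C / h"
    define T where "T = S / C"
    have c0: "c > 0" and T0: "T > 0" using R0 CS0 h0 by (simp_all add: c_def T_def)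
    have eq: "h\<^sup>2 * (1 + c\<^sup>2 * (1 + T\<^sup>2)) = 1"
    proof -
      have "c\<^sup>2 * (1 + T\<^sup>2) = R\<^sup>2 * (C\<^sup>2 + S\<^sup>2) / h\<^sup>2"
        using CS0 h0 by (simp add: c_def T_def field_simps power2_eq_square)
      then show ?thesis using h0 by (simp add: CS R2 field_simps)
    qed
    have sub: "0 \<le> x \<and> x \<le> h \<and> 0 \<le> y \<and> y \<le> c * x \<and> - (T * y) \<le> z \<and> z \<le> T * y"
      if K: "x *\<^sub>R e1 + y *\<^sub>R e2 + z *\<^sub>R e3 \<in> ?K" for x y z
    proof -
      obtain s \<mu> \<nu> where k: "0 \<le> \<mu>" "0 \<le> \<nu>" "\<mu> + \<nu> \<le> s" "s \<le> 1"
        "x *\<^sub>R e1 + y *\<^sub>R e2 + z *\<^sub>R e3 = s *\<^sub>R p + \<mu> *\<^sub>R (a - p) + \<nu> *\<^sub>R (b - p)"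
        using convex_hull_zero_insert_3_subset[OF K] by metis
      define m where "m = \<mu> * norm u"
      define l where "l = \<nu> * norm v"
      have ml: "m \<ge> 0" "l \<ge> 0" using k by (simp_all add: m_def l_def)
      have "s *\<^sub>R p + \<mu> *\<^sub>R (a - p) + \<nu> *\<^sub>R (b - p) = (s * h) *\<^sub>R e1 + m *\<^sub>R u' + l *\<^sub>R v'"
      proof -
        have "(s * h) *\<^sub>R e1 = s *\<^sub>R p" using p0 by (simp add: e1_def h_def field_simps)
        moreover have "m *\<^sub>R u' = \<mu> *\<^sub>R u" "l *\<^sub>R v' = \<nu> *\<^sub>R v"
          using u0 v0 by (simp_all add: m_def l_def u'_def v'_def field_simps)
        ultimately show ?thesis by (simp add: u_def v_def)
      qed
      also have "\<dots> = (s * h) *\<^sub>R e1 + ((m + l) * C) *\<^sub>R e2 + ((m - l) * S) *\<^sub>R e3"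
        by (simp add: u'e v'e algebra_simps)
      finally have E: "x *\<^sub>R e1 + y *\<^sub>R e2 + z *\<^sub>R e3 = (s * h) *\<^sub>R e1 + ((m + l) * C) *\<^sub>R e2 + ((m - l) * S) *\<^sub>R e3"
        using k by simp
      have ee: "e1 \<bullet> e1 = 1" "e2 \<bullet> e2 = 1" "e3 \<bullet> e3 = 1" using on by (simp_all add: dot_square_norm)
      have x: "x = s * h"
        using arg_cong[OF E, of "\<lambda>w. w \<bullet> e1"] on ee by (simp add: inner_simps inner_commute)
      have y: "y = (m + l) * C"
        using arg_cong[OF E, of "\<lambda>w. w \<bullet> e2"] on ee by (simp add: inner_simps inner_commute)
      have z: "z = (m - l) * S"
        using arg_cong[OF E, of "\<lambda>w. w \<bullet> e3"] on ee by (simp add: inner_simps inner_commute)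
      have Ty: "T * y = (m + l) * S" using CS0 by (simp add: y T_def)
      have "m + l \<le> \<mu> * R + \<nu> * R" unfolding m_def l_def
        using k uR by (intro add_mono mult_left_mono) auto
      also have "\<dots> = (\<mu> + \<nu>) * R" by (simp add: algebra_simps)
      also have "\<dots> \<le> s * R" using k R0 by (intro mult_right_mono) auto
      finally have "m + l \<le> s * R" .
      then have "(m + l) * C \<le> s * R * C" using CS0 by (intro mult_right_mono) auto
      also have "s * R * C = c * x" using h0 by (simp add: c_def x)
      finally have "y \<le> c * x" using y by simp
      moreover have "0 \<le> s" using k by linarith
      then have "0 \<le> x" "x \<le> h" using k h0 by (simp_all add: x)
      moreover have "0 \<le> y" using ml CS0 by (simp add: y)
      moreover have "- (T * y) \<le> z" "z \<le> T * y"
        unfolding Ty z using mult_nonneg_nonneg[of m S] mult_nonneg_nonneg[of l S] ml CS0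
        by (simp_all add: algebra_simps)
      ultimately show ?thesis by blast
    qed
    have "emeasure hyp_measure ?K = (\<integral>\<^sup>+x. \<integral>\<^sup>+y. \<integral>\<^sup>+z. ennreal (1 / (1 - (x\<^sup>2 + y\<^sup>2 + z\<^sup>2))\<^sup>2) *
       indicator (hyp3 \<inter> ?K) (x *\<^sub>R e1 + y *\<^sub>R e2 + z *\<^sub>R e3) \<partial>lborel \<partial>lborel \<partial>lborel)"
      by (rule emeasure_hyp_measure_coords[OF on meas])
    also have "\<dots> \<le> (\<integral>\<^sup>+x. \<integral>\<^sup>+y. \<integral>\<^sup>+z. ennreal (1 / (1 - (x\<^sup>2 + y\<^sup>2 + z\<^sup>2))\<^sup>2) *
      (indicator {0..h} x * indicator {0..c * x} y * indicator {- (T * y)..T * y} z)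
        \<partial>lborel \<partial>lborel \<partial>lborel)"
      using sub by (intro nn_integral_mono mult_left_mono) (auto simp: indicator_def)
    also have "\<dots> \<le> ennreal (14 / 25)" by (rule wedge_integral_bound[OF h0 h1 c0 T0 eq])
    finally show ?thesis .
  qed
qed

section \<open>The volume of a polytope inscribed in the closed ball\<close>

lemma emeasure_hyp_flag:
  fixes p :: "real^3"
  assumes E: "E = closed_segment x y" and n: "E \<subseteq> cball 0 1" and p: "\<And>z. z \<in> E \<Longrightarrow> p \<bullet> z = p \<bullet> p"
  shows "emeasure hyp_measure (convex hull (insert 0 (insert p E))) \<le> ennreal (14 / 25)"
proof -
  have "convex hull (insert 0 (insert p E)) \<subseteq> convex hull {0, p, x, y}"
  proof (rule hull_minimal)
    have "E \<subseteq> convex hull {0, p, x, y}" unfolding E segment_convex_hull by (rule hull_mono) auto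
    then show "insert 0 (insert p E) \<subseteq> convex hull {0, p, x, y}" by (simp add: hull_inc)
  qed simp
  moreover have "convex hull {0, p, x, y} \<in> sets hyp_measure"
    by (simp add: borel_closed compact_imp_closed finite_imp_compact_convex_hull)
  ultimately have "emeasure hyp_measure (convex hull (insert 0 (insert p E))) \<le> emeasure hyp_measure (convex hull {0, p, x, y})"
    by (rule emeasure_mono)
  also have "\<dots> \<le> ennreal (14 / 25)"
    using n p by (intro emeasure_hyp_flag_simplex) (auto simp: E)
  finally show ?thesis .
qed

text \<open>Cone \<open>Q\<close> from the origin over its facets, and each facet over its edges from the foot of the
  perpendicular from the origin to its plane; neither apex needs to lie in the respective polytope.\<close>

lemma emeasure_hyp_polytope_le:
  fixes Q :: "(real^3) set"
  assumes Q: "polytope Q" "Q \<subseteq> cball 0 1" "aff_dim Q = 3"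
  shows "emeasure hyp_measure Q \<le> ennreal (14 / 25 * real (\<Sum>F\<in>{F. F facet_of Q}. card {E. E facet_of F}))"
proof -
  have pQ: "polyhedron Q" using Q(1) by (rule polytope_imp_polyhedron)
  have face: "polytope F" "aff_dim F = 2" "F \<subseteq> Q" "convex F" "F \<noteq> {}" if F: "F facet_of Q" for F
  proof -
    show "F \<subseteq> Q" using F by (rule facet_of_imp_subset)
    show "polytope F" using face_of_polytope_polytope[OF Q(1) facet_of_imp_face_of[OF F]] .
    then show "convex F" by (rule polytope_imp_convex)
    show "aff_dim F = 2" "F \<noteq> {}" using F Q(3) by (simp_all add: facet_of_def)
  qed
  have edge: "\<exists>x y. E = closed_segment x y" if "F facet_of Q" "E facet_of F" for E F
  proof -
    have "E edge_of F" using that face(2)[OF that(1)] by (simp add: facet_of_def edge_of_def)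
    then show ?thesis using edge_of_polytope_segment[OF face(1)[OF that(1)]] by metis
  qed
  have "\<exists>p. (\<forall>z\<in>F. p \<bullet> z = p \<bullet> p) \<and> p \<in> affine hull F" if F: "F facet_of Q" for F
  proof -
    obtain a b where ab: "a \<noteq> 0" "F = Q \<inter> {x. a \<bullet> x = b}"
      using facet_of_polyhedron[OF pQ F] by metis
    have "affine hull F = {x. a \<bullet> x = b}"
    proof (rule affine_dim_equal)
      show "affine hull F \<subseteq> {x. a \<bullet> x = b}"
        using ab by (intro hull_minimal affine_hyperplane) auto
      show "aff_dim (affine hull F) = aff_dim {x. a \<bullet> x = b}"
        using face(2)[OF F] ab(1) by (simp add: aff_dim_hyperplane)
    qed (use face(5)[OF F] in \<open>auto simp: affine_hyperplane\<close>)
    then show ?thesis using ab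
      by (intro exI[of _ "(b / (a \<bullet> a)) *\<^sub>R a"]) auto
  qed
  then obtain p where p: "\<And>F z. F facet_of Q \<Longrightarrow> z \<in> F \<Longrightarrow> p F \<bullet> z = p F \<bullet> p F"
      "\<And>F. F facet_of Q \<Longrightarrow> p F \<in> affine hull F" by metis
  define I where "I = (SIGMA F:{F. F facet_of Q}. {E. E facet_of F})"
  have finE: "finite {E. E facet_of F}" if "F facet_of Q" for F
    using face(1)[OF that] finite_polytope_facets by blast
  then have finI: "finite I" unfolding I_def using finite_polytope_facets[OF Q(1)] by auto
  define A where "A = (\<lambda>(F, E). convex hull (insert 0 (insert (p F) E)))"
  have "0 \<in> affine hull Q" using aff_dim_eq_full[of Q] Q(3) by simp
  then have cover: "Q \<subseteq> (\<Union>F\<in>{F. F facet_of Q}. convex hull (insert 0 F))"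
    using Q by (intro polytope_subset_cone_over_facets) auto
  have sub: "Q \<subseteq> (\<Union>i\<in>I. A i)"
  proof
    fix y assume "y \<in> Q"
    then obtain F where F: "F facet_of Q" "y \<in> convex hull (insert 0 F)" using cover by blast
    then obtain u v z where uv: "u \<ge> 0" "v \<ge> 0" "u + v = 1" "z \<in> F" "y = u *\<^sub>R 0 + v *\<^sub>R z"
      using convex_hull_insert[OF face(5)[OF F(1)], of 0] face(4)[OF F(1)] by (auto simp: hull_same)
    have "F \<subseteq> (\<Union>E\<in>{E. E facet_of F}. convex hull (insert (p F) E))"
      using face[OF F(1)] p(2)[OF F(1)] by (intro polytope_subset_cone_over_facets) auto
    then obtain E where E: "E facet_of F" "z \<in> convex hull (insert (p F) E)" using uv(4) by blast
    have "z \<in> A (F, E)" using E(2) hull_mono[of "insert (p F) E" "insert 0 (insert (p F) E)" convex]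
      by (auto simp: A_def)
    moreover have "0 \<in> A (F, E)" by (simp add: A_def hull_inc)
    moreover have "convex (A (F, E))" by (simp add: A_def)
    ultimately have "y \<in> A (F, E)" unfolding uv(5) using uv(1-3) by (intro convexD) auto
    then show "y \<in> (\<Union>i\<in>I. A i)" using F E by (auto simp: I_def)
  qed
  have Asets: "A i \<in> sets hyp_measure" if iI: "i \<in> I" for i
  proof -
    obtain F E where FE: "i = (F, E)" "F facet_of Q" "E facet_of F" using iI by (auto simp: I_def)
    obtain x y where xy: "E = closed_segment x y" using edge FE by blast
    have "compact (insert 0 (insert (p F) E))" unfolding xy by (intro compact_insert) simp
    then have "compact (A i)" by (simp add: FE A_def compact_convex_hull)
    then show ?thesis by (simp add: borel_closed compact_imp_closed)
  qed
  have Ale: "emeasure hyp_measure (A i) \<le> ennreal (14 / 25)" if iI: "i \<in> I" for i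
  proof -
    obtain F E where FE: "i = (F, E)" "F facet_of Q" "E facet_of F" using iI by (auto simp: I_def)
    obtain x y where xy: "E = closed_segment x y" using edge FE by blast
    have "E \<subseteq> F" using FE(3) by (rule facet_of_imp_subset)
    then show ?thesis unfolding FE A_def prod.case using face(3)[OF FE(2)] Q(2) p(1)[OF FE(2)]
      by (intro emeasure_hyp_flag[OF xy]) auto
  qed
  have "emeasure hyp_measure Q \<le> emeasure hyp_measure (\<Union>i\<in>I. A i)"
    using sub finI Asets by (intro emeasure_mono sets.finite_UN) auto
  also have "\<dots> \<le> (\<Sum>i\<in>I. emeasure hyp_measure (A i))"
    using finI Asets by (intro emeasure_subadditive_finite) auto
  also have "\<dots> \<le> (\<Sum>i\<in>I. ennreal (14 / 25))" by (intro sum_mono Ale)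
  also have "\<dots> = ennreal (14 / 25 * real (card I))"
    by (simp add: ennreal_of_nat_eq_real_of_nat ennreal_mult[symmetric] mult.commute)
  also have "card I = (\<Sum>F\<in>{F. F facet_of Q}. card {E. E facet_of F})"
    unfolding I_def using finE finite_polytope_facets[OF Q(1)] by (intro card_SigmaI) auto
  finally show ?thesis .
qed

lemma emeasure_hyp_polytope_finite:
  fixes Q :: "(real^3) set"
  assumes Q: "polytope Q" "Q \<subseteq> cball 0 1"
  shows "emeasure hyp_measure Q < \<infinity>"
proof (cases "aff_dim Q = 3")
  case True
  then show ?thesis using emeasure_hyp_polytope_le[OF Q] by (auto intro: le_less_trans)
next
  case False
  then have "interior Q = {}" using aff_dim_nonempty_interior[of Q] by auto
  then have "negligible Q" using negligible_convex_interior[of Q] Q(1) polytope_imp_convex by blast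
  then have "emeasure hyp_measure Q = 0"
    using Q(1) by (intro hyp_measure_null_of_negligible) (simp_all add: borel_closed polytope_imp_closed)
  then show ?thesis by simp
qed

text \<open>The cone over a neighbourhood of \<open>s\<close> meets the shell \<open>1 - \<epsilon> \<le> \<bar>x\<bar> < 1\<close> in a set of Lebesgue
  measure at least \<open>m \<epsilon>\<close>, on which the density is at least \<open>1 / (4 \<epsilon>\<^sup>2)\<close>.\<close>

lemma emeasure_hyp_near_sphere_infinite:
  assumes s: "norm s = 1" and d: "d > 0" and sub: "ball s d \<inter> hyp3 \<subseteq> S" and S: "S \<in> sets borel"
  shows "emeasure hyp_measure S = \<infinity>"
proof -
  \<comment> \<open>The open cone over the part of the sphere within d / 2 of \<open>s\<close>. The
    other half of \<open>d\<close> absorbs the distance, at most \<open>\<epsilon>\<close>, from a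
    point of the shell to its radial projection.\<close>
  define A where "A = {x::real^3. x \<noteq> 0 \<and> norm (x /\<^sub>R norm x - s) < d / 2}"
  have A_scale: "t *\<^sub>R x \<in> A \<longleftrightarrow> x \<in> A" if "t > 0" for t x
  proof -
    have "(t *\<^sub>R x) /\<^sub>R norm (t *\<^sub>R x) = (inverse t * t) *\<^sub>R (x /\<^sub>R norm x)" using that by simp
    then have e: "(t *\<^sub>R x) /\<^sub>R norm (t *\<^sub>R x) = x /\<^sub>R norm x" using that by simp
    show ?thesis unfolding A_def mem_Collect_eq e using that by simp
  qed
  have "open A"
  proof -
    have "open (- {0} \<inter> (\<lambda>x. norm (x /\<^sub>R norm x - s)) -` {..<d/2})"
      by (intro continuous_open_preimage continuous_intros open_Compl) auto
    moreover have "A = - {0} \<inter> (\<lambda>x. norm (x /\<^sub>R norm x - s)) -` {..<d/2}" by (auto simp: A_def)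
    ultimately show ?thesis by simp
  qed
  define C where "C = A \<inter> ball 0 1"
  have openC: "open C" using \<open>open A\<close> by (simp add: C_def open_Int)
  have "bounded C" by (rule bounded_subset[OF bounded_ball]) (auto simp: C_def)
  then have lC: "C \<in> lmeasurable" using openC by (rule lmeasurable_open)
  have "(1/2) *\<^sub>R s \<in> C" using s d A_scale[of "1/2" s] by (auto simp: C_def A_def)
  then have "\<not> negligible C" using openC open_not_negligible by blast
  define m where "m = measure lebesgue C"
  have m: "m > 0" using \<open>\<not> negligible C\<close> lC
    by (simp add: m_def negligible_iff_measure zero_less_measure_iff)
  have shell: "ennreal (m / (4 * \<epsilon>)) \<le> emeasure hyp_measure S" if \<epsilon>: "0 < \<epsilon>" "\<epsilon> < 1" "\<epsilon> \<le> d / 2" for \<epsilon>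
  proof -
    define D where "D = C - ball 0 (1 - \<epsilon>)"
    have "C \<inter> ball 0 (1 - \<epsilon>) = (\<lambda>x. (1 - \<epsilon>) *\<^sub>R x + 0) ` C"
    proof (intro set_eqI iffI)
      fix x assume x: "x \<in> C \<inter> ball 0 (1 - \<epsilon>)"
      have "x /\<^sub>R (1 - \<epsilon>) \<in> C" using x \<epsilon> A_scale[of "inverse (1 - \<epsilon>)" x]
        by (simp add: C_def field_simps)
      then show "x \<in> (\<lambda>x. (1 - \<epsilon>) *\<^sub>R x + 0) ` C" using \<epsilon> by (intro image_eqI[of _ _ "x /\<^sub>R (1 - \<epsilon>)"]) auto
    next
      fix x assume "x \<in> (\<lambda>x. (1 - \<epsilon>) *\<^sub>R x + 0) ` C"
      then obtain y where y: "y \<in> C" "x = (1 - \<epsilon>) *\<^sub>R y" by auto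
      have "(1 - \<epsilon>) * norm y < (1 - \<epsilon>) * 1" using y \<epsilon> by (intro mult_strict_left_mono) (auto simp: C_def)
      moreover have "(1 - \<epsilon>) * norm y \<le> 1 * norm y" using \<epsilon> by (intro mult_right_mono) auto
      then have "(1 - \<epsilon>) * norm y < 1" using y by (simp add: C_def)
      moreover have "x \<in> A" using y \<epsilon> A_scale[of "1 - \<epsilon>" y] by (simp add: C_def)
      ultimately show "x \<in> C \<inter> ball 0 (1 - \<epsilon>)" using y \<epsilon> by (simp add: C_def)
    qed
    then have inner: "measure lebesgue (C \<inter> ball 0 (1 - \<epsilon>)) = (1 - \<epsilon>) ^ 3 * m"
      using \<epsilon> measure_lebesgue_affine[of "1 - \<epsilon>" 0 C] by (simp add: m_def)
    have D: "D \<in> lmeasurable" "D \<in> sets borel"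
      using lC openC by (simp_all add: D_def fmeasurable.Diff)
    have "measure lebesgue D = m - measure lebesgue (C \<inter> ball 0 (1 - \<epsilon>))"
    proof -
      have "D = C - C \<inter> ball 0 (1 - \<epsilon>)" by (auto simp: D_def)
      moreover have "C \<inter> ball 0 (1 - \<epsilon>) \<in> sets lebesgue"
        using openC by (simp add: lebesgue_openin open_Int)
      ultimately show ?thesis unfolding m_def using lC by (simp only:) (rule measurable_measure_Diff, auto)
    qed
    moreover have "(1 - \<epsilon>) ^ 3 * m \<le> (1 - \<epsilon>) * m"
      using \<epsilon> m power_decreasing[of 1 3 "1 - \<epsilon>"] by (intro mult_right_mono) auto
    ultimately have Dm: "measure lebesgue D \<ge> m * \<epsilon>" unfolding inner by (simp add: algebra_simps)
    have DS: "D \<subseteq> hyp3 \<inter> S"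
    proof
      fix x assume x: "x \<in> D"
      then have nx: "1 - \<epsilon> \<le> norm x" "norm x < 1" "x \<in> A" by (auto simp: D_def C_def)
      have "x - x /\<^sub>R norm x = (norm x - 1) *\<^sub>R (x /\<^sub>R norm x)" using nx by (simp add: A_def algebra_simps)
      moreover have "norm (x /\<^sub>R norm x) = 1" using nx by (simp add: A_def)
      ultimately have "norm (x - x /\<^sub>R norm x) = 1 - norm x" using nx by (simp only: norm_scaleR) simp
      then have "norm (x - s) < d"
        using nx \<epsilon> norm_triangle_ineq[of "x - x /\<^sub>R norm x" "x /\<^sub>R norm x - s"] by (simp add: A_def)
      then have "x \<in> ball s d \<inter> hyp3" using nx by (simp add: hyp3_def dist_norm norm_minus_commute)
      then show "x \<in> hyp3 \<inter> S" using sub by auto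
    qed
    have dens: "1 / (4 * \<epsilon>\<^sup>2) \<le> 1 / (1 - (norm x)\<^sup>2)\<^sup>2" if "x \<in> D" for x
    proof -
      have nx: "1 - \<epsilon> \<le> norm x" "norm x < 1" using that by (auto simp: D_def C_def)
      then have "(norm x)\<^sup>2 < 1" by (simp add: abs_square_less_1)
      moreover have "(1 - \<epsilon>)\<^sup>2 \<le> (norm x)\<^sup>2" using nx \<epsilon> by (intro power_mono) auto
      then have "1 - (norm x)\<^sup>2 \<le> 2 * \<epsilon>" by (simp add: power2_diff) (smt (verit) zero_le_power2)
      ultimately have "(1 - (norm x)\<^sup>2)\<^sup>2 \<le> (2 * \<epsilon>)\<^sup>2" by (intro power_mono) auto
      then show ?thesis using \<open>(norm x)\<^sup>2 < 1\<close> \<epsilon> by (intro divide_left_mono) (auto simp: power_mult_distrib)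
    qed
    have "ennreal (m / (4 * \<epsilon>)) = ennreal (1 / (4 * \<epsilon>\<^sup>2) * (m * \<epsilon>))"
      using \<epsilon> by (simp add: power2_eq_square)
    also have "\<dots> \<le> ennreal (1 / (4 * \<epsilon>\<^sup>2) * measure lebesgue D)"
      using Dm \<epsilon> by (intro ennreal_leI mult_left_mono) auto
    also have "\<dots> = ennreal (1 / (4 * \<epsilon>\<^sup>2)) * ennreal (measure lebesgue D)" by (intro ennreal_mult) auto
    also have "ennreal (measure lebesgue D) = emeasure lebesgue D"
      using D(1) by (simp add: emeasure_eq_measure2)
    also have "\<dots> = emeasure lborel D" using D(2) by simp
    also have "ennreal (1 / (4 * \<epsilon>\<^sup>2)) * emeasure lborel D = (\<integral>\<^sup>+x. ennreal (1 / (4 * \<epsilon>\<^sup>2)) * indicator D x \<partial>lborel)"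
      using D(2) by (simp add: nn_integral_cmult_indicator)
    also have "\<dots> \<le> (\<integral>\<^sup>+x. ennreal (1 / (1 - (norm x)\<^sup>2)\<^sup>2) * indicator (hyp3 \<inter> S) x \<partial>lborel)"
      using dens DS by (intro nn_integral_mono) (auto simp: indicator_def intro!: ennreal_leI)
    also have "\<dots> = emeasure hyp_measure S" by (rule emeasure_hyp_measure[OF S, symmetric])
    finally show ?thesis .
  qed
  show ?thesis
  proof (rule ccontr)
    assume "\<not> ?thesis"
    then obtain r where r: "emeasure hyp_measure S = ennreal r" "r \<ge> 0"
      by (cases "emeasure hyp_measure S") auto
    define \<epsilon> where "\<epsilon> = min (min (1/2) (d/2)) (m / (4 * (r + 1)))"
    have "\<epsilon> \<le> 1/2" and \<epsilon>34: "\<epsilon> \<le> d / 2" "\<epsilon> \<le> m / (4 * (r + 1))"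
      unfolding \<epsilon>_def by linarith+
    then have \<epsilon>: "0 < \<epsilon>" "\<epsilon> < 1" "\<epsilon> \<le> d / 2"
      using d m r by (auto simp: \<epsilon>_def)
    have "r + 1 \<le> m / (4 * \<epsilon>)" using \<epsilon> \<epsilon>34(2) r by (simp add: field_simps)
    moreover have "m / (4 * \<epsilon>) \<le> r" using shell[OF \<epsilon>(1-3)] r m \<epsilon> by simp
    ultimately show False by simp
  qed
qed

text \<open>A segment from \<open>q\<close> to a point \<open>y\<close> of \<open>Q\<close> beyond
  the sphere crosses the sphere at some \<open>s\<close>. The homothety with centre \<open>y\<close>
  that takes \<open>q\<close> to \<open>s\<close> shrinks the ball around \<open>q\<close> to a ball
  around \<open>s\<close>, still inside \<open>Q\<close> by convexity, and this forces infinite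
  volume.\<close>

lemma finite_hyp_measure_imp_subset_cball:
  assumes "convex Q" "closed Q" and q: "r > 0" "ball q r \<subseteq> Q" "q \<in> hyp3"
    and fin: "emeasure hyp_measure (Q \<inter> hyp3) < \<infinity>"
  shows "Q \<subseteq> cball 0 1"
proof (rule ccontr)
  assume "\<not> ?thesis"
  then have "\<exists>y\<in>Q. norm y > 1" by (auto simp: subset_eq not_le)
  then obtain y where y: "y \<in> Q" "norm y > 1" by blast
  have "connected (closed_segment q y)" by simp
  moreover have "closed_segment q y \<inter> ball 0 1 \<noteq> {}" using q(3) by (auto simp: hyp3_def)
  moreover have "closed_segment q y - ball 0 1 \<noteq> {}" using y(2) by (auto intro!: exI[of _ y])
  ultimately have "closed_segment q y \<inter> frontier (ball 0 1) \<noteq> {}" by (rule connected_Int_frontier)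
  then obtain s where s: "s \<in> closed_segment q y" "norm s = 1" by (auto simp: frontier_ball)
  then obtain t where t: "0 \<le> t" "t \<le> 1" "s = (1 - t) *\<^sub>R q + t *\<^sub>R y" by (auto simp: closed_segment_def)
  have "t \<noteq> 1" using t s(2) y(2) by auto
  then have t1: "t < 1" using t by simp
  have "ball s ((1 - t) * r) \<subseteq> Q"
  proof
    fix x assume x: "x \<in> ball s ((1 - t) * r)"
    define v where "v = q + (x - s) /\<^sub>R (1 - t)"
    have "norm (x - s) < (1 - t) * r" using x by (simp add: dist_norm norm_minus_commute)
    then have "norm (x - s) / (1 - t) < r" using t1 by (simp add: pos_divide_less_eq mult.commute)
    then have "norm ((x - s) /\<^sub>R (1 - t)) < r" using t1 by (simp add: divide_inverse mult.commute)
    then have "v \<in> ball q r" by (simp add: v_def dist_norm)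
    then have "v \<in> Q" using q by blast
    then have "(1 - t) *\<^sub>R v + t *\<^sub>R y \<in> Q" using y t assms(1) by (intro convexD) auto
    also have "(1 - t) *\<^sub>R v + t *\<^sub>R y = x" using t1 t(3) by (simp add: v_def scaleR_add_right)
    finally show "x \<in> Q" .
  qed
  then have "ball s ((1 - t) * r) \<inter> hyp3 \<subseteq> Q \<inter> hyp3" by auto
  moreover have "Q \<inter> hyp3 \<in> sets borel" using assms(2) by (simp add: hyp3_def)
  ultimately have "emeasure hyp_measure (Q \<inter> hyp3) = \<infinity>"
    using t1 q s by (intro emeasure_hyp_near_sphere_infinite[of s "(1 - t) * r"]) auto
  then show False using fin by simp
qed

section \<open>Lower bounds for the regular ideal octahedron and tetrahedron\<close>

text \<open>The function \<open>r \<mapsto> 1 / (1 - z\<^sup>2 - r)\<^sup>2\<close> is convex; the tangent at the mean value of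
  \<open>r = u\<^sup>2 + w\<^sup>2\<close> over the rectangle gives the bound.\<close>

lemma rectangle_slice_integral_bound:
  fixes z \<sigma> \<sigma>' :: real and g :: "real \<Rightarrow> real \<Rightarrow> ennreal"
  assumes \<sigma>: "0 \<le> \<sigma>" "0 \<le> \<sigma>'" and ball: "z\<^sup>2 + \<sigma>\<^sup>2 + \<sigma>'\<^sup>2 \<le> 1"
    and d: "1 - z\<^sup>2 - (\<sigma>\<^sup>2 + \<sigma>'\<^sup>2) / 3 > 0"
    and g: "\<And>u w. - \<sigma> < u \<Longrightarrow> u < \<sigma> \<Longrightarrow> - \<sigma>' < w \<Longrightarrow> w < \<sigma>' \<Longrightarrow>
      ennreal (1 / (1 - (z\<^sup>2 + u\<^sup>2 + w\<^sup>2))\<^sup>2) \<le> g u w"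
  shows "ennreal (4 * \<sigma> * \<sigma>' / (1 - z\<^sup>2 - (\<sigma>\<^sup>2 + \<sigma>'\<^sup>2) / 3)\<^sup>2) \<le> (\<integral>\<^sup>+u. \<integral>\<^sup>+w. g u w \<partial>lborel \<partial>lborel)"
proof -
  define m where "m = (\<sigma>\<^sup>2 + \<sigma>'\<^sup>2) / 3"
  define d' where "d' = 1 - z\<^sup>2 - m"
  have d0: "d' > 0" using d by (simp add: d'_def m_def)
  have dm: "d' \<ge> 2 * m" using ball by (simp add: d'_def m_def field_simps)
  \<comment> \<open>\<open>A + B * r\<close> is the tangent of the density at \<open>r = m\<close>,
    the mean of u^2 + w^2 over the rectangle, so its integral is the area times A + B m = 1 / d'^2.
    The assumption \<open>ball\<close> makes \<open>A\<close> non-negative.\<close>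
  define A where "A = (d' - 2 * m) / d' ^ 3"
  define B where "B = 2 / d' ^ 3"
  have AB: "A \<ge> 0" "B > 0" using d0 dm by (simp_all add: A_def B_def)
  have tangent: "A + B * r \<le> 1 / (1 - (z\<^sup>2 + r))\<^sup>2" if "r < 1 - z\<^sup>2" for r
  proof -
    define y where "y = 1 - (z\<^sup>2 + r)"
    have y: "y > 0" using that by (simp add: y_def)
    have r: "r = d' + m - y" by (simp add: y_def d'_def)
    have "A + B * r = (3 * d' - 2 * y) / d' ^ 3"
      by (simp add: A_def B_def r add_divide_distrib[symmetric])
    also have "\<dots> \<le> 1 / y\<^sup>2"
    proof -
      \<comment> \<open>The tangent inequality with denominators cleared: d'^3 - 3 d' y^2 + 2 y^3
        factors this way, with a double zero at the point of contact.\<close>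
      have "0 \<le> (d' - y)\<^sup>2 * (d' + 2 * y)" using y d0 by simp
      then have "(3 * d' - 2 * y) * y\<^sup>2 \<le> d' ^ 3"
        by (simp add: power2_eq_square power3_eq_cube algebra_simps)
      then show ?thesis using y d0 by (simp add: field_simps)
    qed
    finally show ?thesis by (simp add: y_def)
  qed
  let ?G = "\<lambda>u. (A + B * (u\<^sup>2 + \<sigma>'\<^sup>2 / 3)) * (2 * \<sigma>')"
  have inner: "ennreal (?G u) \<le> (\<integral>\<^sup>+w. g u w \<partial>lborel)" if u: "- \<sigma> < u" "u < \<sigma>" for u
  proof -
    let ?F = "\<lambda>w. (A + B * u\<^sup>2) * w + B * w ^ 3 / 3"
    have "ennreal (?F \<sigma>' - ?F (- \<sigma>')) \<le> (\<integral>\<^sup>+w. g u w \<partial>lborel)"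
    proof (rule nn_integral_ge_FTC[where S = "{}" and F = ?F and F' = "\<lambda>w. A + B * (u\<^sup>2 + w\<^sup>2)" and a = "- \<sigma>'" and b = \<sigma>'])
      show "continuous_on {- \<sigma>'..\<sigma>'} ?F" by (intro continuous_intros) auto
      fix w assume w: "- \<sigma>' < w" "w < \<sigma>'"
      show "(?F has_real_derivative A + B * (u\<^sup>2 + w\<^sup>2)) (at w)"
        by (auto intro!: derivative_eq_intros simp: algebra_simps)
      show "0 \<le> A + B * (u\<^sup>2 + w\<^sup>2)" using AB by simp
      have "u\<^sup>2 < \<sigma>\<^sup>2" "w\<^sup>2 < \<sigma>'\<^sup>2"
        using u w power_strict_mono[of "\<bar>u\<bar>" \<sigma> 2] power_strict_mono[of "\<bar>w\<bar>" \<sigma>' 2] by auto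
      then have "u\<^sup>2 + w\<^sup>2 < 1 - z\<^sup>2" using ball by linarith
      from tangent[OF this] g[OF u w]
      show "ennreal (A + B * (u\<^sup>2 + w\<^sup>2)) \<le> g u w"
        by (metis add.assoc ennreal_leI order_trans)
    qed (use \<sigma> in auto)
    also have "?F \<sigma>' - ?F (- \<sigma>') = ?G u" by (simp add: algebra_simps power2_eq_square power3_eq_cube)
    finally show ?thesis .
  qed
  let ?H = "\<lambda>u. ((A + B * \<sigma>'\<^sup>2 / 3) * u + B * u ^ 3 / 3) * (2 * \<sigma>')"
  have "ennreal (?H \<sigma> - ?H (- \<sigma>)) \<le> (\<integral>\<^sup>+u. \<integral>\<^sup>+w. g u w \<partial>lborel \<partial>lborel)"
  proof (rule nn_integral_ge_FTC[where S = "{}" and F = ?H and F' = ?G and a = "- \<sigma>" and b = \<sigma>])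
    show "continuous_on {- \<sigma>..\<sigma>} ?H" by (intro continuous_intros) auto
    fix u assume u: "- \<sigma> < u" "u < \<sigma>"
    show "(?H has_real_derivative ?G u) (at u)"
      by (auto intro!: derivative_eq_intros simp: algebra_simps)
    show "0 \<le> ?G u" using AB \<sigma> by simp
    show "ennreal (?G u) \<le> (\<integral>\<^sup>+w. g u w \<partial>lborel)" by (rule inner[OF u])
  qed (use \<sigma> in auto)
  also have "?H \<sigma> - ?H (- \<sigma>) = 4 * \<sigma> * \<sigma>' * (A + B * m)"
    by (simp add: m_def algebra_simps power2_eq_square power3_eq_cube)
  also have "A + B * m = 1 / d'\<^sup>2"
    using d0 by (simp add: A_def B_def field_simps power2_eq_square power3_eq_cube)
  finally show ?thesis by (simp add: d'_def m_def)
qed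

lemma convex_combination_3_with_zero:
  assumes "convex C" "0 \<in> C" "a \<in> C" "b \<in> C" "c \<in> C"
    and "0 \<le> r" "0 \<le> s" "0 \<le> t" "r + s + t \<le> 1"
  shows "r *\<^sub>R a + s *\<^sub>R b + t *\<^sub>R c \<in> C"
proof -
  have "(\<Sum>i\<in>{0,1,2,3::nat}. [r, s, t, 1 - r - s - t] ! i *\<^sub>R [a, b, c, 0] ! i) \<in> C"
    by (rule convex_sum) (use assms in auto)
  then show ?thesis by (simp add: add.assoc)
qed

context
  fixes e2 e3 :: "real^3"
  defines "e2 \<equiv> (1 / sqrt 2) *\<^sub>R (axis 2 1 + axis 3 1)" and "e3 \<equiv> (1 / sqrt 2) *\<^sub>R (axis 2 1 - axis 3 1)"
begin

lemma diagonal_frame: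
  "norm (axis 1 1 :: real^3) = 1" "norm e2 = 1" "norm e3 = 1"
  "axis 1 1 \<bullet> e2 = 0" "axis 1 1 \<bullet> e3 = 0" "e2 \<bullet> e3 = 0"
  by (simp_all add: e2_def e3_def norm_eq_sqrt_inner inner_simps inner_axis_axis)

lemma diagonal_frame_coords:
  "(x *\<^sub>R axis 1 1 + u *\<^sub>R e2 + w *\<^sub>R e3) = vector [x, (u + w) / sqrt 2, (u - w) / sqrt 2]"
  by (simp add: e2_def e3_def vec_eq_iff forall_3 axis_def field_simps)

text \<open>In the chosen positions, the slices of octahedron and tetrahedron orthogonal to the
  first axis are rectangles with sides along the diagonals of the other two coordinates, which is
  why the frame is turned by 45 degrees. \<open>\<sigma>\<close> and \<open>\<sigma>'\<close> are
  the half side lengths.\<close>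

lemma emeasure_hyp_ge_diagonal_slices:
  fixes \<sigma> \<sigma>' :: "real \<Rightarrow> real"
  assumes S: "S \<in> sets borel"
    and sub: "\<And>z u w. - l < z \<Longrightarrow> z < l \<Longrightarrow> - \<sigma> z < u \<Longrightarrow> u < \<sigma> z \<Longrightarrow> - \<sigma>' z < w \<Longrightarrow> w < \<sigma>' z \<Longrightarrow>
      (vector [z, (u + w) / sqrt 2, (u - w) / sqrt 2] :: real^3) \<in> S"
    and \<sigma>: "\<And>z. - l < z \<Longrightarrow> z < l \<Longrightarrow> 0 \<le> \<sigma> z \<and> 0 \<le> \<sigma>' z \<and> z\<^sup>2 + (\<sigma> z)\<^sup>2 + (\<sigma>' z)\<^sup>2 \<le> 1
        \<and> 1 - z\<^sup>2 - ((\<sigma> z)\<^sup>2 + (\<sigma>' z)\<^sup>2) / 3 > 0"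
    and F: "finite X" "0 \<le> l" "continuous_on {-l..l} F"
       "\<And>z. - l < z \<Longrightarrow> z < l \<Longrightarrow> z \<notin> X \<Longrightarrow> (F has_real_derivative F' z) (at z)"
       "\<And>z. - l < z \<Longrightarrow> z < l \<Longrightarrow> 0 \<le> F' z"
       "\<And>z. - l < z \<Longrightarrow> z < l \<Longrightarrow> F' z \<le> 4 * \<sigma> z * \<sigma>' z / (1 - z\<^sup>2 - ((\<sigma> z)\<^sup>2 + (\<sigma>' z)\<^sup>2) / 3)\<^sup>2"
  shows "ennreal (F l - F (- l)) \<le> emeasure hyp_measure (S \<inter> hyp3)"
proof -
  have "S \<inter> hyp3 \<in> sets borel" using S by (simp add: hyp3_def)
  note coords = emeasure_hyp_measure_coords[OF diagonal_frame this]
  show ?thesis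
    unfolding coords
  proof (rule nn_integral_ge_FTC[where S = X and F = F and F' = F' and a = "- l" and b = l])
    fix z assume z: "- l < z" "z < l"
    have "ennreal (F' z) \<le> ennreal (4 * \<sigma> z * \<sigma>' z / (1 - z\<^sup>2 - ((\<sigma> z)\<^sup>2 + (\<sigma>' z)\<^sup>2) / 3)\<^sup>2)"
      using F(6) z by (intro ennreal_leI)
    also have "\<dots> \<le> (\<integral>\<^sup>+u. \<integral>\<^sup>+w. ennreal (1 / (1 - (z\<^sup>2 + u\<^sup>2 + w\<^sup>2))\<^sup>2) *
                    indicator (hyp3 \<inter> (S \<inter> hyp3)) (z *\<^sub>R axis 1 1 + u *\<^sub>R e2 + w *\<^sub>R e3) \<partial>lborel \<partial>lborel)"
    proof (rule rectangle_slice_integral_bound)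
      fix u w assume u: "- \<sigma> z < u" "u < \<sigma> z" and w: "- \<sigma>' z < w" "w < \<sigma>' z"
      have "\<bar>u\<bar> < \<sigma> z" "\<bar>w\<bar> < \<sigma>' z" using u w by auto
      then have "\<bar>u\<bar>\<^sup>2 < (\<sigma> z)\<^sup>2" "\<bar>w\<bar>\<^sup>2 < (\<sigma>' z)\<^sup>2" by (intro power_strict_mono; simp)+
      then have "z\<^sup>2 + u\<^sup>2 + w\<^sup>2 < 1" using \<sigma>[OF z] by simp
      then have "(norm (z *\<^sub>R axis 1 1 + u *\<^sub>R e2 + w *\<^sub>R e3))\<^sup>2 < 1"
        by (simp add: norm_orthonormal_combination[OF diagonal_frame])
      then have "z *\<^sub>R axis 1 1 + u *\<^sub>R e2 + w *\<^sub>R e3 \<in> hyp3"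
        by (simp add: hyp3_def abs_square_less_1)
      moreover have "z *\<^sub>R axis 1 1 + u *\<^sub>R e2 + w *\<^sub>R e3 \<in> S"
        unfolding diagonal_frame_coords by (rule sub[OF z u w])
      ultimately show "ennreal (1 / (1 - (z\<^sup>2 + u\<^sup>2 + w\<^sup>2))\<^sup>2) \<le> ennreal (1 / (1 - (z\<^sup>2 + u\<^sup>2 + w\<^sup>2))\<^sup>2) *
                    indicator (hyp3 \<inter> (S \<inter> hyp3)) (z *\<^sub>R axis 1 1 + u *\<^sub>R e2 + w *\<^sub>R e3)" by simp
    qed (use \<sigma>[OF z] in auto)
    finally show "ennreal (F' z) \<le> (\<integral>\<^sup>+u. \<integral>\<^sup>+w. ennreal (1 / (1 - (z\<^sup>2 + u\<^sup>2 + w\<^sup>2))\<^sup>2) *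
                    indicator (hyp3 \<inter> (S \<inter> hyp3)) (z *\<^sub>R axis 1 1 + u *\<^sub>R e2 + w *\<^sub>R e3) \<partial>lborel \<partial>lborel)" .
  qed (use F in auto)
qed

end

text \<open>The slices are squares of half side (1 - |z|) / sqrt 2. The factor (1 - |z|)^2 of their
  area cancels against the density, and the remaining 18 / (2 + 4 |z|)^2 integrates to exactly 3
  over [-1, 1].\<close>

lemma octahedron_emeasure_ge:
  "ennreal 3 \<le> emeasure hyp_measure (convex hull (Basis \<union> uminus ` Basis) \<inter> hyp3)"
proof -
  let ?K = "convex hull (Basis \<union> uminus ` Basis) :: (real^3) set"
  have "compact ?K" by (simp add: finite_imp_compact_convex_hull)
  then have S: "?K \<in> sets borel" by (intro borel_closed compact_imp_closed)
  have mem: "v \<in> ?K" if "\<bar>v$1\<bar> + \<bar>v$2\<bar> + \<bar>v$3\<bar> \<le> 1" for v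
  proof -
    have ax: "sgn x *\<^sub>R axis i 1 \<in> ?K" if "x \<noteq> 0" for x i
      using that by (cases "x > 0") (auto intro!: hull_inc simp: axis_in_Basis_iff sgn_if)
    have "(1/2) *\<^sub>R (axis 1 1 :: real^3) + (1/2) *\<^sub>R (- axis 1 1) \<in> ?K"
      by (intro convexD convex_convex_hull hull_inc) (auto simp: axis_in_Basis_iff)
    then have 0: "0 \<in> ?K" by simp
    then have ax': "sgn x *\<^sub>R axis i 1 \<in> ?K" for x i
      using ax[of x i] by (cases "x = 0") auto
    have "\<bar>v$1\<bar> *\<^sub>R (sgn (v$1) *\<^sub>R axis 1 1) + \<bar>v$2\<bar> *\<^sub>R (sgn (v$2) *\<^sub>R axis 2 1) + \<bar>v$3\<bar> *\<^sub>R (sgn (v$3) *\<^sub>R axis 3 1) \<in> ?K"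
      by (intro convex_combination_3_with_zero ax' 0 convex_convex_hull that) auto
    also have "\<bar>v$1\<bar> *\<^sub>R (sgn (v$1) *\<^sub>R axis 1 1) + \<bar>v$2\<bar> *\<^sub>R (sgn (v$2) *\<^sub>R axis 2 1) + \<bar>v$3\<bar> *\<^sub>R (sgn (v$3) *\<^sub>R axis 3 1) = v"
      by (simp add: vec_eq_iff forall_3 axis_def abs_mult_sgn)
    finally show ?thesis .
  qed
  define \<sigma> where "\<sigma> z = (1 - \<bar>z\<bar>) / sqrt 2" for z :: real
  let ?F = "\<lambda>z::real. 9 * z / (2 + 4 * \<bar>z\<bar>)"
  let ?F' = "\<lambda>z::real. 18 / (2 + 4 * \<bar>z\<bar>)\<^sup>2"
  have \<sigma>2: "(\<sigma> z)\<^sup>2 = (1 - \<bar>z\<bar>)\<^sup>2 / 2" for z by (simp add: \<sigma>_def power_divide)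
  have d: "1 - z\<^sup>2 - ((\<sigma> z)\<^sup>2 + (\<sigma> z)\<^sup>2) / 3 = (1 - \<bar>z\<bar>) * (2 + 4 * \<bar>z\<bar>) / 3" for z
  proof -
    have "1 - a\<^sup>2 - ((1 - a)\<^sup>2 / 2 + (1 - a)\<^sup>2 / 2) / 3 = (1 - a) * (2 + 4 * a) / 3" for a :: real
      by (simp add: power2_eq_square field_simps)
    from this[of "\<bar>z\<bar>"] show ?thesis by (simp add: \<sigma>2)
  qed
  have "ennreal (?F 1 - ?F (- 1)) \<le> emeasure hyp_measure (?K \<inter> hyp3)"
  proof (rule emeasure_hyp_ge_diagonal_slices[OF S, where \<sigma> = \<sigma> and \<sigma>' = \<sigma> and X = "{0}" and F' = ?F'])
    have "2 + 4 * \<bar>z\<bar> > 0" for z :: real by (intro add_pos_nonneg) auto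
    then have "2 + 4 * \<bar>z\<bar> \<noteq> 0" for z :: real by (metis less_irrefl)
    then show "continuous_on {-1..1} ?F" by (intro continuous_intros) blast
    fix z :: real assume z: "-1 < z" "z < 1"
    have s0: "\<sigma> z > 0" using z by (simp add: \<sigma>_def)
    have "\<bar>z\<bar>\<^sup>2 + (1 - \<bar>z\<bar>)\<^sup>2 \<le> 1"
    proof -
      have "0 \<le> 2 * (\<bar>z\<bar> * (1 - \<bar>z\<bar>))" using z by simp
      also have "\<dots> = 1 - (\<bar>z\<bar>\<^sup>2 + (1 - \<bar>z\<bar>)\<^sup>2)" by (simp only: power2_eq_square) algebra
      finally show ?thesis by simp
    qed
    then have b: "z\<^sup>2 + (\<sigma> z)\<^sup>2 + (\<sigma> z)\<^sup>2 \<le> 1" by (simp add: \<sigma>2)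
    show "0 \<le> \<sigma> z \<and> 0 \<le> \<sigma> z \<and> z\<^sup>2 + (\<sigma> z)\<^sup>2 + (\<sigma> z)\<^sup>2 \<le> 1 \<and> 1 - z\<^sup>2 - ((\<sigma> z)\<^sup>2 + (\<sigma> z)\<^sup>2) / 3 > 0"
    proof -
      have "(1 - \<bar>z\<bar>) * (2 + 4 * \<bar>z\<bar>) / 3 > 0"
        using z by (intro divide_pos_pos mult_pos_pos add_pos_nonneg) auto
      then show ?thesis using s0 b unfolding d[symmetric] by simp
    qed
    show "0 \<le> ?F' z" by simp
    have 4: "4 * \<sigma> z * \<sigma> z = 2 * (1 - \<bar>z\<bar>)\<^sup>2" using \<sigma>2[of z] by (simp add: power2_eq_square)
    have "2 * x\<^sup>2 / (x * y / 3)\<^sup>2 = 18 / y\<^sup>2" if "x > 0" for x y :: real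
      using that by (simp add: power_mult_distrib power_divide)
    from this[of "1 - \<bar>z\<bar>" "2 + 4 * \<bar>z\<bar>"] z
    show "?F' z \<le> 4 * \<sigma> z * \<sigma> z / (1 - z\<^sup>2 - ((\<sigma> z)\<^sup>2 + (\<sigma> z)\<^sup>2) / 3)\<^sup>2"
      unfolding d 4 by simp
    show "(?F has_real_derivative ?F' z) (at z)" if "z \<notin> {0}"
    proof (cases "z > 0")
      case True
      have "((\<lambda>z. 9 * z / (2 + 4 * z)) has_real_derivative 18 / (2 + 4 * z)\<^sup>2) (at z)"
        using True by (auto intro!: derivative_eq_intros simp: divide_simps power2_eq_square algebra_simps)
      then have "(?F has_real_derivative 18 / (2 + 4 * z)\<^sup>2) (at z)"
        by (rule has_field_derivative_transform_within_open[where S = "{0<..}"]) (use True in auto)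
      then show ?thesis using True by simp
    next
      case False
      then have z0: "z < 0" using that by simp
      have "((\<lambda>z. 9 * z / (2 - 4 * z)) has_real_derivative 18 / (2 - 4 * z)\<^sup>2) (at z)"
        using z0 by (auto intro!: derivative_eq_intros simp: divide_simps power2_eq_square algebra_simps)
      then have "(?F has_real_derivative 18 / (2 - 4 * z)\<^sup>2) (at z)"
        by (rule has_field_derivative_transform_within_open[where S = "{..<0}"]) (use z0 in auto)
      then show ?thesis using z0 by simp
    qed
    fix u w assume u: "- \<sigma> z < u" "u < \<sigma> z" and w: "- \<sigma> z < w" "w < \<sigma> z"
    have q: "sqrt 2 * \<sigma> z = 1 - \<bar>z\<bar>" by (simp add: \<sigma>_def)
    have "\<bar>(u + w) / sqrt 2\<bar> + \<bar>(u - w) / sqrt 2\<bar> = (\<bar>u + w\<bar> + \<bar>u - w\<bar>) / sqrt 2"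
      by (simp only: abs_divide add_divide_distrib[symmetric]) simp
    also have "\<dots> \<le> (2 * \<sigma> z) / sqrt 2" using u w by (intro divide_right_mono) auto
    also have "\<dots> = sqrt 2 * \<sigma> z" by (simp add: real_div_sqrt field_simps)
    finally have *: "\<bar>(u + w) / sqrt 2\<bar> + \<bar>(u - w) / sqrt 2\<bar> \<le> 1 - \<bar>z\<bar>" using q by simp
    show "(vector [z, (u + w) / sqrt 2, (u - w) / sqrt 2] :: real^3) \<in> ?K"
      by (rule mem) (use * in simp)
  qed simp_all
  then show ?thesis by simp
qed

text \<open>Two opposite edges lie in the planes z = s and z = - s with s = 1 / sqrt 3. The
  rectangular slices interpolate between them: one half side grows with \<open>z\<close> while the
  other shrinks, and each vanishes at one end.\<close>

lemma tetrahedron_emeasure_ge: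
  "ennreal (209 / 250) \<le> emeasure hyp_measure (convex hull ((\<lambda>p. p /\<^sub>R sqrt 3) `
          {vector [1, 1, 1], vector [1, -1, -1], vector [-1, 1, -1], vector [-1, -1, 1]}) \<inter> hyp3)"
proof -
  let ?K = "convex hull ((\<lambda>p. p /\<^sub>R sqrt 3) `
          {vector [1, 1, 1], vector [1, -1, -1], vector [-1, 1, -1], vector [-1, -1, 1]}) :: (real^3) set"
  have "compact ?K" by (simp add: finite_imp_compact_convex_hull)
  then have S: "?K \<in> sets borel" by (intro borel_closed compact_imp_closed)
  define s where "s = 1 / sqrt 3"
  have s0: "s > 0" and s2: "s\<^sup>2 = 1/3" by (simp_all add: s_def power_divide)
  have K: "?K = convex hull {vector [s, s, s], vector [s, -s, -s], vector [-s, s, -s], vector [-s, -s, s]}"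
  proof -
    have "(vector [x, y, z] :: real^3) /\<^sub>R sqrt 3 = vector [x * s, y * s, z * s]" for x y z
      by (simp add: vec_eq_iff forall_3 s_def divide_inverse mult.commute)
    then show ?thesis by simp
  qed
  define \<sigma> where "\<sigma> z = (s + z) / sqrt 2" for z :: real
  define \<sigma>' where "\<sigma>' z = (s - z) / sqrt 2" for z :: real
  let ?F = "\<lambda>z::real. 81 / 32 * (z / 3 - 3 / 20 * z ^ 5 - 9 / 28 * z ^ 7 - 3 / 2 * z ^ 9)"
  let ?F' = "\<lambda>z::real. 81 / 32 * (1 / 3 - 3 / 4 * z ^ 4 - 9 / 4 * z ^ 6 - 27 / 2 * z ^ 8)"
  have \<sigma>2: "(\<sigma> z)\<^sup>2 + (\<sigma>' z)\<^sup>2 = 1/3 + z\<^sup>2" for z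
    using s2 by (simp add: \<sigma>_def \<sigma>'_def power_divide) (simp add: power2_eq_square field_simps)
  have \<sigma>\<sigma>: "4 * \<sigma> z * \<sigma>' z = 2 * (1/3 - z\<^sup>2)" for z
  proof -
    have "\<sigma> z * \<sigma>' z = (s + z) * (s - z) / 2"
      unfolding \<sigma>_def \<sigma>'_def times_divide_times_eq by simp
    moreover have "(s + z) * (s - z) = 1/3 - z\<^sup>2"
      using s2 by (simp add: power2_eq_square algebra_simps)
    ultimately show ?thesis by simp
  qed
  have "ennreal (?F s - ?F (- s)) \<le> emeasure hyp_measure (?K \<inter> hyp3)"
  proof (rule emeasure_hyp_ge_diagonal_slices[OF S, where \<sigma> = \<sigma> and \<sigma>' = \<sigma>' and X = "{}" and F' = ?F'])
    show "continuous_on {-s..s} ?F" by (intro continuous_intros) auto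
    fix z :: real assume z: "-s < z" "z < s"
    then have "\<bar>z\<bar> < s" by auto
    then have z2: "z\<^sup>2 < 1/3" using power_strict_mono[of "\<bar>z\<bar>" s 2] s2 by simp
    have pos: "\<sigma> z > 0" "\<sigma>' z > 0" using z by (simp_all add: \<sigma>_def \<sigma>'_def)
    have b: "z\<^sup>2 + (\<sigma> z)\<^sup>2 + (\<sigma>' z)\<^sup>2 \<le> 1" using z2 by (simp add: add.assoc \<sigma>2)
    show "0 \<le> \<sigma> z \<and> 0 \<le> \<sigma>' z \<and> z\<^sup>2 + (\<sigma> z)\<^sup>2 + (\<sigma>' z)\<^sup>2 \<le> 1 \<and> 1 - z\<^sup>2 - ((\<sigma> z)\<^sup>2 + (\<sigma>' z)\<^sup>2) / 3 > 0"
      using pos b z2 by (simp add: \<sigma>2)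
    define y where "y = z\<^sup>2"
    have y: "0 \<le> y" "y < 1/3" using z2 by (simp_all add: y_def)
    have pw: "z ^ 4 = y\<^sup>2" "z ^ 6 = y ^ 3" "z ^ 8 = y ^ 4" by (simp_all add: y_def flip: power_mult)
    have F'y: "?F' z = 81 / 32 * ((1/3 - y) * (1 + 3 * y + 27 / 4 * y\<^sup>2 + 27 / 2 * y ^ 3))"
      unfolding pw by (simp add: field_simps power2_eq_square power3_eq_cube power4_eq_xxxx)
    show "0 \<le> ?F' z" unfolding F'y using y by simp
    show "?F' z \<le> 4 * \<sigma> z * \<sigma>' z / (1 - z\<^sup>2 - ((\<sigma> z)\<^sup>2 + (\<sigma>' z)\<^sup>2) / 3)\<^sup>2"
    proof -
      define t where "t = 1 - 3 / 2 * y"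
      have t: "t > 0" using y by (simp add: t_def)
      have 1: "1 - z\<^sup>2 - ((\<sigma> z)\<^sup>2 + (\<sigma>' z)\<^sup>2) / 3 = 8 / 9 * t" unfolding \<sigma>2 t_def y_def by (simp add: field_simps)
      have "4 * \<sigma> z * \<sigma>' z / (1 - z\<^sup>2 - ((\<sigma> z)\<^sup>2 + (\<sigma>' z)\<^sup>2) / 3)\<^sup>2 = 81 / 32 * ((1/3 - y) * (1 / t\<^sup>2))"
        unfolding 1 \<sigma>\<sigma> y_def using t by (simp add: power_mult_distrib power_divide field_simps)
      \<comment> \<open>The cubic is the Taylor polynomial of (1 - 3 y / 2)^(-2), with all omitted
        terms positive. It replaces the density by a polynomial, so that the integral can be
        evaluated without logarithms.\<close>
      moreover have "1 + 3 * y + 27 / 4 * y\<^sup>2 + 27 / 2 * y ^ 3 \<le> 1 / t\<^sup>2"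
      proof -
        have "(1 + 3 * y + 27 / 4 * y\<^sup>2 + 27 / 2 * y ^ 3) * t\<^sup>2 = 1 - 405 / 16 * y ^ 4 + 243 / 8 * y ^ 5"
          by (simp add: t_def power2_eq_square algebra_simps eval_nat_numeral)
        also have "\<dots> = 1 - y ^ 4 * (405 / 16 - 243 / 8 * y)"
          by (simp add: algebra_simps eval_nat_numeral)
        also have "\<dots> \<le> 1" using y by simp
        finally show ?thesis using t by (simp add: pos_le_divide_eq)
      qed
      ultimately show ?thesis unfolding F'y using y by (simp only:) (intro mult_left_mono; simp)
    qed
    show "(?F has_real_derivative ?F' z) (at z)"
      by (auto intro!: derivative_eq_intros simp: algebra_simps)
    fix u w assume u: "- \<sigma> z < u" "u < \<sigma> z" and w: "- \<sigma>' z < w" "w < \<sigma>' z"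
    define \<alpha> where "\<alpha> = u / \<sigma> z"
    define \<beta> where "\<beta> = w / \<sigma>' z"
    have \<alpha>: "-1 < \<alpha>" "\<alpha> < 1" and \<beta>: "-1 < \<beta>" "\<beta> < 1"
      using u w pos by (simp_all add: \<alpha>_def \<beta>_def pos_less_divide_eq pos_divide_less_eq)
    have "u / sqrt 2 = \<alpha> * (s + z) / 2"
    proof -
      have "u = \<alpha> * ((s + z) / sqrt 2)" using pos unfolding \<alpha>_def \<sigma>_def[symmetric] by simp
      then show ?thesis by simp
    qed
    moreover have "w / sqrt 2 = \<beta> * (s - z) / 2"
    proof -
      have "w = \<beta> * ((s - z) / sqrt 2)" using pos unfolding \<beta>_def \<sigma>'_def[symmetric] by simp
      then show ?thesis by simp
    qed
    ultimately have uw: "(u + w) / sqrt 2 = \<alpha> * (s + z) / 2 + \<beta> * (s - z) / 2"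
        "(u - w) / sqrt 2 = \<alpha> * (s + z) / 2 - \<beta> * (s - z) / 2"
      by (simp_all only: add_divide_distrib diff_divide_distrib)
    have A: "((1 + \<alpha>) / 2) *\<^sub>R vector [s, s, s] + ((1 - \<alpha>) / 2) *\<^sub>R vector [s, -s, -s] \<in> ?K"
      unfolding K using \<alpha> by (intro convexD convex_convex_hull hull_inc) (auto simp: field_simps)
    have B: "((1 + \<beta>) / 2) *\<^sub>R vector [-s, s, -s] + ((1 - \<beta>) / 2) *\<^sub>R vector [-s, -s, s] \<in> ?K"
      unfolding K using \<beta> by (intro convexD convex_convex_hull hull_inc) (auto simp: field_simps)
    \<comment> \<open>The point at height \<open>z\<close> divides a segment between the two
      opposite edges. \<open>\<alpha>\<close> and \<open>\<beta>\<close> are the positions of its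
      ends on these edges, and the weights are determined by the height.\<close>
    have "((s + z) / (2 * s)) *\<^sub>R (((1 + \<alpha>) / 2) *\<^sub>R vector [s, s, s] + ((1 - \<alpha>) / 2) *\<^sub>R vector [s, -s, -s])
      + ((s - z) / (2 * s)) *\<^sub>R (((1 + \<beta>) / 2) *\<^sub>R vector [-s, s, -s] + ((1 - \<beta>) / 2) *\<^sub>R vector [-s, -s, s]) \<in> ?K"
      by (rule convexD[OF convex_convex_hull A B]) (use z s0 in \<open>auto simp: field_simps\<close>)
    also have "((s + z) / (2 * s)) *\<^sub>R (((1 + \<alpha>) / 2) *\<^sub>R vector [s, s, s] + ((1 - \<alpha>) / 2) *\<^sub>R vector [s, -s, -s])
      + ((s - z) / (2 * s)) *\<^sub>R (((1 + \<beta>) / 2) *\<^sub>R vector [-s, s, -s] + ((1 - \<beta>) / 2) *\<^sub>R vector [-s, -s, s])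
      = (vector [z, (u + w) / sqrt 2, (u - w) / sqrt 2] :: real^3)"
      unfolding uw using s0 by (simp add: vec_eq_iff forall_3) (simp add: field_simps)
    finally show "(vector [z, (u + w) / sqrt 2, (u - w) / sqrt 2] :: real^3) \<in> ?K" .
  qed (use s0 in auto)
  moreover have "209 / 250 \<le> ?F s - ?F (- s)"
  proof -
    have "s ^ 5 = s * (s\<^sup>2)\<^sup>2" "s ^ 7 = s * (s\<^sup>2) ^ 3" "s ^ 9 = s * (s\<^sup>2) ^ 4"
      by (simp_all add: eval_nat_numeral)
    then have pw: "s ^ 5 = s / 9" "s ^ 7 = s / 27" "s ^ 9 = s / 81" unfolding s2 by (simp_all add: eval_nat_numeral)
    have "0.577\<^sup>2 \<le> s\<^sup>2" unfolding s2 by (simp add: power2_eq_square)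
    then have "0.577 \<le> s" using s0 by (simp add: power2_le_iff_abs_le)
    then show ?thesis by (simp add: pw)
  qed
  ultimately show ?thesis using ennreal_leI order_trans by blast
qed

text \<open>\<open>measure\<close> returns 0 on sets of infinite measure, so a lower bound for
  \<open>emeasure\<close> passes to \<open>hyp_volume\<close> only together with finiteness, here
  supplied by the flag bound.\<close>

lemma hyp_volume_polytope_slice_ge:
  assumes "finite X" "X \<subseteq> cball 0 1" "0 \<le> c" "ennreal c \<le> emeasure hyp_measure (convex hull X \<inter> hyp3)"
  shows "c \<le> hyp_volume (convex hull X \<inter> hyp3)"
proof -
  have "polytope (convex hull X)" using assms(1) by (rule polytope_convex_hull)
  moreover have "convex hull X \<subseteq> cball 0 1" using assms(2) by (intro hull_minimal) auto
  ultimately have "emeasure hyp_measure (convex hull X) < \<infinity>" by (rule emeasure_hyp_polytope_finite)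
  moreover have "emeasure hyp_measure (convex hull X \<inter> hyp3) \<le> emeasure hyp_measure (convex hull X)"
    using assms(1) by (intro emeasure_mono) (simp_all add: borel_closed compact_imp_closed finite_imp_compact_convex_hull)
  ultimately have "emeasure hyp_measure (convex hull X \<inter> hyp3) \<noteq> \<infinity>" by (auto dest: le_less_trans)
  then have "ennreal c \<le> ennreal (hyp_volume (convex hull X \<inter> hyp3))"
    using assms(4) by (simp add: hyp_volume_def emeasure_eq_ennreal_measure)
  then show ?thesis using assms(3) by (simp add: hyp_volume_def)
qed

lemma V8_ge: "3 \<le> V8"
  unfolding V8_def
  by (rule hyp_volume_polytope_slice_ge) (use octahedron_emeasure_ge in auto)

lemma V3_ge: "209 / 250 \<le> V3"
  unfolding V3_def
proof (rule hyp_volume_polytope_slice_ge)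
  have "norm (vector [x, y, z] :: real^3) = sqrt 3" if "x\<^sup>2 = 1" "y\<^sup>2 = 1" "z\<^sup>2 = 1" for x y z
    using that by (simp add: norm_eq_sqrt_inner inner_vec_def sum_3 flip: power2_eq_square)
  then show "(\<lambda>p. p /\<^sub>R sqrt 3) ` {vector [1, 1, 1], vector [1, -1, -1], vector [-1, 1, -1], vector [-1, -1, 1]}
      \<subseteq> cball (0 :: real^3) 1" by simp
qed (use tetrahedron_emeasure_ge in auto)

section \<open>Non-obtuse polytopes in the Klein model\<close>

lemma open_hyp3 [simp]: "open hyp3" and convex_hyp3 [simp]: "convex hyp3"
  by (simp_all add: hyp3_def)

text \<open>Up to a positive factor, c - (x \<bullet> c) x is the Klein gradient of the linear
  function with coefficient vector \<open>c\<close>. Orthogonality in the Klein metric thus becomes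
  a statement about Euclidean inner products with normals.\<close>

lemma klein_metric_gradient:
  assumes "x \<in> hyp3"
  shows "klein_metric x (c - (x \<bullet> c) *\<^sub>R x) w = (c \<bullet> w) / (1 - (norm x)\<^sup>2)"
proof -
  have s: "1 - (norm x)\<^sup>2 > 0" using assms by (simp add: hyp3_def abs_square_less_1)
  have xx: "x \<bullet> x = (norm x)\<^sup>2" by (simp add: power2_norm_eq_inner)
  have "x \<bullet> (c - (x \<bullet> c) *\<^sub>R x) = (x \<bullet> c) * (1 - (norm x)\<^sup>2)"
    by (simp add: inner_diff_right xx algebra_simps)
  then show ?thesis using s unfolding klein_metric_def
    by (simp add: inner_diff_left power2_eq_square add_divide_distrib[symmetric] diff_divide_distrib)
qed

text \<open>For \<open>x\<close> in the open ball this is, up to the factor \<open>1 - \<bar>x\<bar>\<^sup>2\<close>, the dual of the Klein metric.\<close>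

definition dual_form :: "'a::real_inner \<Rightarrow> 'a \<Rightarrow> 'a \<Rightarrow> real" where
  "dual_form x c c' = c \<bullet> c' - (c \<bullet> x) * (c' \<bullet> x)"

lemma dual_form_add: "dual_form x (c + d) e = dual_form x c e + dual_form x d e"
  and dual_form_scale: "dual_form x (k *\<^sub>R c) e = k * dual_form x c e"
  and dual_form_minus: "dual_form x (- c) e = - dual_form x c e"
  and dual_form_diff: "dual_form x (c - d) e = dual_form x c e - dual_form x d e"
  and dual_form_commute: "dual_form x c e = dual_form x e c"
  by (simp_all add: dual_form_def inner_simps inner_commute algebra_simps)

lemma dual_form_add': "dual_form x e (c + d) = dual_form x e c + dual_form x e d"
  and dual_form_scale': "dual_form x e (k *\<^sub>R c) = k * dual_form x e c"
  and dual_form_minus': "dual_form x e (- c) = - dual_form x e c"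
  and dual_form_diff': "dual_form x e (c - d) = dual_form x e c - dual_form x e d"
  by (simp_all add: dual_form_def inner_simps inner_commute algebra_simps)

lemmas dual_form_simps = dual_form_add dual_form_scale dual_form_minus dual_form_diff
  dual_form_add' dual_form_scale' dual_form_minus' dual_form_diff'

lemma dual_form_pos:
  assumes "norm x < 1" "c \<noteq> 0"
  shows "dual_form x c c > 0"
proof -
  have "(c \<bullet> x)\<^sup>2 \<le> (norm c * norm x)\<^sup>2"
    using Cauchy_Schwarz_ineq2[of c x] by (simp add: abs_le_square_iff[symmetric] abs_mult)
  also have "\<dots> = (norm c)\<^sup>2 * (norm x)\<^sup>2" by (simp add: power_mult_distrib)
  also have "\<dots> < (norm c)\<^sup>2 * 1" using assms by (intro mult_strict_left_mono) (auto simp: abs_square_less_1)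
  finally show ?thesis by (simp add: dual_form_def dot_square_norm power2_eq_square)
qed

lemma dual_form_cauchy_schwarz_strict:
  assumes "norm x < 1" "c \<noteq> 0" "\<And>k. c' \<noteq> k *\<^sub>R c"
  shows "(dual_form x c c')\<^sup>2 < dual_form x c c * dual_form x c' c'"
proof -
  define p where "p = dual_form x c c"
  define q where "q = dual_form x c c'"
  have p: "p > 0" using dual_form_pos assms by (simp add: p_def)
  have "c' - (q / p) *\<^sub>R c \<noteq> 0" using assms(3)[of "q / p"] by simp
  from dual_form_pos[OF assms(1) this]
  have "0 < dual_form x c' c' - q * q / p"
    using p by (simp add: dual_form_simps dual_form_commute[of x c' c] flip: p_def q_def) 
  then show ?thesis using p by (simp add: field_simps power2_eq_square p_def[symmetric] q_def[symmetric])
qed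

lemma dual_form_cauchy_schwarz:
  assumes "norm x < 1"
  shows "(dual_form x c c')\<^sup>2 \<le> dual_form x c c * dual_form x c' c'"
proof (cases "c = 0 \<or> (\<exists>k. c' = k *\<^sub>R c)")
  case True
  then show ?thesis
    by (auto simp: dual_form_simps power2_eq_square) (auto simp: dual_form_def)
next
  case False
  then show ?thesis using dual_form_cauchy_schwarz_strict[OF assms] less_imp_le by blast
qed

text \<open>Fixing one outer normal \<open>(a F, b F)\<close> per facet makes Lorentzian products of
  facets functions of the facets. Normals are not scaled to unit length, since only the signs of
  their products are used.\<close>

locale klein_polytope =
  fixes Q :: "(real^3) set" and a :: "(real^3) set \<Rightarrow> real^3" and b :: "(real^3) set \<Rightarrow> real"
  assumes polytope_Q: "polytope Q" and Q_cball: "Q \<subseteq> cball 0 1" and interior_Q: "interior Q \<noteq> {}"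
    and normal_nz: "F facet_of Q \<Longrightarrow> a F \<noteq> 0"
    and facet_le: "F facet_of Q \<Longrightarrow> x \<in> Q \<Longrightarrow> a F \<bullet> x \<le> b F"
    and facet_eq: "F facet_of Q \<Longrightarrow> F = Q \<inter> {x. a F \<bullet> x = b F}"
    and non_obtuse_Q: "non_obtuse (Q \<inter> hyp3)"
begin

text \<open>The Lorentzian product of the outer normals \<open>(a F, b F)\<close> and \<open>(a G, b G)\<close>.\<close>

definition nprod :: "(real^3) set \<Rightarrow> (real^3) set \<Rightarrow> real" where
  "nprod F G = a F \<bullet> a G - b F * b G"

lemma convex_Q: "convex Q" and polyhedron_Q: "polyhedron Q" and closed_Q: "closed Q"
  using polytope_Q by (auto intro: polytope_imp_convex polytope_imp_polyhedron polytope_imp_closed)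

lemma aff_dim_Q: "aff_dim Q = 3"
  using aff_dim_nonempty_interior[OF interior_Q] by simp

lemma affine_hull_Q: "affine hull Q = UNIV"
  using affine_hull_nonempty_interior[OF interior_Q] .

lemma mem_facet: "F facet_of Q \<Longrightarrow> x \<in> F \<longleftrightarrow> x \<in> Q \<and> a F \<bullet> x = b F"
  using facet_eq by blast

lemma facet_subset: "F facet_of Q \<Longrightarrow> F \<subseteq> Q"
  by (rule facet_of_imp_subset)

text \<open>The closed ball is strictly convex, so the midpoint of two distinct points of
  \<open>E\<close> is an interior point of the ball.\<close>

lemma face_meets_hyp3:
  assumes "E \<subseteq> Q" "aff_dim E \<ge> 1" "convex E"
  shows "E \<inter> hyp3 \<noteq> {}"
proof -
  have "\<not> (\<exists>x. E \<subseteq> {x})"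
  proof
    assume "\<exists>x. E \<subseteq> {x}"
    then obtain x where "E \<subseteq> {x}" by blast
    then have "aff_dim E \<le> aff_dim {x}" by (rule aff_dim_subset)
    then show False using assms(2) by simp
  qed
  then obtain x y where xy: "x \<in> E" "y \<in> E" "x \<noteq> y" by blast
  have n: "norm x \<le> 1" "norm y \<le> 1" using xy assms(1) Q_cball by auto
  have "(norm (x + y))\<^sup>2 + (norm (x - y))\<^sup>2 = 2 * (norm x)\<^sup>2 + 2 * (norm y)\<^sup>2"
    unfolding power2_norm_eq_inner by (simp add: inner_simps inner_commute)
  moreover have "(norm (x - y))\<^sup>2 > 0" using xy by simp
  moreover have "(norm x)\<^sup>2 \<le> 1" "(norm y)\<^sup>2 \<le> 1" using n by (simp_all add: power_le_one)
  ultimately have "(norm (x + y))\<^sup>2 < 4" by linarith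
  then have "(norm (x + y))\<^sup>2 < 2\<^sup>2" by simp
  then have "norm (x + y) < 2" by (rule power2_less_imp_less) simp
  then have "norm ((1/2) *\<^sub>R x + (1/2) *\<^sub>R y) < 1" by (simp flip: scaleR_add_right)
  then have "(1/2) *\<^sub>R x + (1/2) *\<^sub>R y \<in> hyp3" by (simp add: hyp3_def)
  moreover have "(1/2) *\<^sub>R x + (1/2) *\<^sub>R y \<in> E" using assms(3) xy by (intro convexD) auto
  ultimately show ?thesis by blast
qed

text \<open>A face of positive dimension survives the intersection with the open ball with its
  dimension, and its closure restores it. Only vertices on the sphere are lost, which is why they
  are treated separately as ideal vertices.\<close>

lemma face_slice:
  assumes "E face_of Q" "aff_dim E \<ge> 1"
  shows "E \<inter> hyp3 \<noteq> {}" "(E \<inter> hyp3) face_of (Q \<inter> hyp3)" "aff_dim (E \<inter> hyp3) = aff_dim E"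
    "rel_interior (E \<inter> hyp3) \<subseteq> rel_interior E" "rel_interior (E \<inter> hyp3) \<noteq> {}" "closure (E \<inter> hyp3) = E"
proof -
  have cE: "convex E" using assms face_of_imp_convex by blast
  then show ne: "E \<inter> hyp3 \<noteq> {}" using face_meets_hyp3 assms face_of_imp_subset by blast
  show "(E \<inter> hyp3) face_of (Q \<inter> hyp3)" using assms by (intro face_of_slice) auto
  show "aff_dim (E \<inter> hyp3) = aff_dim E" using ne cE by (intro aff_dim_convex_Int_open) auto
  show r: "rel_interior (E \<inter> hyp3) \<subseteq> rel_interior E"
    using ne cE by (intro subset_rel_interior affine_hull_convex_Int_open) auto
  show ne': "rel_interior (E \<inter> hyp3) \<noteq> {}" using ne cE by (simp add: rel_interior_eq_empty convex_Int)
  have "rel_interior hyp3 = hyp3" by (simp add: rel_interior_open)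
  then have "rel_interior E \<inter> rel_interior hyp3 \<noteq> {}" using r ne' rel_interior_subset by blast
  then have "closure (E \<inter> hyp3) = closure E \<inter> closure hyp3" using cE by (intro closure_Int_convex) auto
  also have "\<dots> = E \<inter> cball 0 1" using face_of_imp_closed[OF convex_Q closed_Q assms(1)] by (simp add: hyp3_def)
  also have "\<dots> = E" using assms Q_cball face_of_imp_subset by blast
  finally show "closure (E \<inter> hyp3) = E" .
qed

lemma facet_face: "F facet_of Q \<Longrightarrow> F face_of Q \<and> aff_dim F = 2"
  by (simp add: facet_of_def aff_dim_Q)

lemma rel_interior_facet_disjoint:
  assumes "F facet_of Q" "G facet_of Q" "F \<noteq> G" "x \<in> rel_interior F"
  shows "x \<notin> G"
proof
  assume "x \<in> G"
  then have FG: "F \<subseteq> G"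
    using subset_of_face_of[of G Q F] assms facet_face facet_subset by blast
  then have "F face_of G" using face_of_face[of G Q F] assms facet_face by blast
  moreover have "convex G" using assms facet_face face_of_imp_convex by blast
  ultimately have "aff_dim F < aff_dim G" using face_of_aff_dim_lt assms(3) by blast
  then show False using assms facet_face by force
qed

lemma facet_inner_point:
  assumes "F facet_of Q"
  obtains x where "x \<in> F" "x \<in> hyp3" "x \<in> rel_interior F"
  using face_slice[of F] facet_face[OF assms] rel_interior_subset[of "F \<inter> hyp3"] by fastforce

text \<open>Normals are space-like: at a point of the facet inside the ball,
  \<open>nprod F F\<close> is the value of the positive definite dual form at
  \<open>a F\<close>.\<close>

lemma nprod_self_pos:
  assumes "F facet_of Q"
  shows "nprod F F > 0"
proof -
  obtain x where x: "x \<in> F" "x \<in> hyp3" using facet_inner_point[OF assms] .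
  have "norm x < 1" using x by (simp add: hyp3_def)
  from dual_form_pos[OF this normal_nz[OF assms]] show ?thesis
    using x mem_facet[OF assms] by (simp add: dual_form_def nprod_def)
qed

lemma mem_Q_if:
  assumes "\<And>F. F facet_of Q \<Longrightarrow> a F \<bullet> y \<le> b F"
  shows "y \<in> Q"
proof (rule mem_polytope_if_facet_inequalities[OF polytope_Q])
  show "Q \<noteq> {}" using interior_Q interior_subset by blast
  fix F assume F: "F facet_of Q"
  have "F \<noteq> Q" using F facet_of_irrefl by blast
  then have "\<exists>x\<in>Q. a F \<bullet> x \<noteq> b F" using mem_facet[OF F] facet_subset[OF F] by blast
  then show "\<exists>c d. (\<forall>x\<in>Q. c \<bullet> x \<le> d) \<and> (\<forall>x\<in>F. c \<bullet> x = d) \<and> (\<exists>x\<in>Q. c \<bullet> x \<noteq> d) \<and> c \<bullet> y \<le> d"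
    using facet_le[OF F] mem_facet[OF F] assms[OF F] by blast
qed (simp add: affine_hull_Q)

lemma finite_facets: "finite {F. F facet_of Q}"
  using finite_polyhedron_facets[OF polyhedron_Q] .

lemma eventually_feasible:
  assumes "x \<in> Q" and d: "\<And>F. F facet_of Q \<Longrightarrow> x \<in> F \<Longrightarrow> a F \<bullet> d \<le> 0"
  shows "eventually (\<lambda>t. x + t *\<^sub>R d \<in> Q) (at_right 0)"
proof -
  have "\<forall>F\<in>{F. F facet_of Q}. eventually (\<lambda>t. a F \<bullet> (x + t *\<^sub>R d) \<le> b F) (at_right 0)"
  proof
    fix F assume "F \<in> {F. F facet_of Q}"
    then have F: "F facet_of Q" by simp
    show "eventually (\<lambda>t. a F \<bullet> (x + t *\<^sub>R d) \<le> b F) (at_right 0)"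
    proof (cases "x \<in> F")
      case True
      show ?thesis using eventually_at_right_less[of 0]
      proof eventually_elim
        case (elim t)
        then have "t * (a F \<bullet> d) \<le> 0" using d[OF F True] by (intro mult_nonneg_nonpos) auto
        then show ?case using True mem_facet[OF F] by (simp add: inner_add_right)
      qed
    next
      case False
      then have "a F \<bullet> x < b F" using facet_le[OF F assms(1)] mem_facet[OF F] assms(1) by force
      moreover have "((\<lambda>t. a F \<bullet> (x + t *\<^sub>R d)) \<longlongrightarrow> a F \<bullet> (x + 0 *\<^sub>R d)) (at_right 0)"
        by (intro tendsto_intros)
      ultimately have "eventually (\<lambda>t. a F \<bullet> (x + t *\<^sub>R d) < b F) (at_right 0)"
        by (intro order_tendstoD(2)) auto
      then show ?thesis by eventually_elim simp
    qed
  qed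
  then have "eventually (\<lambda>t. \<forall>F\<in>{F. F facet_of Q}. a F \<bullet> (x + t *\<^sub>R d) \<le> b F) (at_right 0)"
    by (rule eventually_ball_finite[OF finite_facets])
  then show ?thesis by eventually_elim (auto intro: mem_Q_if)
qed

lemma edge_face: "E edge_of Q \<Longrightarrow> E face_of Q \<and> aff_dim E = 1"
  by (simp add: edge_of_def)

lemma facets_containing_edge:
  assumes "E edge_of Q"
  shows "card {F. F facet_of Q \<and> E \<subseteq> F} = 2"
  using assms edge_face[OF assms] aff_dim_Q
  by (intro facets_containing_ridge[OF polyhedron_Q]) auto

text \<open>At a point of the edge, the tangents into \<open>F\<close> and \<open>G\<close>
  perpendicular to the edge are gradients of combinations of the two normals. The cosine of their
  angle has the sign opposite to that of the product of the normals, so an angle of at most pi/2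
  means a non-positive product.\<close>

lemma dihedral_nonobtuse:
  assumes F: "F facet_of Q" and G: "G facet_of Q" and FG: "F \<noteq> G"
    and E: "E edge_of Q" "E \<subseteq> F" "E \<subseteq> G"
  shows "nprod F G \<le> 0"
proof -
  note Es = face_slice[of E]
  have Ef: "E face_of Q" "aff_dim E \<ge> 1" using edge_face[OF E(1)] by auto
  obtain x where x': "x \<in> rel_interior (E \<inter> hyp3)" using Es(5)[OF Ef] by blast
  then have x: "x \<in> E" "x \<in> hyp3" "x \<in> rel_interior E"
    using rel_interior_subset Es(4)[OF Ef] by blast+
  have xQ: "x \<in> Q" using x Ef face_of_imp_subset by blast
  have nx: "norm x < 1" using x by (simp add: hyp3_def)
  \<comment> \<open>Near \<open>x\<close> the polytope is thus cut out by the inequalities of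
    \<open>F\<close> and \<open>G\<close> alone, so a direction is feasible as soon as it respects
    these two.\<close>
  have only: "H = F \<or> H = G" if H: "H facet_of Q" "x \<in> H" for H
  proof -
    have "E \<subseteq> H" using subset_of_face_of[of H Q E] H x facet_face face_of_imp_subset Ef by blast
    then have sub: "{F, G, H} \<subseteq> {F. F facet_of Q \<and> E \<subseteq> F}" using F G H E by auto
    have "finite {F. F facet_of Q \<and> E \<subseteq> F}" using finite_facets by (rule rev_finite_subset) auto
    then have "card {F, G, H} \<le> 2" using card_mono[OF _ sub] facets_containing_edge[OF E(1)] by simp
    then show ?thesis using FG by (auto simp: card_insert_if split: if_splits)
  qed
  have aFx: "a F \<bullet> x = b F" and aGx: "a G \<bullet> x = b G" using x E mem_facet F G by blast+
  let ?B = "dual_form x"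
  define p where "p = ?B (a F) (a F)"
  define q where "q = ?B (a F) (a G)"
  define r where "r = ?B (a G) (a G)"
  have Bs: "?B (a F) (a F) = p" "?B (a F) (a G) = q" "?B (a G) (a F) = q" "?B (a G) (a G) = r"
    by (simp_all add: p_def q_def r_def dual_form_commute)
  have qn: "nprod F G = q" by (simp add: q_def nprod_def dual_form_def aFx aGx)
  have p: "p > 0" and r: "r > 0" using dual_form_pos[OF nx] normal_nz F G by (auto simp: p_def r_def)
  have cs: "q\<^sup>2 < p * r"
    unfolding p_def q_def r_def
  proof (rule dual_form_cauchy_schwarz_strict[OF nx normal_nz[OF F]])
    fix k show "a G \<noteq> k *\<^sub>R a F"
    proof
      assume k: "a G = k *\<^sub>R a F"
      then have "b G = k * b F" using aFx aGx by simp
      then have "F \<subseteq> G" using k mem_facet[OF F] mem_facet[OF G] by auto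
      moreover obtain y where "y \<in> rel_interior F" "y \<in> F" using facet_inner_point[OF F] .
      ultimately show False using rel_interior_facet_disjoint[OF F G FG] by blast
    qed
  qed
  \<comment> \<open>Gram-Schmidt in the dual form: \<open>c\<close> is the negative of the part of
    \<open>a G\<close> orthogonal to \<open>a F\<close>, so the gradient \<open>D c\<close> is
    tangent to \<open>F\<close> and points to the inner side of \<open>G\<close>. \<open>c'\<close>
    is the same with the roles exchanged.\<close>
  define c where "c = (q / p) *\<^sub>R a F - a G"
  define c' where "c' = (q / r) *\<^sub>R a G - a F"
  define D where "D w = w - (x \<bullet> w) *\<^sub>R x" for w
  have BD: "w \<bullet> D w' = ?B w w'" for w w' by (simp add: D_def dual_form_def inner_simps inner_commute)
  have aFc: "a F \<bullet> D c = 0" "a G \<bullet> D c < 0" and aGc: "a G \<bullet> D c' = 0" "a F \<bullet> D c' < 0"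
    using p r cs by (simp_all add: BD c_def c'_def dual_form_simps Bs field_simps power2_eq_square)
  have Dnz: "D c \<noteq> 0" "D c' \<noteq> 0" using aFc(2) aGc(2) by auto
  have ev: "eventually (\<lambda>t. x + t *\<^sub>R D w \<in> hyp3) (at_right 0)" for w
  proof -
    have "((\<lambda>t. x + t *\<^sub>R D w) \<longlongrightarrow> x + 0 *\<^sub>R D w) (at_right 0)" by (intro tendsto_intros)
    then show ?thesis using topological_tendstoD[of _ _ _ hyp3] x(2) by simp
  qed
  have "eventually (\<lambda>t. x + t *\<^sub>R D c \<in> Q) (at_right 0)"
    by (rule eventually_feasible[OF xQ]) (use only aFc in force)
  moreover have "eventually (\<lambda>t. x + t *\<^sub>R D c' \<in> Q) (at_right 0)"
    by (rule eventually_feasible[OF xQ]) (use only aGc in force)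
  ultimately have "eventually (\<lambda>t. t > 0 \<and> x + t *\<^sub>R D c \<in> Q \<inter> hyp3 \<and> x + t *\<^sub>R D c' \<in> Q \<inter> hyp3) (at_right 0)"
    using ev[of c] ev[of c'] eventually_at_right_less[of 0] by eventually_elim auto
  then obtain t where t: "t > 0" "x + t *\<^sub>R D c \<in> Q \<inter> hyp3" "x + t *\<^sub>R D c' \<in> Q \<inter> hyp3"
    using eventually_happens by (metis (no_types, lifting) trivial_limit_at_right_real)
  define u where "u = D (t *\<^sub>R c)"
  define v where "v = D (t *\<^sub>R c')"
  have uv: "u = t *\<^sub>R D c" "v = t *\<^sub>R D c'" by (simp_all add: u_def v_def D_def algebra_simps)
  define s where "s = 1 - (norm x)\<^sup>2"
  have s: "s > 0" using nx by (simp add: s_def abs_square_less_1)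
  have km: "klein_metric x (D w) w' = (w \<bullet> w') / s" for w w'
    unfolding D_def s_def by (rule klein_metric_gradient[OF x(2)])
  have kuv: "klein_metric x u v = ?B (t *\<^sub>R c) (t *\<^sub>R c') / s" "klein_metric x u u = ?B (t *\<^sub>R c) (t *\<^sub>R c) / s"
     "klein_metric x v v = ?B (t *\<^sub>R c') (t *\<^sub>R c') / s"
    by (simp_all only: u_def v_def km BD)
  have orth: "klein_metric x u (y - x) = 0 \<and> klein_metric x v (y - x) = 0" if "y \<in> E \<inter> hyp3" for y
  proof -
    have "a F \<bullet> y = b F" "a G \<bullet> y = b G" using that E mem_facet F G by blast+
    then show ?thesis using aFx aGx by (simp add: u_def v_def km c_def c'_def inner_simps)
  qed
  have xu: "x + u \<in> F \<inter> hyp3" "x + v \<in> G \<inter> hyp3"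
    using t aFc aGc aFx aGx by (auto simp: uv mem_facet[OF F] mem_facet[OF G] inner_simps)
  have facP: "(H \<inter> hyp3) facet_of (Q \<inter> hyp3)" if "H facet_of Q" for H
    using face_slice[of H] face_slice[of Q] facet_face[OF that] aff_dim_Q convex_Q
    by (auto simp: facet_of_def face_of_refl)
  have FG': "F \<inter> hyp3 \<noteq> G \<inter> hyp3"
  proof
    assume eq: "F \<inter> hyp3 = G \<inter> hyp3"
    obtain y where "y \<in> F" "y \<in> hyp3" "y \<in> rel_interior F" using facet_inner_point[OF F] .
    then show False using eq rel_interior_facet_disjoint[OF F G FG] by blast
  qed
  have eP: "(E \<inter> hyp3) edge_of (Q \<inter> hyp3)" using Es(2,3)[OF Ef] edge_face[OF E(1)] by (simp add: edge_of_def)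
  have nz: "u \<noteq> 0" "v \<noteq> 0" using Dnz t by (simp_all add: uv)
  have "E \<inter> hyp3 \<subseteq> (F \<inter> hyp3) \<inter> (G \<inter> hyp3)" using E by blast
  then have "hyp_angle x u v \<in> dihedral_angles (Q \<inter> hyp3)"
    unfolding dihedral_angles_def using facP[OF F] facP[OF G] FG' eP x' nz xu orth by blast
  then have ang: "hyp_angle x u v \<le> pi / 2" using non_obtuse_Q by (auto simp: non_obtuse_def)
  define K where "K = klein_metric x u v / sqrt (klein_metric x u u * klein_metric x v v)"
  have tc: "t *\<^sub>R c \<noteq> 0" "t *\<^sub>R c' \<noteq> 0" using Dnz t by (auto simp: D_def)
  have kpos: "klein_metric x u u * klein_metric x v v > 0"
    unfolding kuv using dual_form_pos[OF nx tc(1)] dual_form_pos[OF nx tc(2)] s by simp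
  have "(klein_metric x u v)\<^sup>2 \<le> klein_metric x u u * klein_metric x v v"
    using dual_form_cauchy_schwarz[OF nx, of "t *\<^sub>R c" "t *\<^sub>R c'"] s
    unfolding kuv by (simp add: power_divide divide_right_mono power2_eq_square)
  then have "\<bar>klein_metric x u v\<bar> \<le> sqrt (klein_metric x u u * klein_metric x v v)" by (rule real_le_rsqrt[of "\<bar>_\<bar>", simplified])
  \<comment> \<open>\<open>arccos\<close> is the inverse of \<open>cos\<close> only on [-1, 1];
    Cauchy-Schwarz for the dual form puts the quotient there.\<close>
  then have K1: "\<bar>K\<bar> \<le> 1" using kpos by (simp add: K_def abs_divide)
  have "K = cos (arccos K)" using K1 by (simp add: cos_arccos_abs)
  moreover have "0 \<le> arccos K" using K1 by (intro arccos_lbound) auto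
  moreover have "arccos K \<le> pi / 2" using ang by (simp add: hyp_angle_def K_def)
  ultimately have "K \<ge> 0" using cos_ge_zero[of "arccos K"] pi_ge_zero by linarith
  then have "klein_metric x u v \<ge> 0" using kpos by (simp add: K_def zero_le_divide_iff)
  then have "?B (t *\<^sub>R c) (t *\<^sub>R c') \<ge> 0" unfolding kuv using s by (simp add: zero_le_divide_iff)
  then have "?B c c' \<ge> 0" using t by (simp add: dual_form_simps zero_le_mult_iff)
  moreover have "?B c c' = - q * (1 - q\<^sup>2 / (p * r))"
    using p r by (simp add: c_def c'_def dual_form_simps Bs field_simps power2_eq_square)
  moreover have "1 - q\<^sup>2 / (p * r) > 0" using cs p r by simp
  ultimately have "q \<le> 0" by (metis less_le_not_le linorder_not_le mult_neg_pos neg_less_0_iff_less)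
  then show ?thesis by (simp add: qn)
qed

lemma edge_iff_facet_of_facet:
  assumes "F facet_of Q"
  shows "E facet_of F \<longleftrightarrow> E edge_of Q \<and> E \<subseteq> F"
  using face_of_face[of F Q E] facet_face[OF assms]
  by (auto simp: facet_of_def edge_of_def)

lemma other_facet:
  assumes "E edge_of Q" "F facet_of Q" "E \<subseteq> F"
  obtains G where "G facet_of Q" "G \<noteq> F" "E \<subseteq> G"
proof -
  have "\<not> {F. F facet_of Q \<and> E \<subseteq> F} \<subseteq> {F}"
  proof
    assume "{F. F facet_of Q \<and> E \<subseteq> F} \<subseteq> {F}"
    then have "card {F. F facet_of Q \<and> E \<subseteq> F} \<le> card {F}" by (intro card_mono) auto
    then show False using facets_containing_edge[OF assms(1)] by simp
  qed
  then show ?thesis using that by auto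
qed

lemma affine_hull_facet:
  assumes "F facet_of Q"
  shows "affine hull F = {x. a F \<bullet> x = b F}"
proof (rule affine_dim_equal)
  show "affine hull F \<subseteq> {x. a F \<bullet> x = b F}"
    using mem_facet[OF assms] by (intro hull_minimal affine_hyperplane) auto
  show "affine hull F \<noteq> {}" using assms by (simp add: facet_of_def)
  show "aff_dim (affine hull F) = aff_dim {x. a F \<bullet> x = b F}"
    using facet_face[OF assms] normal_nz[OF assms] by (simp add: aff_dim_hyperplane)
qed (auto simp: affine_hyperplane)

text \<open>As all dihedral angles are at most \<open>\<pi>/2\<close>, the hyperbolic orthogonal projection to the plane of
  a facet \<open>F\<close> maps \<open>Q\<close> into \<open>F\<close>. Projecting a point of \<open>H\<close> shows that \<open>F\<close> and \<open>H\<close> do not meet at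
  an obtuse angle, even when they are not adjacent.\<close>

lemma nprod_nonpos:
  assumes F: "F facet_of Q" and H: "H facet_of Q" and FH: "F \<noteq> H"
  shows "nprod F H \<le> 0"
proof -
  obtain x where x: "x \<in> H" "x \<in> hyp3" "x \<in> rel_interior H" using facet_inner_point[OF H] .
  have xQ: "x \<in> Q" using x facet_subset[OF H] by blast
  have nx: "norm x < 1" using x by (simp add: hyp3_def)
  have "x \<notin> F" using rel_interior_facet_disjoint[OF H F] FH x(3) by blast
  then have Fx: "a F \<bullet> x < b F" using facet_le[OF F xQ] mem_facet[OF F] xQ by force
  have Hx: "a H \<bullet> x = b H" using x mem_facet[OF H] by blast
  define c where "c = nprod F F"
  have c: "c > 0" using nprod_self_pos[OF F] by (simp add: c_def)
  \<comment> \<open>Homogeneously, the projection is (x, 1) - k (a F, b F), with \<open>k\<close>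
    chosen to make the Lorentzian product with (a F, b F) zero. \<open>T\<close> is the last
    coordinate of the result, and division by it returns to the Klein model.\<close>
  define k where "k = (a F \<bullet> x - b F) / c"
  have k: "k < 0" using Fx c by (simp add: k_def divide_neg_pos)
  have kc: "k * c = a F \<bullet> x - b F" using c by (simp add: k_def)
  define T where "T = 1 - k * b F"
  \<comment> \<open>The space-like normal gives |b F| < norm (a F), and together with norm x < 1
    this keeps the last coordinate positive, so the division preserves the signs of all facet
    inequalities.\<close>
  have T: "T > 0"
  proof -
    have bF: "\<bar>b F\<bar> < norm (a F)"
    proof -
      have "(b F)\<^sup>2 < (norm (a F))\<^sup>2" using c by (simp add: c_def nprod_def dot_square_norm power2_eq_square)
      then show ?thesis using power2_less_imp_less[of "\<bar>b F\<bar>" "norm (a F)"] by simp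
    qed
    have "b F * (a F \<bullet> x) \<le> \<bar>b F\<bar> * \<bar>a F \<bullet> x\<bar>" by (simp flip: abs_mult)
    also have "\<dots> \<le> \<bar>b F\<bar> * (norm (a F) * norm x)"
      by (intro mult_left_mono Cauchy_Schwarz_ineq2) auto
    also have "\<dots> \<le> norm (a F) * (norm (a F) * norm x)" using bF by (intro mult_right_mono) auto
    also have "\<dots> < norm (a F) * (norm (a F) * 1)"
      using nx normal_nz[OF F] by (intro mult_strict_left_mono) auto
    finally have "b F * (a F \<bullet> x) < a F \<bullet> a F" by (simp add: dot_square_norm power2_eq_square)
    moreover have "T * c = c - b F * (k * c)" by (simp add: T_def algebra_simps)
    then have "T * c = a F \<bullet> a F - b F * (a F \<bullet> x)"
      unfolding kc by (simp add: c_def nprod_def algebra_simps)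
    ultimately have "T * c > 0" by simp
    then show ?thesis using c by (simp add: zero_less_mult_iff)
  qed
  define x' where "x' = (x - k *\<^sub>R a F) /\<^sub>R T"
  have val: "a G \<bullet> x' - b G = ((a G \<bullet> x - b G) - k * nprod F G) / T" for G
    using T by (simp add: x'_def inner_simps field_simps) (simp add: T_def nprod_def inner_commute algebra_simps)
  have "x' \<in> F"
  proof (rule mem_polytope_if_facet_inequalities)
    show "polytope F" using face_of_polytope_polytope[OF polytope_Q] facet_face[OF F] by blast
    show "F \<noteq> {}" using F by (simp add: facet_of_def)
    have "a F \<bullet> x' - b F = 0" unfolding val using kc by (simp add: c_def)
    then show "x' \<in> affine hull F" by (simp add: affine_hull_facet[OF F])
    fix E assume "E facet_of F"
    then have E: "E edge_of Q" "E \<subseteq> F" using edge_iff_facet_of_facet[OF F] by auto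
    then obtain G where G: "G facet_of Q" "G \<noteq> F" "E \<subseteq> G" using other_facet F by metis
    obtain y where y: "y \<in> F" "y \<in> rel_interior F" using facet_inner_point[OF F] .
    have "y \<notin> G" using rel_interior_facet_disjoint[OF F G(1)] G y by blast
    then have 1: "\<exists>x\<in>F. a G \<bullet> x \<noteq> b G" using y mem_facet[OF G(1)] facet_subset[OF F] by blast
    \<comment> \<open>Membership in \<open>F\<close> has to be tested only against facets that share
      an edge with \<open>F\<close>, and for these the dihedral angle is controlled by
      assumption.\<close>
    have "nprod F G \<le> 0" using dihedral_nonobtuse[OF F G(1)] G(2) E G(3) by blast
    then have "0 \<le> k * nprod F G" using k by (simp add: mult_nonpos_nonpos)
    moreover have "a G \<bullet> x - b G \<le> 0" using facet_le[OF G(1) xQ] by simp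
    ultimately have "a G \<bullet> x' - b G \<le> 0" unfolding val using T by (intro divide_nonpos_pos) auto
    then have "a G \<bullet> x' \<le> b G" by simp
    then show "\<exists>c d. (\<forall>x\<in>F. c \<bullet> x \<le> d) \<and> (\<forall>x\<in>E. c \<bullet> x = d) \<and> (\<exists>x\<in>F. c \<bullet> x \<noteq> d) \<and> c \<bullet> x' \<le> d"
      using 1 facet_le[OF G(1)] facet_subset[OF F] mem_facet[OF G(1)] G(3) by blast
  qed
  then have "a H \<bullet> x' - b H \<le> 0" using facet_le[OF H] facet_subset[OF F] by fastforce
  then have "0 \<le> k * nprod F H / T" unfolding val using Hx by simp
  then have "0 \<le> k * nprod F H" by (simp only: pos_le_divide_eq[OF T] mult_zero_left)
  then show ?thesis using k by (simp add: zero_le_mult_iff)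
qed

section \<open>Degrees of the vertices of Q\<close>

definition facets_at :: "real^3 \<Rightarrow> (real^3) set set" where
  "facets_at v = {F. F facet_of Q \<and> v \<in> F}"

lemma finite_facets_at: "finite (facets_at v)"
  unfolding facets_at_def by (rule finite_subset[OF _ finite_facets]) auto

text \<open>At an ideal vertex the normals are Lorentz-orthogonal to the null vector (v, 1).
  Dropping their components along \<open>v\<close> maps them to the Euclidean plane orthogonal to
  \<open>v\<close> with all products preserved, and four vectors are the maximum there. At a finite
  vertex the products are those of a positive definite form and all normals lie strictly on one
  side, so they are independent and at most three.\<close>

lemma card_facets_at_le_4:
  assumes "v \<in> Q"
  shows "card (facets_at v) \<le> 4"
proof (cases "norm v = 1")
  case True
  then have vv: "v \<bullet> v = 1" by (simp add: dot_square_norm)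
  define p where "p F = a F - (a F \<bullet> v) *\<^sub>R v" for F
  have pp: "p F \<bullet> p G = nprod F G" if "F \<in> facets_at v" "G \<in> facets_at v" for F G
  proof -
    have "a F \<bullet> v = b F" "a G \<bullet> v = b G" using that mem_facet by (auto simp: facets_at_def)
    then show ?thesis using vv by (simp add: p_def nprod_def inner_simps inner_commute)
  qed
  show ?thesis
  proof (rule card_le_4_pairwise_nonacute_in_plane[OF finite_facets_at, where v = v and p = p])
    show "v \<noteq> 0" using True by auto
    fix F assume F: "F \<in> facets_at v"
    show "p F \<bullet> v = 0" using vv by (simp add: p_def inner_simps)
    have "p F \<bullet> p F > 0" using pp[OF F F] nprod_self_pos F by (simp add: facets_at_def)
    then show "p F \<noteq> 0" by auto
    fix G assume "G \<in> facets_at v" "F \<noteq> G"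
    then show "p F \<bullet> p G \<le> 0" using pp[OF F] nprod_nonpos F by (simp add: facets_at_def)
  qed
next
  case False
  then have nv: "norm v < 1" using assms Q_cball by fastforce
  have dn: "dual_form v (a F) (a G) = nprod F G" if "F \<in> facets_at v" "G \<in> facets_at v" for F G
  proof -
    have "a F \<bullet> v = b F" "a G \<bullet> v = b G" using that mem_facet by (auto simp: facets_at_def)
    then show ?thesis by (simp add: dual_form_def nprod_def)
  qed
  obtain q where q: "q \<in> interior Q" using interior_Q by blast
  have inj: "inj_on a (facets_at v)"
  proof (rule inj_onI)
    fix F G assume F: "F \<in> facets_at v" and G: "G \<in> facets_at v" and eq: "a F = a G"
    then have "b F = b G" using mem_facet by (auto simp: facets_at_def)
    then show "F = G" using F G eq mem_facet by (auto simp: facets_at_def)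
  qed
  have "independent (a ` facets_at v)"
  proof (rule independent_pairwise_nonacute[where B = "dual_form v" and d = "q - v"])
    show "finite (a ` facets_at v)" using finite_facets_at by simp
    show "linear (\<lambda>x. dual_form v x y)" for y by (rule linearI) (simp_all add: dual_form_simps)
    show "linear (\<lambda>y. dual_form v x y)" for x by (rule linearI) (simp_all add: dual_form_simps)
    show "dual_form v x x > 0" if "x \<noteq> 0" for x using dual_form_pos[OF nv that] .
    show "dual_form v x y \<le> 0" if xy: "x \<in> a ` facets_at v" "y \<in> a ` facets_at v" "x \<noteq> y" for x y
    proof -
      obtain F G where FG: "x = a F" "y = a G" "F \<in> facets_at v" "G \<in> facets_at v" using xy by blast
      then have "F \<noteq> G" using xy by blast
      then show ?thesis using FG dn nprod_nonpos by (simp add: facets_at_def)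
    qed
    show "x \<bullet> (q - v) < 0" if x: "x \<in> a ` facets_at v" for x
    proof -
      obtain F where F: "x = a F" "F facet_of Q" "v \<in> F" using x by (auto simp: facets_at_def)
      have "F \<inter> interior Q = {}"
        using face_of_disjoint_interior[of F Q] facet_face[OF F(2)] aff_dim_Q by force
      then have "q \<notin> F" using q by blast
      then have "a F \<bullet> q \<noteq> b F" using mem_facet[OF F(2)] q interior_subset by blast
      then have "a F \<bullet> q < b F" using facet_le[OF F(2)] q interior_subset by (metis less_le subsetD)
      then show ?thesis using F mem_facet[OF F(2)] by (simp add: inner_diff_right)
    qed
  qed
  then have "card (a ` facets_at v) \<le> DIM(real^3)" using independent_bound by blast
  then show ?thesis using card_image[OF inj] by simp
qed

text \<open>Fewer than three normals leave a direction \<open>d\<close> orthogonal to all of them.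
  Small steps along \<open>d\<close> and \<open>- d\<close> remain in \<open>Q\<close>, and
  \<open>v\<close> is their midpoint.\<close>

lemma card_facets_at_ge_3:
  assumes "v extreme_point_of Q"
  shows "card (facets_at v) \<ge> 3"
proof (rule ccontr)
  assume n: "\<not> ?thesis"
  have vQ: "v \<in> Q" using assms by (simp add: extreme_point_of_def)
  have "dim (a ` facets_at v) \<le> card (a ` facets_at v)"
    using finite_facets_at by (intro dim_le_card') simp
  also have "\<dots> \<le> card (facets_at v)" using finite_facets_at by (rule card_image_le)
  finally have "dim (a ` facets_at v) < DIM(real^3)" using n by simp
  then obtain d where d: "d \<noteq> 0" "\<And>y. y \<in> span (a ` facets_at v) \<Longrightarrow> orthogonal d y"
    using orthogonal_to_subspace_exists by metis
  have ad: "a F \<bullet> d = 0" if "F facet_of Q" "v \<in> F" for F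
    using d(2)[of "a F"] that by (simp add: facets_at_def span_base orthogonal_def inner_commute)
  have "eventually (\<lambda>t. v + t *\<^sub>R d \<in> Q) (at_right 0)" "eventually (\<lambda>t. v + t *\<^sub>R (- d) \<in> Q) (at_right 0)"
    by (intro eventually_feasible[OF vQ]; simp add: ad)+
  then have "eventually (\<lambda>t. t > 0 \<and> v + t *\<^sub>R d \<in> Q \<and> v - t *\<^sub>R d \<in> Q) (at_right 0)"
    using eventually_at_right_less[of 0] by eventually_elim auto
  then obtain t where t: "t > 0" "v + t *\<^sub>R d \<in> Q" "v - t *\<^sub>R d \<in> Q"
    using eventually_happens by (metis (no_types, lifting) trivial_limit_at_right_real)
  have "v + t *\<^sub>R d \<noteq> v - t *\<^sub>R d"
  proof
    assume "v + t *\<^sub>R d = v - t *\<^sub>R d"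
    then have "(2 * t) *\<^sub>R d = 0" by (simp add: algebra_simps flip: scaleR_add_left)
    then show False using t d by simp
  qed
  moreover have "midpoint (v + t *\<^sub>R d) (v - t *\<^sub>R d) = v" by (simp add: midpoint_def)
  ultimately have "v \<in> open_segment (v + t *\<^sub>R d) (v - t *\<^sub>R d)"
    using midpoint_in_open_segment[of "v + t *\<^sub>R d" "v - t *\<^sub>R d"] by simp
  then show False using assms t by (auto simp: extreme_point_of_def)
qed

definition edges_at :: "real^3 \<Rightarrow> (real^3) set set" where
  "edges_at v = {E. E edge_of Q \<and> v \<in> E}"

definition corners :: "(real^3) set" where
  "corners = {v. v extreme_point_of Q}"

lemma finite_edges: "finite {E. E edge_of Q}"
  using finite_polytope_faces[OF polytope_Q] by (rule rev_finite_subset) (auto simp: edge_of_def)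

lemma finite_edges_at: "finite (edges_at v)"
  unfolding edges_at_def using finite_edges by (rule rev_finite_subset) auto

lemma finite_corners: "finite corners"
  unfolding corners_def using finite_polyhedron_extreme_points[OF polyhedron_Q] .

text \<open>Count the incident pairs of an edge and a facet at \<open>v\<close>: an edge lies in two
  facets, and a facet has two edges at \<open>v\<close>. Both facts are the ridge lemma, applied to
  \<open>Q\<close> and, with the ridge \<open>{v}\<close>, to the facet.\<close>

lemma card_edges_at:
  assumes "v extreme_point_of Q"
  shows "card (edges_at v) = card (facets_at v)"
proof -
  have "(\<Sum>E\<in>edges_at v. card {F \<in> facets_at v. E \<subseteq> F}) = 2 * card (facets_at v)"
  proof (rule sum_multicount[OF finite_edges_at finite_facets_at], intro ballI)
    fix F assume "F \<in> facets_at v"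
    then have F: "F facet_of Q" "v \<in> F" by (auto simp: facets_at_def)
    have "v extreme_point_of F" using assms F extreme_point_of_face facet_face by blast
    then have "{v} face_of F" by (simp add: face_of_singleton)
    moreover have "polyhedron F"
      using face_of_polytope_polytope[OF polytope_Q] facet_face[OF F(1)] polytope_imp_polyhedron by blast
    ultimately have "card {E. E facet_of F \<and> {v} \<subseteq> E} = 2"
      using facet_face[OF F(1)] by (intro facets_containing_ridge) auto
    also have "{E. E facet_of F \<and> {v} \<subseteq> E} = {E \<in> edges_at v. E \<subseteq> F}"
      using edge_iff_facet_of_facet[OF F(1)] by (auto simp: edges_at_def)
    finally show "card {E \<in> edges_at v. E \<subseteq> F} = 2" .
  qed
  moreover have "(\<Sum>E\<in>edges_at v. card {F \<in> facets_at v. E \<subseteq> F}) = (\<Sum>E\<in>edges_at v. 2)"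
  proof (rule sum.cong)
    fix E assume "E \<in> edges_at v"
    then have "{F \<in> facets_at v. E \<subseteq> F} = {F. F facet_of Q \<and> E \<subseteq> F}" "E edge_of Q"
      by (auto simp: edges_at_def facets_at_def)
    then show "card {F \<in> facets_at v. E \<subseteq> F} = 2" using facets_containing_edge by simp
  qed simp
  ultimately show ?thesis by simp
qed

lemma edge_corners:
  assumes "E edge_of Q" "v \<in> corners" "v \<in> E"
  obtains w where "w \<in> corners" "w \<noteq> v" "E = closed_segment v w" "{u \<in> corners. u \<in> E} = {v, w}"
proof -
  obtain x y where xy: "x \<noteq> y" "E = closed_segment x y" "x extreme_point_of Q" "y extreme_point_of Q"
    using edge_of_polytope_segment[OF polytope_Q assms(1)] .
  have "u = x \<or> u = y" if u: "u \<in> corners" "u \<in> E" for u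
  proof -
    have "u extreme_point_of E"
      using extreme_point_of_face[of E Q u] u edge_face[OF assms(1)] by (simp add: corners_def)
    then show ?thesis unfolding xy(2) extreme_point_of_segment .
  qed
  then have c: "{u \<in> corners. u \<in> E} = {x, y}" using xy by (auto simp: corners_def)
  have "v = x \<or> v = y" using c assms(2,3) by blast
  then show ?thesis
  proof
    assume "v = x"
    then show ?thesis using that[of y] xy c by (simp add: corners_def)
  next
    assume "v = y"
    then show ?thesis using that[of x] xy c by (simp add: corners_def closed_segment_commute insert_commute)
  qed
qed

lemma card_corners_of_edge:
  assumes "E edge_of Q"
  shows "card {v \<in> corners. v \<in> E} = 2"
proof -
  obtain x y where xy: "x \<noteq> y" "E = closed_segment x y" "x extreme_point_of Q" "y extreme_point_of Q"
    using edge_of_polytope_segment[OF polytope_Q assms(1)] .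
  then have "x \<in> corners" "x \<in> E" by (auto simp: corners_def)
  from edge_corners[OF assms this] obtain w where "w \<noteq> x" "{u \<in> corners. u \<in> E} = {x, w}" .
  then show ?thesis by simp
qed

lemma card_corners_gt_degree:
  assumes "v \<in> corners"
  shows "card (edges_at v) < card corners"
proof -
  have "\<exists>w. w \<in> corners - {v} \<and> E = closed_segment v w" if "E \<in> edges_at v" for E
  proof -
    have E: "E edge_of Q" "v \<in> E" using that by (auto simp: edges_at_def)
    from edge_corners[OF E(1) assms E(2)] obtain w where "w \<in> corners" "w \<noteq> v" "E = closed_segment v w" .
    then show ?thesis by blast
  qed
  then obtain f where f: "\<And>E. E \<in> edges_at v \<Longrightarrow> f E \<in> corners - {v} \<and> E = closed_segment v (f E)"
    by metis
  have "inj_on f (edges_at v)" using f by (metis inj_onI)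
  then have "card (edges_at v) \<le> card (corners - {v})"
    using f finite_corners by (intro card_inj_on_le[of f]) auto
  also have "\<dots> < card corners" using assms finite_corners by (intro psubset_card_mono) auto
  finally show ?thesis .
qed

lemma card_flags:
  "(\<Sum>F\<in>{F. F facet_of Q}. card {E. E facet_of F}) = (\<Sum>v\<in>corners. card (edges_at v))"
proof -
  have "(\<Sum>F\<in>{F. F facet_of Q}. card {E. E facet_of F})
      = (\<Sum>F\<in>{F. F facet_of Q}. card {E \<in> {E. E edge_of Q}. E \<subseteq> F})"
    by (intro sum.cong) (simp_all add: edge_iff_facet_of_facet)
  also have "\<dots> = 2 * card {E. E edge_of Q}"
    by (rule sum_multicount[OF finite_facets finite_edges]) (simp add: facets_containing_edge)
  also have "\<dots> = (\<Sum>v\<in>corners. card {E \<in> {E. E edge_of Q}. v \<in> E})"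
    by (rule sum_multicount[OF finite_corners finite_edges, symmetric]) (simp add: card_corners_of_edge)
  finally show ?thesis by (simp add: edges_at_def)
qed

section \<open>Combinatorics of the intersection with the open ball\<close>

text \<open>\<open>E\<close> is the smallest face of \<open>Q\<close> containing a relative interior
  point \<open>x\<close> of \<open>e\<close>. Minimality puts \<open>x\<close> in the relative
  interior of \<open>E\<close>, since otherwise a facet of \<open>E\<close> would be a smaller face;
  and faces whose relative interiors share a point coincide.\<close>

lemma face_of_slice_obtain:
  assumes "e face_of (Q \<inter> hyp3)" "e \<noteq> {}"
  obtains E where "E face_of Q" "e = E \<inter> hyp3"
proof -
  have ce: "convex e" using assms(1) face_of_imp_convex by blast
  then obtain x where x: "x \<in> rel_interior e" using assms(2) rel_interior_eq_empty by blast
  have xe: "x \<in> e" using x rel_interior_subset by blast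
  have xQ: "x \<in> Q" "x \<in> hyp3" using xe assms(1) face_of_imp_subset by blast+
  define \<F> where "\<F> = {F. F face_of Q \<and> x \<in> F}"
  define E where "E = \<Inter>\<F>"
  have "Q \<in> \<F>" using xQ convex_Q by (simp add: \<F>_def face_of_refl)
  then have E: "E face_of Q" unfolding E_def by (intro face_of_Inter) (auto simp: \<F>_def)
  have xE: "x \<in> E" by (auto simp: E_def \<F>_def)
  have cE: "convex E" using E face_of_imp_convex by blast
  have poly: "polyhedron E" using face_of_polytope_polytope[OF polytope_Q E] polytope_imp_polyhedron by blast
  have "x \<in> rel_interior E"
  proof (rule ccontr)
    assume "x \<notin> rel_interior E"
    then obtain G where G: "G facet_of E" "x \<in> G" using xE rel_interior_of_polyhedron[OF poly] by blast
    then have "G face_of Q" using E face_of_trans facet_of_imp_face_of by blast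
    then have "E \<subseteq> G" using G(2) by (auto simp: E_def \<F>_def)
    then have "G = E" using G(1) facet_of_imp_subset by blast
    then show False using G(1) facet_of_irrefl by blast
  qed
  moreover have "rel_interior (E \<inter> hyp3) = rel_interior E \<inter> hyp3"
  proof -
    have "rel_interior hyp3 = hyp3" by (simp add: rel_interior_open)
    then have "rel_interior E \<inter> rel_interior hyp3 \<noteq> {}" using calculation xQ by blast
    from convex_rel_interior_inter_two[OF cE convex_hyp3 this] show ?thesis
      using \<open>rel_interior hyp3 = hyp3\<close> by simp
  qed
  ultimately have "x \<in> rel_interior (E \<inter> hyp3)" using xQ by blast
  moreover have "(E \<inter> hyp3) face_of (Q \<inter> hyp3)" using E by (intro face_of_slice) auto
  ultimately have "e = E \<inter> hyp3" using face_of_eq[OF assms(1)] x by blast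
  then show ?thesis using that E by blast
qed

text \<open>The closure of the slice is \<open>Q\<close>, so the ideal vertices are all points of
  \<open>Q\<close> on the sphere, and strict convexity of the ball makes these extreme. A finite
  vertex of the slice comes from a face of dimension 0, because faces of positive dimension keep
  their dimension in the slice.\<close>

lemma vertices_eq_corners: "vertices (Q \<inter> hyp3) = corners"
proof -
  have clo: "closure (Q \<inter> hyp3) = Q"
    using face_slice(6)[of Q] convex_Q aff_dim_Q by (simp add: face_of_refl)
  have 1: "v extreme_point_of (Q \<inter> hyp3) \<longleftrightarrow> v extreme_point_of Q \<and> v \<in> hyp3" for v
  proof
    assume "v extreme_point_of (Q \<inter> hyp3)"
    then have "{v} face_of (Q \<inter> hyp3)" by (simp add: face_of_singleton)
    then obtain E where E: "E face_of Q" "{v} = E \<inter> hyp3" using face_of_slice_obtain by blast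
    have "\<not> aff_dim E \<ge> 1"
      using face_slice(3)[OF E(1)] by (auto simp flip: E(2))
    moreover have "v \<in> E" using E(2) by blast
    then have "\<not> aff_dim E < 0" by auto
    ultimately have "aff_dim E = 0" by linarith
    then obtain w where "E = {w}" using aff_dim_eq_0 by blast
    then show "v extreme_point_of Q \<and> v \<in> hyp3" using E \<open>v \<in> E\<close> by (auto simp: face_of_singleton)
  next
    assume "v extreme_point_of Q \<and> v \<in> hyp3"
    then show "v extreme_point_of (Q \<inter> hyp3)" by (auto simp: extreme_point_of_def)
  qed
  have 2: "v extreme_point_of Q" if v: "v \<in> Q" "norm v = 1" for v
    unfolding extreme_point_of_def
  proof (intro conjI ballI v)
    fix x y assume xy: "x \<in> Q" "y \<in> Q"
    show "v \<notin> open_segment x y"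
    proof
      assume o: "v \<in> open_segment x y"
      have n: "norm x \<le> 1" "norm y \<le> 1" using xy Q_cball by auto
      have "dist 0 v < dist 0 x \<or> dist 0 v < dist 0 y" using dist_decreases_open_segment[OF o] by blast
      then show False using n v by simp
    qed
  qed
  have 3: "norm v = 1 \<or> v \<in> hyp3" if "v \<in> Q" for v
    using Q_cball that by (force simp: hyp3_def)
  have 4: "v \<in> vertices (Q \<inter> hyp3) \<longleftrightarrow> v extreme_point_of (Q \<inter> hyp3) \<or> v \<in> Q \<and> norm v = 1" for v
    by (simp add: vertices_def finite_vertices_def ideal_vertices_def clo)
  have "v \<in> vertices (Q \<inter> hyp3) \<longleftrightarrow> v \<in> corners" for v
    unfolding 4 1 corners_def mem_Collect_eq using 2[of v] 3[of v] by (auto simp: extreme_point_of_def)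
  then show ?thesis by blast
qed

text \<open>Intersection with the open ball and closure are inverse bijections between the edges of
  \<open>Q\<close> and those of the slice.\<close>

lemma vertex_degree_eq: "vertex_degree (Q \<inter> hyp3) v = card (edges_at v)"
proof -
  have "bij_betw (\<lambda>E. E \<inter> hyp3) (edges_at v) {e. e edge_of (Q \<inter> hyp3) \<and> v \<in> closure e}"
  proof (rule bij_betwI[where g = closure])
    show "(\<lambda>E. E \<inter> hyp3) \<in> edges_at v \<rightarrow> {e. e edge_of (Q \<inter> hyp3) \<and> v \<in> closure e}"
    proof
      fix E assume "E \<in> edges_at v"
      then have E: "E face_of Q" "aff_dim E = 1" "v \<in> E" by (auto simp: edges_at_def edge_of_def)
      then show "E \<inter> hyp3 \<in> {e. e edge_of (Q \<inter> hyp3) \<and> v \<in> closure e}"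
        using face_slice[OF E(1)] by (simp add: edge_of_def)
    qed
    have *: "\<exists>E. E \<in> edges_at v \<and> e = E \<inter> hyp3 \<and> closure e = E"
      if e: "e edge_of (Q \<inter> hyp3)" "v \<in> closure e" for e
    proof -
      have "e face_of (Q \<inter> hyp3)" "e \<noteq> {}" "aff_dim e = 1" using e by (auto simp: edge_of_def)
      then obtain E where E: "E face_of Q" "e = E \<inter> hyp3" using face_of_slice_obtain by metis
      have "aff_dim e \<le> aff_dim E" unfolding E(2) by (rule aff_dim_subset) auto
      then have d: "aff_dim E \<ge> 1" using \<open>aff_dim e = 1\<close> by simp
      have "aff_dim E = 1" "closure e = E" using face_slice(3,6)[OF E(1) d] \<open>aff_dim e = 1\<close> E(2) by auto
      then show ?thesis using E e(2) by (auto simp: edges_at_def edge_of_def)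
    qed
    show "closure \<in> {e. e edge_of (Q \<inter> hyp3) \<and> v \<in> closure e} \<rightarrow> edges_at v" using * by fastforce
    show "closure (E \<inter> hyp3) = E" if "E \<in> edges_at v" for E
      using that face_slice(6)[of E] by (auto simp: edges_at_def edge_of_def)
    show "closure e \<inter> hyp3 = e" if "e \<in> {e. e edge_of (Q \<inter> hyp3) \<and> v \<in> closure e}" for e
      using that * by fastforce
  qed
  then show ?thesis by (simp add: vertex_degree_def bij_betw_same_card)
qed

lemma card_edges_at_cases:
  assumes "v \<in> corners"
  shows "card (edges_at v) = 3 \<or> card (edges_at v) = 4"
proof -
  have v: "v extreme_point_of Q" using assms by (simp add: corners_def)
  then have "v \<in> Q" by (simp add: extreme_point_of_def)
  then show ?thesis
    using card_facets_at_le_4 card_facets_at_ge_3[OF v] card_edges_at[OF v] by force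
qed

lemma volume_bound:
  assumes N4: "card {v \<in> vertices (Q \<inter> hyp3). vertex_degree (Q \<inter> hyp3) v = 4} = N4"
    and N3: "card {v \<in> vertices (Q \<inter> hyp3). vertex_degree (Q \<inter> hyp3) v = 3} = N3"
  shows "hyp_volume (Q \<inter> hyp3) <
    (2 * real N4 + 3 * real N3 - 2) / 4 * V8 + (15 * real N3 + 20 * real N4) / 16 * V3"
proof -
  have "Q \<noteq> {}" using interior_Q interior_subset by blast
  then obtain v where v: "v \<in> corners"
    using extreme_point_exists_convex[of Q] polytope_Q polytope_imp_compact polytope_imp_convex
    unfolding corners_def by blast
  define C4 where "C4 = {v \<in> corners. card (edges_at v) = 4}"
  define C3 where "C3 = {v \<in> corners. card (edges_at v) = 3}"
  have c: "card C4 = N4" "card C3 = N3"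
    using N4 N3 by (simp_all add: C4_def C3_def vertices_eq_corners vertex_degree_eq)
  have un: "corners = C4 \<union> C3" "C4 \<inter> C3 = {}"
    using card_edges_at_cases by (auto simp: C4_def C3_def)
  have fin: "finite C4" "finite C3" using finite_corners by (auto simp: C4_def C3_def)
  have N: "card corners = N4 + N3" unfolding un(1) using un(2) fin c by (simp add: card_Un_disjoint)
  have "(\<Sum>v\<in>corners. card (edges_at v)) = (\<Sum>v\<in>C4. card (edges_at v)) + (\<Sum>v\<in>C3. card (edges_at v))"
    unfolding un(1) using un(2) fin by (intro sum.union_disjoint)
  also have "\<dots> = 4 * N4 + 3 * N3" using c by (simp add: C4_def C3_def)
  finally have flags: "(\<Sum>F\<in>{F. F facet_of Q}. card {E. E facet_of F}) = 4 * N4 + 3 * N3"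
    by (simp add: card_flags)
  have "emeasure hyp_measure (Q \<inter> hyp3) \<le> emeasure hyp_measure Q"
    using closed_Q by (intro emeasure_mono) (auto simp: borel_closed)
  also have "\<dots> \<le> ennreal (14 / 25 * real (4 * N4 + 3 * N3))"
    using emeasure_hyp_polytope_le[OF polytope_Q Q_cball aff_dim_Q] unfolding flags .
  finally have "hyp_volume (Q \<inter> hyp3) \<le> 14 / 25 * real (4 * N4 + 3 * N3)"
    unfolding hyp_volume_def measure_def by (intro enn2real_leI) auto
  also have "\<dots> < (2 * real N4 + 3 * real N3 - 2) / 4 * 3 + (15 * real N3 + 20 * real N4) / 16 * (209 / 250)"
  proof -
    have gt: "card (edges_at v) < N4 + N3" using card_corners_gt_degree[OF v] N by simp
    \<comment> \<open>Any vertex has degree at least 3, hence there are at least four vertices; if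
      all have degree 4, there are at least five. The distinction matters: four vertices of degree 4
      would violate the numerical inequality.\<close>
    have "N3 \<ge> 1 \<and> N4 + N3 \<ge> 4 \<or> N4 \<ge> 5"
    proof (cases "N3 = 0")
      case True
      then have "C3 = {}" using c fin by simp
      then have "v \<in> C4" using v un by blast
      then show ?thesis using gt True by (simp add: C4_def)
    next
      case False
      then show ?thesis using gt card_edges_at_cases[OF v] by linarith
    qed
    then show ?thesis
    proof
      assume "N3 \<ge> 1 \<and> N4 + N3 \<ge> 4"
      then have "real N3 \<ge> 1" "real N4 + real N3 \<ge> 4" by linarith+
      then show ?thesis by (simp add: field_simps)
    next
      assume "N4 \<ge> 5"
      then have "real N4 \<ge> 5" "real N3 \<ge> 0" by linarith+
      then show ?thesis by (simp add: field_simps)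
    qed
  qed
  also have "\<dots> \<le> (2 * real N4 + 3 * real N3 - 2) / 4 * V8 + (15 * real N3 + 20 * real N4) / 16 * V3"
  proof (intro add_mono mult_left_mono V8_ge V3_ge)
    \<comment> \<open>\<open>V8\<close> may be replaced by its lower bound only if its coefficient
      is non-negative; a single vertex ensures that.\<close>
    show "0 \<le> (2 * real N4 + 3 * real N3 - 2) / 4"
    proof -
      have "card corners > 0" using v finite_corners by (auto simp: card_gt_0_iff)
      then have "real N4 + real N3 \<ge> 1" using N by linarith
      then show ?thesis by simp
    qed
  qed auto
  finally show ?thesis .
qed

end

section \<open>From half-spaces to a polytope\<close>

text \<open>\<open>Q\<close> is the intersection of the closed Euclidean half-spaces. Every point
  \<open>y\<close> of \<open>Q\<close> in the ball is a limit of points on the segment to some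
  \<open>q\<close> in the open intersection, and these satisfy the strict inequalities. For an empty
  family \<open>Q\<close> is the whole space; finite volume excludes this later.\<close>

lemma open_hyp_halfspaces_closure:
  assumes "finite \<H>" "\<And>H. H \<in> \<H> \<Longrightarrow> open_hyp_halfspace H" and ne: "hyp3 \<inter> \<Inter>\<H> \<noteq> {}"
  obtains Q where "closed Q" "convex Q" "polyhedron Q" "open (hyp3 \<inter> \<Inter>\<H>)" "hyp3 \<inter> \<Inter>\<H> \<subseteq> Q"
    "top_of_set hyp3 closure_of (hyp3 \<inter> \<Inter>\<H>) = Q \<inter> hyp3"
proof -
  have "\<forall>H\<in>\<H>. \<exists>a b. a \<noteq> 0 \<and> H = hyp3 \<inter> {x. a \<bullet> x < b}"
  proof
    fix H assume "H \<in> \<H>"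
    then obtain a b where "\<bar>b\<bar> < norm a" "H = {x \<in> hyp3. a \<bullet> x < b}"
      using assms(2)[of H] unfolding open_hyp_halfspace_def by blast
    then show "\<exists>a b. a \<noteq> 0 \<and> H = hyp3 \<inter> {x. a \<bullet> x < b}" by (intro exI[of _ a] exI[of _ b]) auto
  qed
  then obtain a b where ab: "\<And>H. H \<in> \<H> \<Longrightarrow> a H \<noteq> 0 \<and> H = hyp3 \<inter> {x. a H \<bullet> x < b H}"
    by metis
  define U where "U = (\<Inter>H\<in>\<H>. {x. a H \<bullet> x < b H})"
  define Q where "Q = (\<Inter>H\<in>\<H>. {x. a H \<bullet> x \<le> b H})"
  have hU: "hyp3 \<inter> \<Inter>\<H> = hyp3 \<inter> U" using ab by (auto simp: U_def)
  have oU: "open U" unfolding U_def using assms(1) by (intro open_INT) (auto simp: open_halfspace_lt)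
  have cQ: "closed Q" unfolding Q_def by (intro closed_INT) (auto simp: closed_halfspace_le)
  have cvQ: "convex Q" unfolding Q_def by (intro convex_INT) (auto simp: convex_halfspace_le)
  have pQ: "polyhedron Q" unfolding Q_def
    using assms(1) by (intro polyhedron_Inter) (auto simp: polyhedron_halfspace_le)
  have UQ: "U \<subseteq> Q" by (force simp: U_def Q_def)
  obtain q where q: "q \<in> hyp3" "q \<in> U" using ne hU by blast
  have "hyp3 \<inter> closure (hyp3 \<inter> U) = Q \<inter> hyp3"
  proof
    have "closure (hyp3 \<inter> U) \<subseteq> Q" using UQ cQ by (intro closure_minimal) auto
    then show "hyp3 \<inter> closure (hyp3 \<inter> U) \<subseteq> Q \<inter> hyp3" by blast
    show "Q \<inter> hyp3 \<subseteq> hyp3 \<inter> closure (hyp3 \<inter> U)"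
    proof
      fix y assume y: "y \<in> Q \<inter> hyp3"
      have "(1 - t) *\<^sub>R y + t *\<^sub>R q \<in> hyp3 \<inter> U" if t: "0 < t" "t < 1" for t
      proof
        show "(1 - t) *\<^sub>R y + t *\<^sub>R q \<in> hyp3" using y q t by (intro convexD) auto
        show "(1 - t) *\<^sub>R y + t *\<^sub>R q \<in> U"
          unfolding U_def
        proof (clarsimp simp: inner_add_right)
          fix H assume H: "H \<in> \<H>"
          have "(1 - t) * (a H \<bullet> y) \<le> (1 - t) * b H" using y t H by (intro mult_left_mono) (auto simp: Q_def)
          moreover have "t * (a H \<bullet> q) < t * b H" using q t H by (simp add: U_def)
          ultimately show "(1 - t) * (a H \<bullet> y) + t * (a H \<bullet> q) < b H" by (simp add: algebra_simps)
        qed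
      qed
      then have "(1 - t) *\<^sub>R y + t *\<^sub>R q \<in> closure (hyp3 \<inter> U)" if "0 < t" "t < 1" for t
        using that closure_subset by blast
      then have "eventually (\<lambda>t. (1 - t) *\<^sub>R y + t *\<^sub>R q \<in> closure (hyp3 \<inter> U)) (at_right 0)"
        by (auto simp: eventually_at_right_field intro!: exI[of _ 1])
      moreover have "((\<lambda>t. (1 - t) *\<^sub>R y + t *\<^sub>R q) \<longlongrightarrow> (1 - 0) *\<^sub>R y + 0 *\<^sub>R q) (at_right 0)"
        by (intro tendsto_intros)
      ultimately have "(1 - 0) *\<^sub>R y + 0 *\<^sub>R q \<in> closure (hyp3 \<inter> U)"
        by (intro Lim_in_closed_set[OF closed_closure]) auto
      then show "y \<in> hyp3 \<inter> closure (hyp3 \<inter> U)" using y by simp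
    qed
  qed
  then have "top_of_set hyp3 closure_of (hyp3 \<inter> \<Inter>\<H>) = Q \<inter> hyp3"
    unfolding hU closure_of_subtopology by simp
  then show ?thesis using that[of Q] cQ cvQ pQ UQ hU oU by (simp add: open_Int) (use hU in blast)
qed

theorem corollary7p4:
  fixes P :: "(real^3) set" and N3 N4 :: nat
  assumes "hyp_polyhedron P"
    and "finite_hyp_volume P"
    and "non_obtuse P"
    and "card {v \<in> vertices P. vertex_degree P v = 4} = N4"
    and "card {v \<in> vertices P. vertex_degree P v = 3} = N3"
  shows "hyp_volume P <
    (2 * real N4 + 3 * real N3 - 2) / 4 * V8 + (15 * real N3 + 20 * real N4) / 16 * V3"
proof -
  obtain \<H> where H: "finite \<H>" "\<forall>H\<in>\<H>. open_hyp_halfspace H" "hyp3 \<inter> \<Inter>\<H> \<noteq> {}"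
      "P = (top_of_set hyp3) closure_of (hyp3 \<inter> \<Inter>\<H>)"
    using assms(1) by (auto simp: hyp_polyhedron_def)
  obtain Q where Q: "closed Q" "convex Q" "polyhedron Q" "open (hyp3 \<inter> \<Inter>\<H>)" "hyp3 \<inter> \<Inter>\<H> \<subseteq> Q" "P = Q \<inter> hyp3"
    using open_hyp_halfspaces_closure[OF H(1) _ H(3)] H(2,4) by metis
  obtain q where q: "q \<in> hyp3 \<inter> \<Inter>\<H>" using H(3) by blast
  then obtain r where r: "r > 0" "ball q r \<subseteq> hyp3 \<inter> \<Inter>\<H>" using Q(4) open_contains_ball by blast
  have int: "interior Q \<noteq> {}" using q Q(4,5) interior_maximal by blast
  have "emeasure hyp_measure (Q \<inter> hyp3) < \<infinity>" using assms(2) Q(6) by (simp add: finite_hyp_volume_def)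
  then have cb: "Q \<subseteq> cball 0 1"
    using r q Q(5) by (intro finite_hyp_measure_imp_subset_cball[OF Q(2,1), of r q]) auto
  then have poly: "polytope Q" using Q(3) bounded_subset[OF bounded_cball] by (simp add: polytope_eq_bounded_polyhedron)
  have "\<exists>a b. a \<noteq> 0 \<and> (\<forall>x\<in>Q. a \<bullet> x \<le> b) \<and> F = Q \<inter> {x. a \<bullet> x = b}" if F: "F facet_of Q" for F
  proof -
    obtain a b where "a \<noteq> 0" "Q \<subseteq> {x. a \<bullet> x \<le> b}" "F = Q \<inter> {x. a \<bullet> x = b}"
      using facet_of_polyhedron[OF Q(3) F] by metis
    then show ?thesis by blast
  qed
  then obtain a b where ab: "\<And>F. F facet_of Q \<Longrightarrow>
      a F \<noteq> 0 \<and> (\<forall>x\<in>Q. a F \<bullet> x \<le> b F) \<and> F = Q \<inter> {x. a F \<bullet> x = b F}" by metis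
  interpret klein_polytope Q a b
  proof
    show "F = Q \<inter> {x. a F \<bullet> x = b F}" if "F facet_of Q" for F using ab[OF that] by blast
  qed (use poly cb int ab assms(3) Q(6) in auto)
  show ?thesis using volume_bound assms(4,5) unfolding Q(6) by blast
qed

end
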